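(* Let $K$ be a field, $S=K[x_1,\dots,x_n]$, $k\in\{1,\dots,n\}$, and let $M$ be a finitely generated $\mathbb{Z}^n$-graded $S$-module. If $\beta_p^{k,lin}(M)\neq 0$ for some $p\geq k$, then $$\beta_i^{k,lin}(M)\geq\binom{p}{i}\quad\text{for } i=k,\dots,p.$$
   Context: $S$ is $\mathbb{Z}^n$-graded by $\deg(x_i)=\epsilon_i$, the $i$-th standard basis vector of $\mathbb{Z}^n$. A $\mathbb{Z}^n$-graded module $M$ is regarded as $\mathbb{Z}$-graded via $M_i=\bigoplus_{a\in\mathbb{Z}^n,\,|a|=i}M_a$, where $|a|=a_1+\dots+a_n$; the following refer to this $\mathbb{Z}$-grading. For $M\neq0$, $\beta_{i,i+j}(M)=\dim_K\operatorname{Tor}^S_i(M,K)_{i+j}$, $\operatorname{reg}(M)=\max\{j\in\mathbb{Z}: \beta_{i,i+j}(M)\neq 0 \text{ for some } i\in\mathbb{N}\}$, $d_k(M)=\min(\{j\in\mathbb{Z}:\beta_{k,k+j}(M)\neq 0\}\cup\{\operatorname{reg}(M)\})$, and $\beta_i^{k,lin}(M)=\beta_{i,i+d_k(M)}(M)$ for $i\geq k$. *)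

theory Defs
  imports "HOL-Library.Poly_Mapping" "HOL-Analysis.Finite_Cartesian_Product"
begin

section \<open>The polynomial ring and graded modules\<close>

text \<open>
  The polynomial ring \<open>S = K[x\<^sub>i : i \<in> 'n]\<close>, with one variable for each element of the finite
  index type, so that \<open>n = CARD('n)\<close>: a polynomial is a finitely supported map from exponent vectors
  to coefficients, and the product of \<^typ>\<open>('n \<Rightarrow>\<^sub>0 nat) \<Rightarrow>\<^sub>0 'k\<close> is convolution.
\<close>

type_synonym ('n, 'k) mpoly = "('n \<Rightarrow>\<^sub>0 nat) \<Rightarrow>\<^sub>0 'k"

definition const_poly :: "'k::zero \<Rightarrow> ('n, 'k) mpoly"
  where "const_poly c = Poly_Mapping.single 0 c"

definition multidegree :: "('n::finite \<Rightarrow>\<^sub>0 nat) \<Rightarrow> int ^ 'n"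
  where "multidegree t = (\<chi> i. int (Poly_Mapping.lookup t i))"

definition total :: "int ^ 'n::finite \<Rightarrow> int"
  where "total a = (\<Sum>i\<in>UNIV. a $ i)"

definition poly_zn_part :: "int ^ 'n::finite \<Rightarrow> ('n, 'k::zero) mpoly set"
  where "poly_zn_part b = {f. \<forall>t\<in>Poly_Mapping.keys f. multidegree t = b}"

definition poly_z_part :: "int \<Rightarrow> ('n::finite, 'k::zero) mpoly set"
  where "poly_z_part d = {f. \<forall>t\<in>Poly_Mapping.keys f. total (multidegree t) = d}"

text \<open>
  A module is a whole type \<open>'m\<close> with a scalar multiplication by polynomials; \<open>G a\<close> is its homogeneous
  part of degree \<open>a\<close>. The last conjunct says that the module is the direct sum of its parts. Closure
  of the parts under negation and under multiplication by elements of \<open>K\<close> is the case \<open>b = 0\<close> of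
  the conjunct before it.
\<close>

definition zn_graded_module ::
    "(('n::finite, 'k::field) mpoly \<Rightarrow> 'm::ab_group_add \<Rightarrow> 'm) \<Rightarrow> (int ^ 'n \<Rightarrow> 'm set) \<Rightarrow> bool"
  where "zn_graded_module smul G \<longleftrightarrow>
    module smul \<and>
    (\<forall>a. 0 \<in> G a) \<and>
    (\<forall>a. \<forall>x\<in>G a. \<forall>y\<in>G a. x + y \<in> G a) \<and>
    (\<forall>a b. \<forall>f\<in>poly_zn_part b. \<forall>x\<in>G a. smul f x \<in> G (b + a)) \<and>
    (\<forall>x. \<exists>!c. (\<forall>a. Poly_Mapping.lookup c a \<in> G a) \<and>
               x = (\<Sum>a\<in>Poly_Mapping.keys c. Poly_Mapping.lookup c a))"

definition finitely_generated ::
    "(('n, 'k::field) mpoly \<Rightarrow> 'm::ab_group_add \<Rightarrow> 'm) \<Rightarrow> bool"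
  where "finitely_generated smul \<longleftrightarrow> (\<exists>B. finite B \<and> module.span smul B = UNIV)"

definition z_grading :: "(int ^ 'n::finite \<Rightarrow> 'm::ab_group_add set) \<Rightarrow> int \<Rightarrow> 'm set"
  where "z_grading G d = {x. \<exists>c :: int ^ 'n \<Rightarrow>\<^sub>0 'm.
    (\<forall>a\<in>Poly_Mapping.keys c. total a = d \<and> Poly_Mapping.lookup c a \<in> G a) \<and>
    x = (\<Sum>a\<in>Poly_Mapping.keys c. Poly_Mapping.lookup c a)}"


section \<open>Graded free resolutions\<close>

text \<open>
  Data for a complex \<open>\<dots> \<rightarrow> P\<^sub>1 \<rightarrow> P\<^sub>0\<close> of graded free modules of finite rank over \<open>S\<close>:
  \<open>P\<^sub>i\<close> has the basis \<open>e\<^sub>i\<^sub>,\<^sub>l\<close> for \<open>l < frank P i\<close>, with \<open>e\<^sub>i\<^sub>,\<^sub>l\<close> in degree \<open>shift P i l\<close>, that is,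
  \<open>P\<^sub>i\<close> is the direct sum of the \<open>S(- shift P i l)\<close>; the differential sends \<open>e\<^sub>i\<^sub>+\<^sub>1\<^sub>,\<^sub>m\<close> to the sum of
  the \<open>dmat P i l m * e\<^sub>i\<^sub>,\<^sub>l\<close>.
\<close>

record (overloaded) ('n, 'k) free_complex =
  frank :: "nat \<Rightarrow> nat"
  shift :: "nat \<Rightarrow> nat \<Rightarrow> int"
  dmat :: "nat \<Rightarrow> nat \<Rightarrow> nat \<Rightarrow> ('n \<Rightarrow>\<^sub>0 nat) \<Rightarrow>\<^sub>0 'k"

text \<open>
  The complex \<open>M \<otimes> P\<close> over \<open>S\<close>, with \<open>M \<otimes> S(-b)\<close> identified with \<open>M(-b)\<close> by sending
  \<open>x \<otimes> f\<close> to \<open>f x\<close>: chains in degree \<open>i\<close> are tuples of \<open>frank P i\<close> elements of \<open>M\<close> (extended by 0),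
  and the differential is given by the same matrices as that of \<open>P\<close>. For \<open>M = S\<close>, with the
  multiplication of \<open>S\<close> as \<open>smul\<close>, this is \<open>P\<close> itself. The differential leaving degree 0 is 0.
\<close>

definition tensor_chains :: "('n, 'k) free_complex \<Rightarrow> nat \<Rightarrow> (nat \<Rightarrow> 'm::zero) set"
  where "tensor_chains P i = {v. \<forall>l\<ge>frank P i. v l = 0}"

definition tensor_chains_gr ::
    "(int \<Rightarrow> 'm::zero set) \<Rightarrow> ('n, 'k) free_complex \<Rightarrow> nat \<Rightarrow> int \<Rightarrow> (nat \<Rightarrow> 'm) set"
  where "tensor_chains_gr H P i d =
    {v \<in> tensor_chains P i. \<forall>l<frank P i. v l \<in> H (d - shift P i l)}"

fun tensor_diff ::
    "(('n, 'k::field) mpoly \<Rightarrow> 'm::ab_group_add \<Rightarrow> 'm) \<Rightarrow> ('n, 'k) free_complex \<Rightarrow>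
     nat \<Rightarrow> (nat \<Rightarrow> 'm) \<Rightarrow> (nat \<Rightarrow> 'm)"
  where
    "tensor_diff smul P 0 v = (\<lambda>l. 0)"
  | "tensor_diff smul P (Suc i) v =
      (\<lambda>l. if l < frank P i then \<Sum>m<frank P (Suc i). smul (dmat P i l m) (v m) else 0)"

text \<open>
  \<open>P\<close> is a graded free resolution of the graded module \<open>N\<close> given by \<open>smulN\<close> and the \<open>\<int>\<close>-grading \<open>HN\<close>;
  \<open>e l\<close> is the image of the basis element \<open>e\<^sub>0\<^sub>,\<^sub>l\<close> under the augmentation \<open>P\<^sub>0 \<rightarrow> N\<close>.
\<close>

definition graded_free_resolution ::
    "(('n::finite, 'k::field) mpoly \<Rightarrow> 'b::ab_group_add \<Rightarrow> 'b) \<Rightarrow> (int \<Rightarrow> 'b set) \<Rightarrow>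
     ('n, 'k) free_complex \<Rightarrow> bool"
  where "graded_free_resolution smulN HN P \<longleftrightarrow>
    (\<forall>i. \<forall>l<frank P i. \<forall>m<frank P (Suc i).
       dmat P i l m \<in> poly_z_part (shift P (Suc i) m - shift P i l)) \<and>
    (\<exists>e. (\<forall>l<frank P 0. e l \<in> HN (shift P 0 l)) \<and>
         (\<forall>y. \<exists>v\<in>tensor_chains P 0. y = (\<Sum>l<frank P 0. smulN (v l) (e l))) \<and>
         {v \<in> tensor_chains P 0. (\<Sum>l<frank P 0. smulN (v l) (e l)) = 0} =
           tensor_diff (*) P 1 ` tensor_chains P 1) \<and>
    (\<forall>i. {v \<in> tensor_chains P (Suc i). tensor_diff (*) P (Suc i) v = (\<lambda>l. 0)} =
           tensor_diff (*) P (Suc (Suc i)) ` tensor_chains P (Suc (Suc i)))"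


section \<open>Tor and graded Betti numbers\<close>

text \<open>
  The dimension of a quotient \<open>Z / B\<close> of two subspaces of the space of sequences in \<open>M\<close>: the number
  of elements of a finite set of representatives in \<open>Z\<close> whose classes form a basis of \<open>Z / B\<close>
  (and, as for \<^const>\<open>vector_space.dim\<close>, 0 if there is none).
\<close>

definition quotient_basis ::
    "(('n, 'k::field) mpoly \<Rightarrow> 'm::ab_group_add \<Rightarrow> 'm) \<Rightarrow>
     (nat \<Rightarrow> 'm) set \<Rightarrow> (nat \<Rightarrow> 'm) set \<Rightarrow> (nat \<Rightarrow> 'm) set \<Rightarrow> bool"
  where "quotient_basis smul Z B C \<longleftrightarrow>
    finite C \<and> C \<subseteq> Z \<and>
    (\<forall>u :: (nat \<Rightarrow> 'm) \<Rightarrow> 'k.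
       (\<lambda>l. \<Sum>c\<in>C. smul (const_poly (u c)) (c l)) \<in> B \<longrightarrow> (\<forall>c\<in>C. u c = 0)) \<and>
    (\<forall>z\<in>Z. \<exists>u :: (nat \<Rightarrow> 'm) \<Rightarrow> 'k.
       (\<lambda>l. z l - (\<Sum>c\<in>C. smul (const_poly (u c)) (c l))) \<in> B)"

definition quotient_dim ::
    "(('n, 'k::field) mpoly \<Rightarrow> 'm::ab_group_add \<Rightarrow> 'm) \<Rightarrow>
     (nat \<Rightarrow> 'm) set \<Rightarrow> (nat \<Rightarrow> 'm) set \<Rightarrow> nat"
  where "quotient_dim smul Z B =
    (if \<exists>C. quotient_basis smul Z B C then card (SOME C. quotient_basis smul Z B C) else 0)"

text \<open>
  The dimension over \<open>K\<close> of the degree \<open>d\<close> part of \<open>Tor\<^sub>i(M, N)\<close>, that is, of the \<open>i\<close>-th homology of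
  \<open>M \<otimes> P\<close> for a graded free resolution \<open>P\<close> of the finitely generated graded module \<open>N\<close>. It does not
  depend on the choice of \<open>P\<close>.
\<close>

definition tor_dim ::
    "(('n::finite, 'k::field) mpoly \<Rightarrow> 'm::ab_group_add \<Rightarrow> 'm) \<Rightarrow> (int \<Rightarrow> 'm set) \<Rightarrow>
     (('n, 'k) mpoly \<Rightarrow> 'b::ab_group_add \<Rightarrow> 'b) \<Rightarrow> (int \<Rightarrow> 'b set) \<Rightarrow>
     nat \<Rightarrow> int \<Rightarrow> nat"
  where "tor_dim smulM HM smulN HN i d =
    (let P = (SOME P. graded_free_resolution smulN HN P)
     in quotient_dim smulM
          {v \<in> tensor_chains_gr HM P i d. tensor_diff smulM P i v = (\<lambda>l. 0)}
          (tensor_diff smulM P (Suc i) ` tensor_chains_gr HM P (Suc i) d))"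

text \<open>\<open>K = S / (x\<^sub>i : i \<in> 'n)\<close> as a graded module, concentrated in degree 0.\<close>

definition residue_smul :: "('n, 'k::field) mpoly \<Rightarrow> 'k \<Rightarrow> 'k"
  where "residue_smul f c = Poly_Mapping.lookup f 0 * c"

definition residue_grading :: "int \<Rightarrow> 'k::field set"
  where "residue_grading d = (if d = 0 then UNIV else {0})"

text \<open>
  In the following, \<open>G\<close> is a \<open>\<int>\<^sup>n\<close>-grading of \<open>M\<close>, and \<open>betti smul G i d\<close> is \<open>\<beta>\<^sub>i\<^sub>,\<^sub>d(M)\<close>
  (internal degree \<open>d\<close>, not \<open>i + d\<close>) for the induced \<open>\<int>\<close>-grading. \<open>regularity\<close> is only
  meaningful for \<open>M \<noteq> 0\<close>.
\<close>

definition betti ::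
    "(('n::finite, 'k::field) mpoly \<Rightarrow> 'm::ab_group_add \<Rightarrow> 'm) \<Rightarrow> (int ^ 'n \<Rightarrow> 'm set) \<Rightarrow>
     nat \<Rightarrow> int \<Rightarrow> nat"
  where "betti smul G i d =
    tor_dim smul (z_grading G) (residue_smul :: ('n, 'k) mpoly \<Rightarrow> 'k \<Rightarrow> 'k) residue_grading i d"

definition regularity ::
    "(('n::finite, 'k::field) mpoly \<Rightarrow> 'm::ab_group_add \<Rightarrow> 'm) \<Rightarrow> (int ^ 'n \<Rightarrow> 'm set) \<Rightarrow> int"
  where "regularity smul G = (GREATEST j. \<exists>i. betti smul G i (int i + j) \<noteq> 0)"

definition lin_degree ::
    "(('n::finite, 'k::field) mpoly \<Rightarrow> 'm::ab_group_add \<Rightarrow> 'm) \<Rightarrow> (int ^ 'n \<Rightarrow> 'm set) \<Rightarrow>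
     nat \<Rightarrow> int"
  where "lin_degree smul G k =
    (LEAST j. j \<in> {j. betti smul G k (int k + j) \<noteq> 0} \<union> {regularity smul G})"

definition betti_lin ::
    "(('n::finite, 'k::field) mpoly \<Rightarrow> 'm::ab_group_add \<Rightarrow> 'm) \<Rightarrow> (int ^ 'n \<Rightarrow> 'm set) \<Rightarrow>
     nat \<Rightarrow> nat \<Rightarrow> nat"
  where "betti_lin smul G k i = betti smul G i (int i + lin_degree smul G k)"

end

(*
  Tor(M, K) is the homology of the Koszul complex K(M), which is graded by Z^n; fix d = d_k(M).  By
  the choice of d, the homology H_k(K(M)) vanishes in the multidegrees a with |a| - k < d.

  Let K_A(M) be the Koszul complex of the variables x_i with i in A.  As K_A is the mapping cone of
  x_i on K_{A - i}, an induction on |a| shows that, in the strands up to d, a cycle of K_A that is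
  a boundary in K(M) is already a boundary in K_A.  Hence, if z is a cycle of K_{q+1}(M) and the
  contraction of z with e_i is a boundary, then z is homologous to a cycle without e_i.  If z is not
  a boundary, then at least q + 1 of its contractions are not boundaries, because otherwise z would
  be homologous to a cycle in fewer than q + 1 of the e_i.

  So the vanishing passes from k to all q >= k, and from a nonzero class of H_p in multidegree a one
  obtains, by contracting p - i times and counting twice, at least binomial(p, i) sets F of
  p - i variables such that H_i is nonzero in the multidegree a - (sum of epsilon_j over j in F).
  These multidegrees are distinct.
*)

theory Submission
  imports Defs "HOL-Library.Function_Algebras"
begin

section \<open>Koszul complexes\<close>

text \<open>Tor is computed from an arbitrarily chosen resolution of K, and its dimension is the
  size of a chosen finite basis, with default value 0. So it is not enough that the Koszul complex
  resolves K: every resolution has to be compared with it. An injection on homology in each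
  direction suffices. One turns a nonzero Betti number into a nonzero Koszul class, the other turns
  independent Koszul classes into a lower bound for a Betti number. The Z^n-grading makes counting
  possible: classes in distinct multidegrees are independent, so one nonzero class per multidegree
  is enough. The obstacle is that a primitive of a contraction may contain variables that were
  already eliminated. It must be moved into a subcomplex, and this is where vanishing in lower
  strands is used: splitting e_i off a primitive of a cycle leaves a cycle one strand below it.
  Finite generation enters twice. It bounds the degrees from below, which starts the induction on
  |a| and makes d_k an attained minimum, and it makes each degree finite-dimensional, so that the
  default value 0 does not hide a basis.\<close>

definition var_rank :: "'n::finite \<Rightarrow> nat"
  where "var_rank = (SOME f. inj f)"

text \<open>The index type carries no order, but the signs of exterior products need one; it is
  pulled back from the natural numbers along an arbitrary injection.\<close>

lemma inj_var_rank: "inj (var_rank :: 'n::finite \<Rightarrow> nat)"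
proof -
  have "\<exists>f :: 'n \<Rightarrow> nat. inj f"
    using finite_imp_inj_to_nat_seg[of "UNIV :: 'n set"] by auto
  then show ?thesis
    unfolding var_rank_def by (rule someI_ex)
qed

text \<open>
  An element \<open>\<Sum>\<^sub>F u\<^sub>F e\<^sub>F\<close> of \<open>M \<otimes> \<Lambda> K\<^sup>n\<close> is the function \<open>u\<close> on the subsets \<open>F\<close> of the variables.
  \<open>contract i\<close> is the interior product with the \<open>i\<close>-th dual basis vector and \<open>wedge i\<close> is the
  exterior product with \<open>e\<^sub>i\<close> from the left;
  \<open>crosses i F\<close> is the parity of the number of factors of \<open>e\<^sub>F\<close> that \<open>e\<^sub>i\<close> passes.
\<close>

definition crosses :: "'n::finite \<Rightarrow> 'n set \<Rightarrow> bool"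
  where "crosses i F \<longleftrightarrow> odd (card {j \<in> F. var_rank j < var_rank i})"

text \<open>Signs are booleans rather than powers of -1, so that they compose by exclusive or and
  sign identities become propositional.\<close>

definition flip :: "bool \<Rightarrow> 'm::ab_group_add \<Rightarrow> 'm"
  where "flip b y = (if b then - y else y)"

definition contract :: "'n::finite \<Rightarrow> ('n set \<Rightarrow> 'm::ab_group_add) \<Rightarrow> 'n set \<Rightarrow> 'm"
  where "contract i u F = (if i \<in> F then 0 else flip (crosses i F) (u (insert i F)))"

definition wedge :: "'n::finite \<Rightarrow> ('n set \<Rightarrow> 'm::ab_group_add) \<Rightarrow> 'n set \<Rightarrow> 'm"
  where "wedge i u F = (if i \<in> F then flip (crosses i F) (u (F - {i})) else 0)"

definition var :: "'n \<Rightarrow> ('n, 'k::field) mpoly"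
  where "var i = Poly_Mapping.single (Poly_Mapping.single i 1) 1"

text \<open>The usual alternating sum, written as the sum of the x_i times interior products. In
  this form its identities follow from those of \<open>contract\<close>.\<close>

definition koszul_diff ::
    "(('n::finite, 'k::field) mpoly \<Rightarrow> 'm::ab_group_add \<Rightarrow> 'm) \<Rightarrow> ('n set \<Rightarrow> 'm) \<Rightarrow> 'n set \<Rightarrow> 'm"
  where "koszul_diff smul u F = (\<Sum>i\<in>UNIV. smul (var i) (contract i u F))"

lemma flip_0 [simp]: "flip b 0 = 0"
  by (simp add: flip_def)

lemma flip_False [simp]: "flip False x = x"
  by (simp add: flip_def)

lemma flip_add: "flip b (x + y) = flip b x + flip b y"
  by (simp add: flip_def)

lemma flip_minus: "flip b (- x) = - flip b x"
  by (simp add: flip_def)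

lemma flip_diff: "flip b (x - y) = flip b x - flip b y"
  by (simp add: flip_def)

lemma flip_sum: "flip b (\<Sum>a\<in>A. f a) = (\<Sum>a\<in>A. flip b (f a))"
  by (simp add: flip_def sum_negf)

lemma flip_flip [simp]: "flip a (flip b x) = flip (a \<noteq> b) x"
  by (simp add: flip_def)

lemma crosses_insert:
  assumes "j \<notin> F" "j \<noteq> i"
  shows "crosses i (insert j F) \<longleftrightarrow> (crosses i F \<noteq> (var_rank j < var_rank i))"
proof (cases "var_rank j < var_rank i")
  case True
  then have "{l \<in> insert j F. var_rank l < var_rank i} = insert j {l \<in> F. var_rank l < var_rank i}"
    by auto
  then show ?thesis
    using assms True by (simp add: crosses_def)
next
  case False
  then have "{l \<in> insert j F. var_rank l < var_rank i} = {l \<in> F. var_rank l < var_rank i}"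
    by auto
  then show ?thesis
    using False by (simp add: crosses_def)
qed

lemma crosses_insert_self [simp]: "crosses i (insert i F) = crosses i F"
proof -
  have "{l \<in> insert i F. var_rank l < var_rank i} = {l \<in> F. var_rank l < var_rank i}"
    by auto
  then show ?thesis
    by (simp add: crosses_def)
qed

lemma crosses_remove_self [simp]: "crosses i (F - {i}) = crosses i F"
  by (metis crosses_insert_self insert_Diff_single)

lemma var_rank_linear: "i \<noteq> j \<Longrightarrow> (var_rank j < var_rank i) = (\<not> var_rank i < var_rank j)"
  using inj_var_rank by (metis injD linorder_neqE_nat not_less_iff_gr_or_eq)

lemma contract_contract_self [simp]: "contract i (contract i u) F = 0"
  by (simp add: contract_def)

text \<open>For distinct i and j exactly one precedes the other, so exactly one of the two crossing
  parities changes when the other index is inserted.\<close>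

lemma contract_contract: "contract i (contract j u) F = - contract j (contract i u) F"
proof (cases "i = j \<or> i \<in> F \<or> j \<in> F")
  case True
  then show ?thesis
    by (auto simp: contract_def)
next
  case False
  then have "crosses j (insert i F) = (crosses j F \<noteq> (var_rank i < var_rank j))"
    and "crosses i (insert j F) = (crosses i F \<noteq> (var_rank j < var_rank i))"
    using False by (intro crosses_insert; blast)+
  moreover have "(var_rank j < var_rank i) = (\<not> var_rank i < var_rank j)"
    using False by (intro var_rank_linear) auto
  ultimately show ?thesis
    using False by (auto simp: contract_def flip_def insert_commute)
qed

text \<open>The Clifford relation between exterior and interior multiplication. For i = j it shows
  that \<open>contract i (wedge i u)\<close> is the part of u without e_i, which is how this
  projection is written below.\<close>

lemma contract_wedge:
  "contract j (wedge i u) F = (if i = j then u F else 0) - wedge i (contract j u) F"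
proof (cases "i = j")
  case True
  show ?thesis
  proof (cases "i \<in> F")
    case True
    then show ?thesis
      using \<open>i = j\<close> by (simp add: contract_def wedge_def insert_absorb)
  next
    case False
    then show ?thesis
      using \<open>i = j\<close> by (simp add: contract_def wedge_def)
  qed
next
  case ne: False
  show ?thesis
  proof (cases "i \<in> F \<and> j \<notin> F")
    case True
    have "crosses i (insert j F) = (crosses i F \<noteq> (var_rank j < var_rank i))"
      using True ne by (intro crosses_insert) auto
    moreover have "crosses j (insert i (F - {i})) = (crosses j (F - {i}) \<noteq> (var_rank i < var_rank j))"
      using True ne by (intro crosses_insert) auto
    moreover have "insert i (F - {i}) = F"
      using True by auto
    moreover have "insert j F - {i} = insert j (F - {i})"
      using ne by auto
    moreover have "(var_rank j < var_rank i) = (\<not> var_rank i < var_rank j)"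
      using ne by (rule var_rank_linear)
    ultimately show ?thesis
      using True ne by (auto simp: contract_def wedge_def flip_def)
  next
    case False
    then show ?thesis
      using ne by (auto simp: contract_def wedge_def)
  qed
qed

lemma contract_add: "contract i (\<lambda>F. u F + v F) F = contract i u F + contract i v F"
  by (simp add: contract_def flip_add)

lemma contract_diff: "contract i (\<lambda>F. u F - v F) F = contract i u F - contract i v F"
  by (simp add: contract_def flip_diff)

lemma contract_minus: "contract i (\<lambda>F. - u F) F = - contract i u F"
  by (simp add: contract_def flip_minus)

lemma contract_sum: "contract i (\<lambda>F. \<Sum>a\<in>A. u a F) F = (\<Sum>a\<in>A. contract i (u a) F)"
  by (simp add: contract_def flip_sum)

lemma contract_0 [simp]: "contract i (\<lambda>F. 0) F = 0"
  by (simp add: contract_def)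

lemma wedge_0 [simp]: "wedge i (\<lambda>F. 0) F = 0"
  by (simp add: wedge_def)

lemma wedge_sum: "wedge i (\<lambda>F. \<Sum>a\<in>A. u a F) F = (\<Sum>a\<in>A. wedge i (u a) F)"
  by (simp add: wedge_def flip_sum)

text \<open>The diagonal is a separate hypothesis because antisymmetry alone does not make it vanish
  in a group with 2-torsion, as in characteristic 2.\<close>

lemma double_sum_antisymmetric:
  fixes f :: "'a \<Rightarrow> 'a \<Rightarrow> 'b::ab_group_add"
  assumes "finite A" "\<And>i. f i i = 0" "\<And>i j. f i j = - f j i"
  shows "(\<Sum>i\<in>A. \<Sum>j\<in>A. f i j) = 0"
  using assms(1)
proof induction
  case (insert a A)
  have "(\<Sum>i\<in>A. f i a) = - (\<Sum>j\<in>A. f a j)"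
    using assms(3) by (metis (no_types, lifting) sum.cong sum_negf)
  then show ?case
    using insert by (simp add: sum.distrib assms(2))
qed simp

section \<open>Identities of the Koszul differential over an arbitrary module\<close>

locale poly_module = module smul
  for smul :: "('n::finite, 'k::field) mpoly \<Rightarrow> 'm::ab_group_add \<Rightarrow> 'm"
begin

abbreviation "kd \<equiv> koszul_diff smul"

lemma scale_flip: "smul f (flip b x) = flip b (smul f x)"
  by (simp add: flip_def)

lemma contract_scale: "contract i (\<lambda>F. smul f (u F)) F = smul f (contract i u F)"
  by (simp add: contract_def scale_flip)

lemma wedge_scale: "wedge i (\<lambda>F. smul f (u F)) F = smul f (wedge i u F)"
  by (simp add: wedge_def scale_flip)

lemma kd_add: "kd (\<lambda>F. u F + v F) F = kd u F + kd v F"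
  by (simp add: koszul_diff_def contract_add scale_right_distrib sum.distrib)

lemma kd_diff: "kd (\<lambda>F. u F - v F) F = kd u F - kd v F"
  by (simp add: koszul_diff_def contract_diff scale_right_diff_distrib sum_subtractf)

lemma kd_minus: "kd (\<lambda>F. - u F) F = - kd u F"
  by (simp add: koszul_diff_def contract_minus sum_negf)

lemma kd_0 [simp]: "kd (\<lambda>F. 0) F = 0"
  by (simp add: koszul_diff_def)

lemma kd_sum: "kd (\<lambda>F. \<Sum>a\<in>A. u a F) F = (\<Sum>a\<in>A. kd (u a) F)"
  by (simp add: koszul_diff_def contract_sum scale_sum_right) (rule sum.swap)

lemma kd_scale: "kd (\<lambda>F. smul f (u F)) F = smul f (kd u F)"
  by (simp add: koszul_diff_def contract_scale scale_sum_right mult.commute)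

text \<open>Contractions anticommute with each other and commute with scalars. Consequently they
  carry cycles to cycles and boundaries to boundaries, so they act on homology.\<close>

lemma contract_kd: "contract i (kd u) F = - kd (contract i u) F"
proof -
  have "contract i (kd u) F = contract i (\<lambda>F. \<Sum>j\<in>UNIV. smul (var j) (contract j u F)) F"
    by (simp add: koszul_diff_def[abs_def])
  also have "\<dots> = (\<Sum>j\<in>UNIV. smul (var j) (contract i (contract j u) F))"
    by (simp add: contract_sum contract_scale)
  also have "\<dots> = - kd (contract i u) F"
    by (subst contract_contract) (simp add: koszul_diff_def sum_negf)
  finally show ?thesis .
qed

lemma kd_kd [simp]: "kd (kd u) F = 0"
proof -
  have "kd (kd u) F = (\<Sum>i\<in>UNIV. smul (var i) (- kd (contract i u) F))"
    by (subst koszul_diff_def) (simp add: contract_kd)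
  also have "\<dots> = - (\<Sum>i\<in>UNIV. \<Sum>j\<in>UNIV. smul (var i) (smul (var j) (contract j (contract i u) F)))"
    by (simp add: koszul_diff_def sum_negf scale_sum_right)
  also have "(\<Sum>i\<in>UNIV. \<Sum>j\<in>UNIV. smul (var i) (smul (var j) (contract j (contract i u) F))) = 0"
  proof (rule double_sum_antisymmetric)
    fix i j
    show "smul (var i) (smul (var j) (contract j (contract i u) F)) =
        - smul (var j) (smul (var i) (contract i (contract j u) F))"
      by (subst contract_contract) (simp add: mult.commute)
  qed auto
  finally show ?thesis
    by simp
qed

text \<open>Exterior multiplication by e_i is a null-homotopy of multiplication by x_i. This is the
  formula by which terms containing e_i are traded for multiples of x_i.\<close>

lemma kd_wedge: "kd (wedge i u) F = smul (var i) (u F) - wedge i (kd u) F"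
proof -
  have "kd (wedge i u) F =
      (\<Sum>j\<in>UNIV. smul (var j) (if i = j then u F else 0)) -
      (\<Sum>j\<in>UNIV. smul (var j) (wedge i (contract j u) F))"
    by (simp add: koszul_diff_def contract_wedge scale_right_diff_distrib sum_subtractf)
  also have "(\<Sum>j\<in>UNIV. smul (var j) (if i = j then u F else 0)) = smul (var i) (u F)"
    by (subst sum.remove[of _ i]) (auto intro!: sum.neutral)
  also have "(\<Sum>j\<in>UNIV. smul (var j) (wedge i (contract j u) F)) = wedge i (kd u) F"
    by (simp add: koszul_diff_def[abs_def] wedge_sum wedge_scale)
  finally show ?thesis .
qed

end

section \<open>Multigraded Koszul homology\<close>

definition indicator_vec :: "'n::finite set \<Rightarrow> int ^ 'n"
  where "indicator_vec F = (\<chi> i. if i \<in> F then 1 else 0)"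

lemma total_add: "total (a + b) = total a + total b"
  by (simp add: total_def sum.distrib)

lemma total_diff: "total (a - b) = total a - total b"
  by (simp add: total_def sum_subtractf)

lemma total_axis [simp]: "total (axis i 1) = 1"
  by (simp add: total_def axis_def)

lemma total_indicator_vec [simp]: "total (indicator_vec F) = int (card F)"
  by (simp add: total_def indicator_vec_def sum.If_cases)

lemma indicator_vec_insert: "i \<notin> F \<Longrightarrow> indicator_vec (insert i F) = indicator_vec F + axis i 1"
  by (auto simp: vec_eq_iff indicator_vec_def axis_def)

lemma indicator_vec_remove: "i \<in> F \<Longrightarrow> indicator_vec (F - {i}) = indicator_vec F - axis i 1"
  by (auto simp: vec_eq_iff indicator_vec_def axis_def)

lemma indicator_vec_empty [simp]: "indicator_vec {} = 0"
  by (simp add: vec_eq_iff indicator_vec_def)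

lemma indicator_vec_eq_iff: "indicator_vec F = indicator_vec F' \<longleftrightarrow> F = F'"
  by (auto simp: vec_eq_iff indicator_vec_def set_eq_iff split: if_splits)

lemma multidegree_single [simp]: "multidegree (Poly_Mapping.single i (Suc 0)) = axis i 1"
  by (auto simp: multidegree_def vec_eq_iff axis_def lookup_single when_def)

lemma var_in_poly_zn_part: "var i \<in> poly_zn_part (axis i 1)"
  by (simp add: poly_zn_part_def var_def)

lemma const_poly_in_poly_zn_part: "const_poly c \<in> poly_zn_part 0"
  by (simp add: poly_zn_part_def const_poly_def multidegree_def vec_eq_iff)

locale graded_module =
  fixes smul :: "('n::finite, 'k::field) mpoly \<Rightarrow> 'm::ab_group_add \<Rightarrow> 'm"
    and G :: "int ^ 'n \<Rightarrow> 'm set"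
  assumes graded: "zn_graded_module smul G"

sublocale graded_module \<subseteq> poly_module smul
  using graded by (simp add: zn_graded_module_def poly_module_def)

context graded_module
begin

lemma G_0 [simp]: "0 \<in> G a"
  using graded by (simp add: zn_graded_module_def)

lemma G_add: "x \<in> G a \<Longrightarrow> y \<in> G a \<Longrightarrow> x + y \<in> G a"
  using graded by (simp add: zn_graded_module_def)

lemma G_smul: "f \<in> poly_zn_part b \<Longrightarrow> x \<in> G a \<Longrightarrow> smul f x \<in> G (b + a)"
  using graded by (simp add: zn_graded_module_def)

lemma G_scale: "x \<in> G a \<Longrightarrow> smul (const_poly c) x \<in> G a"
  using G_smul[OF const_poly_in_poly_zn_part] by force

lemma G_minus:
  assumes "x \<in> G a"
  shows "- x \<in> G a"
proof -
  have "const_poly (- 1) = (- 1 :: ('n, 'k) mpoly)"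
    by (simp add: const_poly_def single_uminus flip: single_one)
  then show ?thesis
    using G_scale[OF assms, of "- 1"] by simp
qed

lemma G_diff: "x \<in> G a \<Longrightarrow> y \<in> G a \<Longrightarrow> x - y \<in> G a"
  using G_add[of x a "- y"] G_minus by simp

lemma G_flip: "x \<in> G a \<Longrightarrow> flip b x \<in> G a"
  by (simp add: flip_def G_minus)

lemma G_sum: "(\<And>i. i \<in> A \<Longrightarrow> f i \<in> G a) \<Longrightarrow> (\<Sum>i\<in>A. f i) \<in> G a"
  by (induction A rule: infinite_finite_induct) (auto intro: G_add)

lemma G_var: "x \<in> G a \<Longrightarrow> smul (var i) x \<in> G (a + axis i 1)"
  using G_smul[OF var_in_poly_zn_part] by (simp add: add.commute)

text \<open>The set A restricts the exterior factors only; the coefficients still range over M.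
  Since e_F has degree \<open>indicator_vec F\<close>, coefficients live in degree a minus that
  vector. Extension by 0 turns membership in a subcomplex into a condition on the support.\<close>

definition kchains :: "'n set \<Rightarrow> nat \<Rightarrow> int ^ 'n \<Rightarrow> ('n set \<Rightarrow> 'm) set"
  where "kchains A q a =
    {u. \<forall>F. if F \<subseteq> A \<and> card F = q then u F \<in> G (a - indicator_vec F) else u F = 0}"

lemma kchainsI:
  "(\<And>F. F \<subseteq> A \<Longrightarrow> card F = q \<Longrightarrow> u F \<in> G (a - indicator_vec F)) \<Longrightarrow>
   (\<And>F. \<not> (F \<subseteq> A \<and> card F = q) \<Longrightarrow> u F = 0) \<Longrightarrow> u \<in> kchains A q a"
  by (simp add: kchains_def)

lemma kchains_G: "u \<in> kchains A q a \<Longrightarrow> u F \<in> G (a - indicator_vec F)"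
  by (cases "F \<subseteq> A \<and> card F = q") (auto simp: kchains_def dest: spec[of _ F])

lemma kchains_eq_0: "u \<in> kchains A q a \<Longrightarrow> \<not> (F \<subseteq> A \<and> card F = q) \<Longrightarrow> u F = 0"
  by (auto simp: kchains_def dest!: spec[of _ F] split: if_splits)

lemma kchains_add: "u \<in> kchains A q a \<Longrightarrow> v \<in> kchains A q a \<Longrightarrow> (\<lambda>F. u F + v F) \<in> kchains A q a"
  by (intro kchainsI) (auto intro: G_add kchains_G simp: kchains_eq_0)

lemma kchains_diff: "u \<in> kchains A q a \<Longrightarrow> v \<in> kchains A q a \<Longrightarrow> (\<lambda>F. u F - v F) \<in> kchains A q a"
  by (intro kchainsI) (auto intro: G_diff kchains_G simp: kchains_eq_0)

lemma kchains_minus: "u \<in> kchains A q a \<Longrightarrow> (\<lambda>F. - u F) \<in> kchains A q a"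
  by (intro kchainsI) (auto intro: G_minus kchains_G simp: kchains_eq_0)

lemma kchains_0 [simp]: "(\<lambda>F. 0) \<in> kchains A q a"
  by (simp add: kchainsI)

lemma kchains_sum:
  "(\<And>i. i \<in> I \<Longrightarrow> u i \<in> kchains A q a) \<Longrightarrow> (\<lambda>F. \<Sum>i\<in>I. u i F) \<in> kchains A q a"
  by (intro kchainsI G_sum sum.neutral ballI) (blast intro: kchains_G kchains_eq_0)+

lemma kchains_mono: "u \<in> kchains A q a \<Longrightarrow> A \<subseteq> B \<Longrightarrow> u \<in> kchains B q a"
  by (rule kchainsI) (auto intro: kchains_G kchains_eq_0)

lemma kchains_var:
  assumes "u \<in> kchains A q a"
  shows "(\<lambda>F. smul (var i) (u F)) \<in> kchains A q (a + axis i 1)"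
proof (rule kchainsI)
  fix F
  show "smul (var i) (u F) \<in> G (a + axis i 1 - indicator_vec F)"
    using G_var[OF kchains_G[OF assms, of F], of i] by (simp add: algebra_simps)
qed (simp add: kchains_eq_0[OF assms])

lemma contract_kchains:
  assumes "u \<in> kchains A (Suc q) a"
  shows "contract i u \<in> kchains (A - {i}) q (a - axis i 1)"
proof (rule kchainsI)
  fix F assume F: "F \<subseteq> A - {i}"
  then have "u (insert i F) \<in> G (a - axis i 1 - indicator_vec F)"
    using kchains_G[OF assms, of "insert i F"] indicator_vec_insert[of i F]
    by (simp add: subset_Diff_insert diff_diff_add add.commute)
  then show "contract i u F \<in> G (a - axis i 1 - indicator_vec F)"
    by (simp add: contract_def G_flip)
next
  fix F assume F: "\<not> (F \<subseteq> A - {i} \<and> card F = q)"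
  then have "\<not> (insert i F \<subseteq> A \<and> card (insert i F) = Suc q)" if "i \<notin> F"
    using that by auto
  then show "contract i u F = 0"
    using kchains_eq_0[OF assms, of "insert i F"] by (simp add: contract_def)
qed

lemma wedge_kchains:
  assumes "u \<in> kchains A q a" "i \<in> A"
  shows "wedge i u \<in> kchains A (Suc q) (a + axis i 1)"
proof (rule kchainsI)
  fix F assume F: "F \<subseteq> A"
  have "u (F - {i}) \<in> G (a + axis i 1 - indicator_vec F)" if "i \<in> F"
    using kchains_G[OF assms(1), of "F - {i}"] that
    by (auto simp: indicator_vec_remove algebra_simps)
  then show "wedge i u F \<in> G (a + axis i 1 - indicator_vec F)"
    by (simp add: wedge_def G_flip)
next
  fix F assume F: "\<not> (F \<subseteq> A \<and> card F = Suc q)"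
  then have "\<not> (F - {i} \<subseteq> A \<and> card (F - {i}) = q)" if "i \<in> F"
    using that assms(2) card_Suc_Diff1[of F i] by auto
  then show "wedge i u F = 0"
    using kchains_eq_0[OF assms(1), of "F - {i}"] by (auto simp: wedge_def)
qed

lemma kd_kchains:
  assumes "u \<in> kchains A (Suc q) a"
  shows "kd u \<in> kchains A q a"
proof -
  have "(\<lambda>F. smul (var i) (contract i u F)) \<in> kchains A q a" for i
    using kchains_var[OF contract_kchains[OF assms, of i], of i]
    by (auto intro: kchains_mono)
  then show ?thesis
    using kchains_sum[of UNIV "\<lambda>i F. smul (var i) (contract i u F)"]
    by (simp add: koszul_diff_def[abs_def])
qed

text \<open>A cycle with nonzero class in H_q of the full complex. Primitives are sought in the same
  multidegree only, which is no restriction since the differential preserves multidegrees.\<close>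

definition essential :: "nat \<Rightarrow> int ^ 'n \<Rightarrow> ('n set \<Rightarrow> 'm) \<Rightarrow> bool"
  where "essential q a z \<longleftrightarrow>
    z \<in> kchains UNIV q a \<and> kd z = (\<lambda>F. 0) \<and> z \<notin> kd ` kchains UNIV (Suc q) a"

definition nonzero_class :: "nat \<Rightarrow> int ^ 'n \<Rightarrow> bool"
  where "nonzero_class q a \<longleftrightarrow> (\<exists>z. essential q a z)"

text \<open>The strand |a| - q is the j of the Betti number with indices q and q + j. A contraction
  lowers |a| and q by one each and so stays in its strand.\<close>

definition strands_vanish :: "nat \<Rightarrow> int \<Rightarrow> bool"
  where "strands_vanish q d \<longleftrightarrow> (\<forall>a. total a - int q < d \<longrightarrow> \<not> nonzero_class q a)"

lemma strands_vanishD: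
  assumes "strands_vanish q d" "total a - int q < d" "z \<in> kchains UNIV q a" "kd z = (\<lambda>F. 0)"
  obtains y where "y \<in> kchains UNIV (Suc q) a" "z = kd y"
  using assms unfolding strands_vanish_def nonzero_class_def essential_def by blast

text \<open>
  Splitting off \<open>e\<^sub>i\<close>: the complex of \<open>A\<close> is the mapping cone of \<open>x\<^sub>i\<close> on the complex of \<open>A - {i}\<close>.
\<close>

lemma kd_split:
  assumes "y \<in> kchains A (Suc q) a" "kd y \<in> kchains (A - {i}) q a"
  defines "u \<equiv> contract i y" and "w \<equiv> contract i (wedge i y)"
  shows "u \<in> kchains (A - {i}) q (a - axis i 1)" "w \<in> kchains (A - {i}) (Suc q) a"
    "kd u = (\<lambda>F. 0)" "kd y F = kd w F + smul (var i) (u F)"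
proof -
  show u: "u \<in> kchains (A - {i}) q (a - axis i 1)"
    unfolding u_def by (rule contract_kchains) fact
  have w_eq: "w F = (if i \<in> F then 0 else y F)" for F
    unfolding w_def by (auto simp: contract_wedge wedge_def contract_def insert_absorb)
  show "w \<in> kchains (A - {i}) (Suc q) a"
    by (rule kchainsI) (auto simp: w_eq intro: kchains_G[OF assms(1)] kchains_eq_0[OF assms(1)])
  \<comment> \<open>The boundary of y does not contain e_i; as contraction anticommutes with the
    differential, the e_i-coefficient u of y is a cycle.\<close>
  have "contract i (kd y) F = 0" for F
    using kchains_eq_0[OF assms(2), of "insert i F"] by (simp add: contract_def)
  then show kd_u: "kd u = (\<lambda>F. 0)"
    by (simp add: u_def fun_eq_iff contract_kd)
  \<comment> \<open>By the Clifford relation y splits into w, without e_i, and e_i wedge u.\<close>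
  have y_eq: "y = (\<lambda>F. w F + wedge i u F)"
    unfolding w_def u_def by (simp add: contract_wedge)
  have "kd y F = kd w F + kd (wedge i u) F"
    by (simp only: y_eq[symmetric] flip: kd_add)
  then show "kd y F = kd w F + smul (var i) (u F)"
    by (simp add: kd_wedge kd_u)
qed

end

section \<open>Boundaries inside subcomplexes and contractions that survive in homology\<close>

locale bounded_graded_module = graded_module smul G
  for smul :: "('n::finite, 'k::field) mpoly \<Rightarrow> 'm::ab_group_add \<Rightarrow> 'm"
    and G :: "int ^ 'n \<Rightarrow> 'm set" +
  fixes b :: int
  assumes G_below: "total a < b \<Longrightarrow> G a = {0}"
begin

text \<open>Injectivity of H_q of the subcomplex on A into H_q of the full complex, in strands up to
  d. There are two nested inductions: on |a| above the lower bound b, and, for fixed a, on the set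
  of variables removed so far from the primitive.\<close>

lemma boundary_in_subcomplex:
  assumes V: "strands_vanish q d"
    and "total a - int q \<le> d" "y \<in> kchains UNIV (Suc q) a" "kd y \<in> kchains A q a"
  shows "\<exists>y'\<in>kchains A (Suc q) a. kd y' = kd y"
proof -
  have "\<exists>y'\<in>kchains A (Suc q) a. kd y' = kd y"
    if "total a < b + int N" "total a - int q \<le> d" "y \<in> kchains UNIV (Suc q) a" "kd y \<in> kchains A q a"
    for N
    using that
  proof (induction N arbitrary: a A y)
    case 0
    \<comment> \<open>Dividing out e_F only lowers the degree, so every coefficient lies below
      b.\<close>
    have "kd y F = 0" for F
      using G_below[of "a - indicator_vec F"] kchains_G[OF 0(4), of F] 0(1) by (simp add: total_diff)
    then show ?case
      by (intro bexI[of _ "\<lambda>F. 0"]) auto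
  next
    case (Suc N)
    have "kd y \<in> kchains (- B) q a \<Longrightarrow> \<exists>y'\<in>kchains (- B) (Suc q) a. kd y' = kd y"
      if "finite B" for B
      using that
    proof (induction B)
      case empty
      then show ?case
        using Suc.prems(3) by auto
    next
      case (insert i B)
      let ?A = "- insert i B"
      have z: "kd y \<in> kchains ?A q a"
        by fact
      have "kd y \<in> kchains (- B) q a"
        using z by (rule kchains_mono) auto
      then obtain y1 where y1: "y1 \<in> kchains (- B) (Suc q) a" "kd y1 = kd y"
        using insert.IH by blast
      define u where "u = contract i y1"
      define w where "w = contract i (wedge i y1)"
      have A: "- B - {i} = ?A"
        by auto
      have "kd y1 \<in> kchains (- B - {i}) q a"
        using z y1(2) A by simp
      note sp = kd_split[OF y1(1) this, folded u_def w_def, unfolded A]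
      have tot: "total (a - axis i 1) = total a - 1"
        by (simp add: total_diff)
      have "u \<in> kchains UNIV q (a - axis i 1)"
        using sp(1) by (rule kchains_mono) auto
      \<comment> \<open>The strand of u is |a| - 1 - q, strictly below d, so the vanishing
        hypothesis gives a primitive, though possibly one with the forbidden variables.\<close>
      then obtain u1 where u1: "u1 \<in> kchains UNIV (Suc q) (a - axis i 1)" "u = kd u1"
        using strands_vanishD[OF V, of "a - axis i 1" u] sp(3) tot Suc.prems(2) by auto
      \<comment> \<open>The outer induction, in total degree |a| - 1, moves that primitive into the
        smaller subcomplex.\<close>
      obtain u2 where u2: "u2 \<in> kchains ?A (Suc q) (a - axis i 1)" "kd u2 = u"
        using Suc.IH[of "a - axis i 1" u1 ?A] u1 sp(1) tot Suc.prems(1,2) by auto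
      \<comment> \<open>The boundary of e_i wedge u is x_i u, which is also the boundary of x_i u2;
        the latter has no e_i.\<close>
      have "(\<lambda>F. w F + smul (var i) (u2 F)) \<in> kchains ?A (Suc q) a"
        using kchains_add[OF sp(2)] kchains_var[OF u2(1), of i] by simp
      moreover have "kd (\<lambda>F. w F + smul (var i) (u2 F)) = kd y"
        using sp(4) by (simp add: fun_eq_iff kd_add kd_scale u2(2) y1(2))
      ultimately show ?case
        by blast
    qed
    from this[of "- A"] show ?case
      using Suc.prems(4) by simp
  qed
  \<comment> \<open>This bound puts total a below b + N; if the difference is negative,
    \<open>nat\<close> gives 0 and the base case applies.\<close>
  from this[of "nat (total a - b + 1)", OF _ assms(2-4)] show ?thesis
    by simp
qed

lemma essential_cong:
  assumes "essential q a z" "y \<in> kchains UNIV (Suc q) a"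
  shows "essential q a (\<lambda>F. z F + kd y F)"
proof -
  have "(\<lambda>F. z F + kd y F) \<notin> kd ` kchains UNIV (Suc q) a"
  proof
    assume "(\<lambda>F. z F + kd y F) \<in> kd ` kchains UNIV (Suc q) a"
    then obtain y' where y': "y' \<in> kchains UNIV (Suc q) a" "(\<lambda>F. z F + kd y F) = kd y'"
      by blast
    have "z F = kd (\<lambda>F. y' F - y F) F" for F
      using fun_cong[OF y'(2), of F] by (simp add: kd_diff algebra_simps)
    then have "z = kd (\<lambda>F. y' F - y F)"
      by (rule ext)
    moreover have "(\<lambda>F. y' F - y F) \<in> kchains UNIV (Suc q) a"
      using assms(2) y'(1) by (intro kchains_diff)
    ultimately show False
      using assms(1) unfolding essential_def by blast
  qed
  moreover have "(\<lambda>F. z F + kd y F) \<in> kchains UNIV q a"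
    using assms(1) kchains_add[OF _ kd_kchains[OF assms(2)]] by (simp add: essential_def)
  moreover have "kd (\<lambda>F. z F + kd y F) = (\<lambda>F. 0)"
    using assms(1) by (simp add: essential_def fun_eq_iff kd_add)
  ultimately show ?thesis
    by (simp add: essential_def)
qed

lemma not_essential_0: "\<not> essential q a (\<lambda>F. 0)"
proof -
  have "(\<lambda>F. 0) = kd (\<lambda>F. 0)"
    by (simp add: fun_eq_iff)
  then show ?thesis
    unfolding essential_def using kchains_0 by blast
qed

definition essential_contractions :: "nat \<Rightarrow> int ^ 'n \<Rightarrow> ('n set \<Rightarrow> 'm) \<Rightarrow> 'n set"
  where "essential_contractions q a z = {i. essential q (a - axis i 1) (contract i z)}"

lemma card_essential_contractions:
  assumes V: "strands_vanish q d" and le: "total a - int (Suc q) \<le> d"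
    and z: "essential (Suc q) a z"
  shows "Suc q \<le> card (essential_contractions q a z)"
proof -
  define C where "C = essential_contractions q a z"
  \<comment> \<open>C depends only on the class of z, so it stays the same while z is replaced by
    homologous cycles.\<close>
  have ess_iff: "essential q (a - axis i 1) (contract i z') \<longleftrightarrow> i \<in> C"
    if "y \<in> kchains UNIV (Suc (Suc q)) a" "z' = (\<lambda>F. z F + kd y F)" for i z' y
  proof -
    have cy: "(\<lambda>F. - contract i y F) \<in> kchains UNIV (Suc q) (a - axis i 1)"
      "(\<lambda>F. contract i y F) \<in> kchains UNIV (Suc q) (a - axis i 1)"
      using contract_kchains[OF that(1), of i] by (auto intro: kchains_mono kchains_minus)
    have 1: "contract i z' = (\<lambda>F. contract i z F + kd (\<lambda>F. - contract i y F) F)"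
      by (simp add: that(2) contract_add contract_kd kd_minus fun_eq_iff)
    have 2: "contract i z = (\<lambda>F. contract i z' F + kd (\<lambda>F. contract i y F) F)"
      by (simp add: that(2) contract_add contract_kd kd_minus fun_eq_iff)
    show ?thesis
      unfolding C_def essential_contractions_def mem_Collect_eq
      using essential_cong[OF _ cy(1), of "contract i z", folded 1]
        essential_cong[OF _ cy(2), of "contract i z'", folded 2] by blast
  qed
  have "\<exists>y. y \<in> kchains UNIV (Suc (Suc q)) a \<and> (\<lambda>F. z F + kd y F) \<in> kchains (- B) (Suc q) a"
    if "B \<subseteq> - C" for B
  proof -
    have "finite B"
      by simp
    then show ?thesis
      using that
    proof (induction B)
      case empty
      have "(\<lambda>F. z F + kd (\<lambda>F. 0) F) \<in> kchains (- {}) (Suc q) a"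
        using z by (simp add: essential_def)
      then show ?case
        by (intro exI[of _ "\<lambda>F. 0"]) auto
    next
      case (insert i B)
      then obtain y where y: "y \<in> kchains UNIV (Suc (Suc q)) a"
        and z1: "(\<lambda>F. z F + kd y F) \<in> kchains (- B) (Suc q) a"
        by auto
      define z' where "z' = (\<lambda>F. z F + kd y F)"
      have ess: "essential (Suc q) a z'"
        unfolding z'_def by (rule essential_cong) fact+
      have "kd (contract i z') F = 0" for F
        using contract_kd[of i z' F] ess by (simp add: essential_def)
      moreover have cz: "contract i z' \<in> kchains (- insert i B) q (a - axis i 1)"
        using contract_kchains[OF z1[folded z'_def], of i]
        by (simp add: Compl_insert)
      moreover have "\<not> essential q (a - axis i 1) (contract i z')"
        using ess_iff[OF y z'_def] insert.prems by auto
      ultimately obtain y1 where "y1 \<in> kchains UNIV (Suc q) (a - axis i 1)" "kd y1 = contract i z'"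
        unfolding essential_def using kchains_mono[OF cz, of UNIV] by (auto simp: fun_eq_iff)
      moreover have "total (a - axis i 1) - int q \<le> d"
        using le by (simp add: total_diff)
      \<comment> \<open>The contraction is a boundary since i is not in C. A primitive that avoids B
        as well as i keeps the variables already eliminated from returning.\<close>
      ultimately obtain y2 where y2: "y2 \<in> kchains (- insert i B) (Suc q) (a - axis i 1)"
        "kd y2 = contract i z'"
        using boundary_in_subcomplex[OF V, of "a - axis i 1" y1 "- insert i B"] cz by auto
      have wy2: "wedge i y2 \<in> kchains (- B) (Suc (Suc q)) a"
        using wedge_kchains[of y2 "- B" "Suc q" "a - axis i 1" i] kchains_mono[OF y2(1), of "- B"] insert.hyps
        by auto
      have "(\<lambda>F. y F + wedge i y2 F) \<in> kchains UNIV (Suc (Suc q)) a"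
        using y wy2 by (auto intro: kchains_add kchains_mono)
      moreover have "(\<lambda>F. z F + kd (\<lambda>F. y F + wedge i y2 F) F) \<in> kchains (- insert i B) (Suc q) a"
      proof -
        have eq: "(\<lambda>F. z F + kd (\<lambda>F. y F + wedge i y2 F) F) = (\<lambda>F. z' F + kd (wedge i y2) F)"
          by (simp add: z'_def kd_add add.assoc)
        have in_B: "(\<lambda>F. z' F + kd (wedge i y2) F) \<in> kchains (- B) (Suc q) a"
          using z1 wy2 by (auto simp: z'_def intro: kchains_add kd_kchains)
        \<comment> \<open>The boundary of e_i wedge y2 is x_i y2 minus e_i wedge
          \<open>contract i z'\<close>. The first term has no e_i, and the second cancels the part
          of z' with e_i.\<close>
        have "z' F + kd (wedge i y2) F = 0" if "i \<in> F" for F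
        proof -
          have "y2 F = 0"
            using that by (intro kchains_eq_0[OF y2(1)]) auto
          then show ?thesis
            using that by (simp add: kd_wedge y2(2)) (simp add: wedge_def contract_def insert_absorb)
        qed
        then show ?thesis
          unfolding eq
          by (intro kchainsI)
            (auto intro: kchains_G[OF in_B] kchains_eq_0[OF in_B] simp: subset_Compl_singleton)
      qed
      ultimately show ?case
        by blast
    qed
  qed
  from this[of "- C"] obtain y where y: "y \<in> kchains UNIV (Suc (Suc q)) a"
    and z1: "(\<lambda>F. z F + kd y F) \<in> kchains C (Suc q) a"
    by auto
  \<comment> \<open>All variables outside C are gone; any F in the support of the remaining nonzero
    chain is a subset of C with q + 1 elements.\<close>
  have "(\<lambda>F. z F + kd y F) \<noteq> (\<lambda>F. 0)"
    using essential_cong[OF z y] not_essential_0 by metis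
  then obtain F where "z F + kd y F \<noteq> 0"
    by blast
  then have "F \<subseteq> C" "card F = Suc q"
    using kchains_eq_0[OF z1, of F] by blast+
  then show ?thesis
    using card_mono[of C F] by (simp add: C_def)
qed

text \<open>At least one contraction of a nonzero class survives, and it lies in the same strand one
  homological degree lower.\<close>

lemma strands_vanish_Suc:
  assumes "strands_vanish q d"
  shows "strands_vanish (Suc q) d"
  unfolding strands_vanish_def
proof (intro allI impI notI)
  fix a assume a: "total a - int (Suc q) < d" and "nonzero_class (Suc q) a"
  then obtain z where "essential (Suc q) a z"
    by (auto simp: nonzero_class_def)
  then have "essential_contractions q a z \<noteq> {}"
    using card_essential_contractions[OF assms, of a z] a by auto
  then obtain i where "nonzero_class q (a - axis i 1)"
    by (auto simp: nonzero_class_def essential_contractions_def)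
  then show False
    using assms a by (auto simp: strands_vanish_def total_diff)
qed

lemma strands_vanish_le: "q \<le> q' \<Longrightarrow> strands_vanish q d \<Longrightarrow> strands_vanish q' d"
  by (induction rule: dec_induct) (auto intro: strands_vanish_Suc)

end

text \<open>Double counting of the pairs \<open>(F, insert i F)\<close>.\<close>

lemma card_upper_shadow:
  fixes X Y :: "'n::finite set set"
  assumes X: "\<And>F. F \<in> X \<Longrightarrow> card F = j"
    and Y: "\<And>F. F \<in> Y \<Longrightarrow> card F = Suc j"
    and ext: "\<And>F. F \<in> X \<Longrightarrow> r \<le> card {i. i \<notin> F \<and> insert i F \<in> Y}"
  shows "r * card X \<le> Suc j * card Y"
proof -
  define P where "P = (SIGMA F:X. {i. i \<notin> F \<and> insert i F \<in> Y})"
  define Q where "Q = (SIGMA F:Y. F)"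
  have "r * card X = (\<Sum>F\<in>X. r)"
    by simp
  also have "\<dots> \<le> (\<Sum>F\<in>X. card {i. i \<notin> F \<and> insert i F \<in> Y})"
    by (rule sum_mono) (rule ext)
  also have "\<dots> = card P"
    by (simp add: P_def)
  also have "\<dots> \<le> card Q"
  \<comment> \<open>The pair (F, i) is recovered from (insert i F, i) because i is not in F; each
    set in Y receives at most one pair for each of its j + 1 elements.\<close>
  proof (rule card_inj_on_le)
    show "inj_on (\<lambda>(F, i). (insert i F, i)) P"
      by (clarsimp simp: inj_on_def P_def) (metis insert_ident)
    show "(\<lambda>(F, i). (insert i F, i)) ` P \<subseteq> Q"
      by (auto simp: P_def Q_def)
  qed simp
  also have "\<dots> = (\<Sum>F\<in>Y. card F)"
    by (simp add: Q_def)
  also have "\<dots> = Suc j * card Y"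
    using Y by simp
  finally show ?thesis .
qed

context bounded_graded_module
begin

lemma card_nonzero_class:
  assumes V: "strands_vanish k d" and nz: "nonzero_class p a" and tot: "total a - int p = d"
    and "k \<le> q" "q \<le> p"
  shows "\<exists>I. finite I \<and> (p choose q) \<le> card I \<and> (\<forall>a'\<in>I. total a' = int q + d \<and> nonzero_class q a')"
proof -
  \<comment> \<open>The representative must avoid F. Then its contraction by a variable of F is 0,
    so every surviving contraction enlarges F by a new variable.\<close>
  define X where "X j = {F. card F = j \<and>
    (\<exists>z\<in>kchains (- F) (p - j) (a - indicator_vec F). essential (p - j) (a - indicator_vec F) z)}" for j
  have "(p choose j) \<le> card (X j)" if "j \<le> p - k" for j
    using that
  proof (induction j)
    case 0
    have "{} \<in> X 0"
      using nz by (auto simp: X_def nonzero_class_def essential_def)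
    then have "card (X 0) > 0"
      by (auto simp: card_gt_0_iff)
    then show ?case
      by simp
  next
    case (Suc j)
    define r where "r = p - Suc j"
    have pj: "p - j = Suc r"
      using Suc.prems by (simp add: r_def)
    \<comment> \<open>With r + 1 = p - j this is the recursion of the binomial coefficients
      binomial(p, j), up to an inequality.\<close>
    have "Suc r * card (X j) \<le> Suc j * card (X (Suc j))"
    proof (rule card_upper_shadow)
      fix F assume "F \<in> X j"
      then obtain z where cF: "card F = j" and zF: "z \<in> kchains (- F) (Suc r) (a - indicator_vec F)"
        and z: "essential (Suc r) (a - indicator_vec F) z"
        by (auto simp: X_def pj)
      \<comment> \<open>The contracted class has homological degree r = p - j - 1, which is at least
        k exactly because j + 1 does not exceed p - k.\<close>
      have "strands_vanish r d"
        using V Suc.prems by (intro strands_vanish_le[OF _ V]) (simp add: r_def)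
      moreover have "total (a - indicator_vec F) - int (Suc r) \<le> d"
        using tot cF Suc.prems pj by (simp add: total_diff)
      ultimately have "Suc r \<le> card (essential_contractions r (a - indicator_vec F) z)"
        using z by (rule card_essential_contractions)
      also have "\<dots> \<le> card {i. i \<notin> F \<and> insert i F \<in> X (Suc j)}"
      proof (rule card_mono)
        show "essential_contractions r (a - indicator_vec F) z \<subseteq> {i. i \<notin> F \<and> insert i F \<in> X (Suc j)}"
        proof
          fix i assume "i \<in> essential_contractions r (a - indicator_vec F) z"
          then have ess: "essential r (a - indicator_vec F - axis i 1) (contract i z)"
            by (simp add: essential_contractions_def)
          have "i \<notin> F"
          proof
            assume "i \<in> F"
            then have "contract i z = (\<lambda>F. 0)"
              using kchains_eq_0[OF zF] by (auto simp: contract_def fun_eq_iff)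
            then show False
              using ess not_essential_0 by simp
          qed
          moreover have "contract i z \<in> kchains (- insert i F) r (a - indicator_vec F - axis i 1)"
            using contract_kchains[OF zF, of i] by (simp add: Compl_insert)
          moreover have "a - indicator_vec (insert i F) = a - indicator_vec F - axis i 1"
            using \<open>i \<notin> F\<close> by (simp add: indicator_vec_insert)
          ultimately have "\<exists>z\<in>kchains (- insert i F) r (a - indicator_vec (insert i F)).
              essential r (a - indicator_vec (insert i F)) z"
            using ess by metis
          then show "i \<in> {i. i \<notin> F \<and> insert i F \<in> X (Suc j)}"
            using \<open>i \<notin> F\<close> cF by (simp add: X_def r_def)
        qed
      qed simp
      finally show "Suc r \<le> card {i. i \<notin> F \<and> insert i F \<in> X (Suc j)}" .
    qed (auto simp: X_def)
    moreover have "Suc j * (p choose Suc j) = Suc r * (p choose j)"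
      using binomial_absorb_comp[of p j] binomial_absorption[of j p] pj by metis
    ultimately have "Suc j * (p choose Suc j) \<le> Suc j * card (X (Suc j))"
      using Suc by (metis Suc_leD le_trans mult_le_mono2)
    then show ?case
      by (simp only: mult_le_cancel1) 
  qed
  from this[of "p - q"] have card_X: "(p choose q) \<le> card (X (p - q))"
    using assms(4,5) by (simp add: binomial_symmetric[of q p])
  define I where "I = (\<lambda>F. a - indicator_vec F) ` X (p - q)"
  have "card I = card (X (p - q))"
    unfolding I_def by (rule card_image) (auto simp: inj_on_def indicator_vec_eq_iff)
  moreover have "\<forall>a'\<in>I. total a' = int q + d \<and> nonzero_class q a'"
    using tot assms(5) by (auto simp: I_def X_def total_diff nonzero_class_def)
  ultimately show ?thesis
    using card_X by (intro exI[of _ I]) (simp add: I_def)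
qed

end

section \<open>Dimensions of quotients\<close>

lemma const_poly_1: "const_poly 1 = 1"
  by (simp add: const_poly_def)

lemma const_poly_add: "const_poly (c + d) = const_poly c + const_poly d"
  by (simp add: const_poly_def single_add)

lemma const_poly_mult: "const_poly (c * d) = const_poly c * (const_poly d :: ('n, 'k::field) mpoly)"
  by (simp add: const_poly_def mult_single)

lemma sum_fun_apply: "(\<Sum>a\<in>A. f a) x = (\<Sum>a\<in>A. f a x)"
  by (induction A rule: infinite_finite_induct) auto

context vector_space
begin

text \<open>Independence of S modulo the span of T. It passes between bases of a quotient and bases
  that extend a basis of the subspace.\<close>

lemma independent_Un_iff:
  assumes "finite S" "finite T" "S \<inter> T = {}" "independent T"
  shows "independent (S \<union> T) \<longleftrightarrow> (\<forall>u. (\<Sum>c\<in>S. scale (u c) c) \<in> span T \<longrightarrow> (\<forall>c\<in>S. u c = 0))"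
proof
  assume ind: "independent (S \<union> T)"
  show "\<forall>u. (\<Sum>c\<in>S. scale (u c) c) \<in> span T \<longrightarrow> (\<forall>c\<in>S. u c = 0)"
  proof (intro allI impI ballI)
    fix u c assume "(\<Sum>c\<in>S. scale (u c) c) \<in> span T" and c: "c \<in> S"
    then obtain v where v: "(\<Sum>c\<in>S. scale (u c) c) = (\<Sum>c\<in>T. scale (v c) c)"
      using assms(2) by (auto simp: span_finite)
    define w where "w c = (if c \<in> S then u c else - v c)" for c
    have "(\<Sum>c\<in>S \<union> T. scale (w c) c) = (\<Sum>c\<in>S. scale (w c) c) + (\<Sum>c\<in>T. scale (w c) c)"
      using assms by (intro sum.union_disjoint) auto
    also have "(\<Sum>c\<in>S. scale (w c) c) = (\<Sum>c\<in>S. scale (u c) c)"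
      by (simp add: w_def)
    also have "(\<Sum>c\<in>T. scale (w c) c) = - (\<Sum>c\<in>T. scale (v c) c)"
      unfolding sum_negf[symmetric] using assms(3) by (intro sum.cong) (auto simp: w_def)
    finally have "w c = 0"
      using independentD[OF ind, of "S \<union> T" w c] assms c v by auto
    then show "u c = 0"
      using c by (simp add: w_def)
  qed
next
  assume *: "\<forall>u. (\<Sum>c\<in>S. scale (u c) c) \<in> span T \<longrightarrow> (\<forall>c\<in>S. u c = 0)"
  show "independent (S \<union> T)"
  proof (rule independent_if_scalars_zero)
    fix w c assume 0: "(\<Sum>c\<in>S \<union> T. scale (w c) c) = 0" and c: "c \<in> S \<union> T"
    have sum: "(\<Sum>c\<in>S. scale (w c) c) = - (\<Sum>c\<in>T. scale (w c) c)"
      using 0 assms by (simp add: sum.union_disjoint add_eq_0_iff2)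
    moreover have "- (\<Sum>c\<in>T. scale (w c) c) \<in> span T"
      by (intro span_neg span_sum span_scale span_base)
    ultimately have S: "\<forall>c\<in>S. w c = 0"
      using * by auto
    then have "(\<Sum>c\<in>T. scale (w c) c) = 0"
      using sum by simp
    then have "\<forall>c\<in>T. w c = 0"
      using independentD[OF assms(4) assms(2), of w] by blast
    with S c show "w c = 0"
      by blast
  qed (use assms in simp)
qed

end

context poly_module
begin

text \<open>Makes tuples a vector space over K, with the pointwise addition of functions, so that
  \<open>quotient_basis\<close> falls under ordinary linear algebra.\<close>

definition tuple_scale :: "'k \<Rightarrow> (nat \<Rightarrow> 'm) \<Rightarrow> nat \<Rightarrow> 'm"
  where "tuple_scale c v = (\<lambda>l. smul (const_poly c) (v l))"

sublocale tuples: vector_space tuple_scale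
  by standard
    (simp_all add: tuple_scale_def fun_eq_iff scale_right_distrib scale_left_distrib
      const_poly_add const_poly_mult const_poly_1)

lemma sum_tuple_scale:
  "(\<lambda>l. \<Sum>c\<in>C. smul (const_poly (u c)) (f c l)) = (\<Sum>c\<in>C. tuple_scale (u c) (f c))"
  by (simp add: fun_eq_iff sum_fun_apply tuple_scale_def)

lemma quotient_basis_iff:
  "quotient_basis smul Z B C \<longleftrightarrow> finite C \<and> C \<subseteq> Z \<and>
    (\<forall>u. (\<Sum>c\<in>C. tuple_scale (u c) c) \<in> B \<longrightarrow> (\<forall>c\<in>C. u c = 0)) \<and>
    (\<forall>z\<in>Z. \<exists>u. z - (\<Sum>c\<in>C. tuple_scale (u c) c) \<in> B)"
proof -
  have "(\<lambda>l. z l - (\<Sum>c\<in>C. smul (const_poly (u c)) (c l))) = z - (\<Sum>c\<in>C. tuple_scale (u c) c)" for u z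
    unfolding sum_tuple_scale[where C = C and u = u and f = "\<lambda>c. c", symmetric] by (simp add: fun_eq_iff)
  then show ?thesis
    unfolding quotient_basis_def sum_tuple_scale[where C = C and f = "\<lambda>c. c"] by simp
qed

text \<open>A nonzero value excludes the default, so there is a nonempty basis; none of its elements
  lies in B.\<close>

lemma quotient_dim_nonzero:
  assumes "quotient_dim smul Z B \<noteq> 0"
  shows "\<exists>z\<in>Z. z \<notin> B"
proof -
  define C where "C = (SOME C. quotient_basis smul Z B C)"
  have "quotient_basis smul Z B C" "card C \<noteq> 0"
    using assms someI_ex[of "quotient_basis smul Z B"]
    by (auto simp: quotient_dim_def C_def split: if_splits)
  moreover from this(2) obtain c where "c \<in> C"
    by fastforce
  ultimately have C: "finite C" "c \<in> C" "c \<in> Z"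
    and ind: "\<And>u. (\<Sum>c\<in>C. tuple_scale (u c) c) \<in> B \<longrightarrow> (\<forall>c\<in>C. u c = 0)"
    unfolding quotient_basis_iff by blast+
  have "(\<Sum>d\<in>C. tuple_scale (if d = c then 1 else 0) d) = (\<Sum>d\<in>C. if d = c then c else 0)"
    by (intro sum.cong) auto
  also have "\<dots> = c"
    using C by simp
  finally have "c \<notin> B"
    using ind[of "\<lambda>d. if d = c then 1 else 0"] C by auto
  then show ?thesis
    using C by blast
qed

text \<open>The finite set X guarantees that a finite quotient basis exists at all. The chosen basis
  is then compared with the family f by the exchange argument, after a basis T of B is added to
  both.\<close>

lemma quotient_dim_ge:
  assumes Z: "tuples.subspace Z" "Z \<subseteq> tuples.span X" "finite X"
    and B: "tuples.subspace B" "B \<subseteq> Z"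
    and I: "finite I" "\<And>i. i \<in> I \<Longrightarrow> f i \<in> Z"
    and ind: "\<And>u i. (\<Sum>i\<in>I. tuple_scale (u i) (f i)) \<in> B \<Longrightarrow> i \<in> I \<Longrightarrow> u i = 0"
  shows "card I \<le> quotient_dim smul Z B"
proof -
  obtain T where T: "T \<subseteq> B" "tuples.independent T" "B \<subseteq> tuples.span T"
    using tuples.maximal_independent_subset[of B] by blast
  have span_T: "tuples.span T = B"
    using T tuples.span_minimal[OF T(1) B(1)] by blast
  have fin_T: "finite T"
    using tuples.independent_span_bound[OF Z(3) T(2)] T(1) B(2) Z(2) by blast
  obtain T' where T': "T \<subseteq> T'" "T' \<subseteq> Z" "tuples.independent T'" "Z \<subseteq> tuples.span T'"
    using tuples.maximal_independent_subset_extend[of T Z] T B by blast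
  have fin_T': "finite T'"
    using tuples.independent_span_bound[OF Z(3) T'(3)] T'(2) Z(2) by blast
  \<comment> \<open>The vectors that extend a basis T of B to a basis T' of Z represent a basis of Z
    / B.\<close>
  have "quotient_basis smul Z B (T' - T)"
    unfolding quotient_basis_iff
  proof (intro conjI ballI)
    have "(T' - T) \<union> T = T'"
      using T'(1) by blast
    then show "\<forall>u. (\<Sum>c\<in>T' - T. tuple_scale (u c) c) \<in> B \<longrightarrow> (\<forall>c\<in>T' - T. u c = 0)"
      using tuples.independent_Un_iff[of "T' - T" T] fin_T fin_T' T(2) T'(3) span_T by auto
    fix z assume "z \<in> Z"
    then obtain u where u: "z = (\<Sum>c\<in>T'. tuple_scale (u c) c)"
      using T'(4) fin_T' by (auto simp: tuples.span_finite)
    have "z - (\<Sum>c\<in>T' - T. tuple_scale (u c) c) = (\<Sum>c\<in>T. tuple_scale (u c) c)"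
      unfolding u using sum.subset_diff[OF T'(1) fin_T', of "\<lambda>c. tuple_scale (u c) c"]
      by (simp add: algebra_simps)
    moreover have "\<dots> \<in> B"
      unfolding span_T[symmetric] by (intro tuples.span_sum tuples.span_scale tuples.span_base)
    ultimately show "\<exists>u. z - (\<Sum>c\<in>T' - T. tuple_scale (u c) c) \<in> B"
      by (intro exI[of _ u]) simp
  qed (use fin_T' T' in auto)
  then have "\<exists>C. quotient_basis smul Z B C" ..
  then obtain C where "quotient_dim smul Z B = card C" and C: "quotient_basis smul Z B C"
    using someI_ex[of "quotient_basis smul Z B"] by (auto simp: quotient_dim_def)
  have delta: "(\<Sum>j\<in>I. tuple_scale (if j = i then c else 0) (f j)) = tuple_scale c (f i)" if "i \<in> I" for i c
  proof -
    have "(\<Sum>j\<in>I. tuple_scale (if j = i then c else 0) (f j)) = (\<Sum>j\<in>I. if j = i then tuple_scale c (f i) else 0)"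
      by (intro sum.cong) auto
    then show ?thesis
      using that I(1) by simp
  qed
  \<comment> \<open>If f i = f j, the coefficients 1 at i and -1 at j give a relation, which the
    independence of the family forbids.\<close>
  have inj: "inj_on f I"
  proof (rule inj_onI, rule ccontr)
    fix i j assume ij: "i \<in> I" "j \<in> I" "f i = f j" "i \<noteq> j"
    have "(\<Sum>l\<in>I. tuple_scale ((if l = i then 1 else 0) + (if l = j then - 1 else 0)) (f l)) = 0"
      unfolding tuples.scale_left_distrib sum.distrib using ij by (simp add: delta)
    also have "0 \<in> B"
      using B(1) by (rule tuples.subspace_0)
    finally show False
      using ind[of "\<lambda>l. (if l = i then 1 else 0) + (if l = j then - 1 else 0)" i] ij by simp
  qed
  have "f ` I \<inter> T = {}"
  proof -
    have "f i \<notin> B" if "i \<in> I" for i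
      using ind[of "\<lambda>l. if l = i then 1 else 0" i] that delta[OF that, of 1] by auto
    then show ?thesis
      using T(1) by blast
  qed
  moreover have "\<forall>c\<in>f ` I. u c = 0" if "(\<Sum>c\<in>f ` I. tuple_scale (u c) c) \<in> tuples.span T" for u
    using that ind[of "u \<circ> f"] unfolding sum.reindex[OF inj] span_T by auto
  ultimately have ind_fT: "tuples.independent (f ` I \<union> T)"
    using tuples.independent_Un_iff[of "f ` I" T] I(1) fin_T T(2) by blast
  have "Z \<subseteq> tuples.span (C \<union> T)"
  proof
    fix z assume "z \<in> Z"
    then obtain u where "z - (\<Sum>c\<in>C. tuple_scale (u c) c) \<in> tuples.span T"
      using C unfolding quotient_basis_iff span_T by blast
    then have "z - (\<Sum>c\<in>C. tuple_scale (u c) c) \<in> tuples.span (C \<union> T)"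
      using tuples.span_mono[of T "C \<union> T"] by blast
    moreover have "(\<Sum>c\<in>C. tuple_scale (u c) c) \<in> tuples.span (C \<union> T)"
      by (intro tuples.span_sum tuples.span_scale tuples.span_base) auto
    ultimately show "z \<in> tuples.span (C \<union> T)"
      using tuples.span_add by fastforce
  qed
  moreover have "f ` I \<union> T \<subseteq> Z"
    using I(2) T(1) B(2) by blast
  moreover have "finite (C \<union> T)"
    using C fin_T by (simp add: quotient_basis_iff)
  \<comment> \<open>An independent subset of Z is no larger than the spanning set; card T then
    cancels on both sides.\<close>
  ultimately have "card (f ` I \<union> T) \<le> card (C \<union> T)"
    using tuples.independent_span_bound[OF _ ind_fT, of "C \<union> T"] by blast
  also have "\<dots> \<le> card C + card T"
    by (rule card_Un_le)
  finally show ?thesis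
    using \<open>f ` I \<inter> T = {}\<close> I(1) fin_T \<open>quotient_dim smul Z B = card C\<close>
    by (simp add: card_Un_disjoint card_image[OF inj])
qed

end

section \<open>Homogeneous polynomials\<close>

lemma total_multidegree_add:
  "total (multidegree (s + t)) = total (multidegree s) + total (multidegree t)"
  by (simp add: total_def multidegree_def lookup_add sum.distrib)

lemma poly_z_partI: "(\<And>t. t \<in> Poly_Mapping.keys f \<Longrightarrow> total (multidegree t) = d) \<Longrightarrow> f \<in> poly_z_part d"
  by (simp add: poly_z_part_def)

lemma poly_z_part_0 [simp]: "0 \<in> poly_z_part d"
  by (simp add: poly_z_part_def)

lemma poly_z_part_1: "1 \<in> poly_z_part 0"
  by (simp add: poly_z_part_def total_def multidegree_def)

lemma poly_z_part_add: "f \<in> poly_z_part d \<Longrightarrow> g \<in> poly_z_part d \<Longrightarrow> f + g \<in> poly_z_part d"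
  for f g :: "('n::finite, 'k::field) mpoly"
  using Poly_Mapping.keys_add[of f g] by (auto simp: poly_z_part_def)

lemma poly_z_part_minus: "f \<in> poly_z_part d \<Longrightarrow> - f \<in> poly_z_part d"
  for f :: "('n::finite, 'k::field) mpoly"
  by (simp add: poly_z_part_def in_keys_iff)

lemma poly_z_part_diff: "f \<in> poly_z_part d \<Longrightarrow> g \<in> poly_z_part d \<Longrightarrow> f - g \<in> poly_z_part d"
  for f g :: "('n::finite, 'k::field) mpoly"
  using poly_z_part_add[of f d "- g"] poly_z_part_minus[of g d] by simp

lemma poly_z_part_mult:
  fixes f g :: "('n::finite, 'k::field) mpoly"
  assumes "f \<in> poly_z_part d" "g \<in> poly_z_part e"
  shows "f * g \<in> poly_z_part (d + e)"
proof (rule poly_z_partI)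
  fix t assume "t \<in> Poly_Mapping.keys (f * g)"
  then obtain s s' where "t = s + s'" "s \<in> Poly_Mapping.keys f" "s' \<in> Poly_Mapping.keys g"
    using keys_mult[of f g] by blast
  then show "total (multidegree t) = d + e"
    using assms by (simp add: total_multidegree_add poly_z_part_def)
qed

lemma poly_z_part_sum: "(\<And>i. i \<in> A \<Longrightarrow> f i \<in> poly_z_part d) \<Longrightarrow> (\<Sum>i\<in>A. f i) \<in> poly_z_part d"
  for f :: "'a \<Rightarrow> ('n::finite, 'k::field) mpoly"
  by (induction A rule: infinite_finite_induct) (auto intro: poly_z_part_add)

definition hom_part :: "int \<Rightarrow> ('n::finite, 'k::field) mpoly \<Rightarrow> ('n, 'k) mpoly"
  where "hom_part d f = Poly_Mapping.mapp (\<lambda>t c. c when total (multidegree t) = d) f"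

lemma lookup_hom_part:
  "Poly_Mapping.lookup (hom_part d f) t = (Poly_Mapping.lookup f t when total (multidegree t) = d)"
  by (simp add: hom_part_def lookup_mapp when_def in_keys_iff)

lemma hom_part_in_poly_z_part: "hom_part d f \<in> poly_z_part d"
  by (rule poly_z_partI) (auto simp: in_keys_iff lookup_hom_part when_def split: if_splits)

lemma hom_part_id: "f \<in> poly_z_part d \<Longrightarrow> hom_part d f = f"
  by (rule poly_mapping_eqI) (auto simp: lookup_hom_part when_def poly_z_part_def in_keys_iff)

lemma hom_part_add: "hom_part d (f + g) = hom_part d f + hom_part d g"
  by (rule poly_mapping_eqI) (auto simp: lookup_hom_part when_def lookup_add)

lemma hom_part_0 [simp]: "hom_part d 0 = 0"
  by (rule poly_mapping_eqI) (simp add: lookup_hom_part)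

lemma hom_part_sum: "hom_part d (\<Sum>i\<in>A. f i) = (\<Sum>i\<in>A. hom_part d (f i))"
  by (induction A rule: infinite_finite_induct) (auto simp: hom_part_add)

text \<open>If h is g without its part of degree d, then no term of f * h has degree e + d. This
  allows lifts of homogeneous elements to be made homogeneous.\<close>

lemma hom_part_mult:
  assumes "f \<in> poly_z_part e"
  shows "hom_part (e + d) (f * g) = f * hom_part d g"
proof -
  define h where "h = g - hom_part d g"
  have h: "total (multidegree t) \<noteq> d" if "t \<in> Poly_Mapping.keys h" for t
    using that by (auto simp: h_def in_keys_iff lookup_minus lookup_hom_part when_def)
  have "hom_part (e + d) (f * h) = 0"
  proof (rule poly_mapping_eqI)
    fix t
    have "Poly_Mapping.lookup (f * h) t = 0" if t: "total (multidegree t) = e + d"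
    proof (rule ccontr)
      assume "Poly_Mapping.lookup (f * h) t \<noteq> 0"
      then have "t \<in> Poly_Mapping.keys (f * h)"
        by (simp add: in_keys_iff)
      then obtain s s' where "t = s + s'" "s \<in> Poly_Mapping.keys f" "s' \<in> Poly_Mapping.keys h"
        using keys_mult[of f h] by blast
      then show False
        using assms t h by (auto simp: total_multidegree_add poly_z_part_def)
    qed
    then show "Poly_Mapping.lookup (hom_part (e + d) (f * h)) t = Poly_Mapping.lookup 0 t"
      by (simp add: lookup_hom_part when_def)
  qed
  moreover have "f * g = f * hom_part d g + f * h"
    by (simp add: h_def algebra_simps)
  ultimately show ?thesis
    using hom_part_id[OF poly_z_part_mult[OF assms hom_part_in_poly_z_part[of d g]]]
    by (simp add: hom_part_add)
qed

text \<open>Exponents are natural numbers, so a sum is 0 only if both summands are. Hence taking the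
  constant term, the map from S to K, is multiplicative.\<close>

lemma lookup_mult_0:
  fixes f g :: "('n, 'k::field) mpoly"
  shows "Poly_Mapping.lookup (f * g) 0 = Poly_Mapping.lookup f 0 * Poly_Mapping.lookup g 0"
proof -
  have sum0: "s + t = 0 \<longleftrightarrow> s = 0 \<and> t = 0" for s t :: "'n \<Rightarrow>\<^sub>0 nat"
    by (auto simp: poly_mapping_eq_iff lookup_add fun_eq_iff)
  have "Poly_Mapping.lookup f s * Sum_any (\<lambda>t. Poly_Mapping.lookup g t when 0 = s + t) =
      ((Poly_Mapping.lookup f 0 * Poly_Mapping.lookup g 0) when s = 0)" for s
  proof -
    have "(\<lambda>t. Poly_Mapping.lookup g t when 0 = s + t) =
        (\<lambda>t. (Poly_Mapping.lookup g 0 when s = 0) when t = 0)"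
      using sum0[of s] by (auto simp: fun_eq_iff when_def)
    then have "Sum_any (\<lambda>t. Poly_Mapping.lookup g t when 0 = s + t) = (Poly_Mapping.lookup g 0 when s = 0)"
      by (simp only: Sum_any_when_equal)
    then show ?thesis
      by (cases "s = 0") auto
  qed
  then show ?thesis
    by (simp add: lookup_mult)
qed

lemma lookup_sum_poly: "Poly_Mapping.lookup (\<Sum>i\<in>A. f i) t = (\<Sum>i\<in>A. Poly_Mapping.lookup (f i) t)"
  by (induction A rule: infinite_finite_induct) (auto simp: lookup_add)

section \<open>Comparison of resolutions\<close>

type_synonym ('n, 'k) pmat = "nat \<Rightarrow> nat \<Rightarrow> ('n, 'k) mpoly"

definition mat_mult :: "nat \<Rightarrow> ('n, 'k::field) pmat \<Rightarrow> ('n, 'k) pmat \<Rightarrow> ('n, 'k) pmat"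
  where "mat_mult c A B = (\<lambda>l m. \<Sum>j<c. A l j * B j m)"

definition mat_diff :: "('n, 'k::field) pmat \<Rightarrow> ('n, 'k) pmat \<Rightarrow> ('n, 'k) pmat"
  where "mat_diff A B = (\<lambda>l m. A l m - B l m)"

definition id_mat :: "nat \<Rightarrow> ('n, 'k::field) pmat"
  where "id_mat r = (\<lambda>l m. if l = m \<and> l < r then 1 else 0)"

text \<open>
  Matrices of degree preserving maps \<open>\<Oplus>\<^sub>m\<^sub><\<^sub>c S(- t m) \<rightarrow> \<Oplus>\<^sub>l\<^sub><\<^sub>r S(- s l)\<close>, extended by 0 outside
  their bounds.
\<close>

definition hom_mats :: "nat \<Rightarrow> (nat \<Rightarrow> int) \<Rightarrow> nat \<Rightarrow> (nat \<Rightarrow> int) \<Rightarrow> ('n::finite, 'k::field) pmat set"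
  where "hom_mats r s c t =
    {A. \<forall>l m. if l < r \<and> m < c then A l m \<in> poly_z_part (t m - s l) else A l m = 0}"

lemma hom_matsI:
  "(\<And>l m. l < r \<Longrightarrow> m < c \<Longrightarrow> A l m \<in> poly_z_part (t m - s l)) \<Longrightarrow>
   (\<And>l m. r \<le> l \<or> c \<le> m \<Longrightarrow> A l m = 0) \<Longrightarrow> A \<in> hom_mats r s c t"
  unfolding hom_mats_def mem_Collect_eq by (metis linorder_not_less)

lemma hom_matsD: "A \<in> hom_mats r s c t \<Longrightarrow> A l m \<in> poly_z_part (t m - s l)"
  by (cases "l < r \<and> m < c") (auto simp: hom_mats_def dest: spec)

lemma hom_mats_eq_0: "A \<in> hom_mats r s c t \<Longrightarrow> r \<le> l \<or> c \<le> m \<Longrightarrow> A l m = 0"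
  unfolding hom_mats_def mem_Collect_eq by (metis linorder_not_less)

lemma hom_mats_mult:
  assumes "A \<in> hom_mats r s c t" "B \<in> hom_mats c t c' t'"
  shows "mat_mult c A B \<in> hom_mats r s c' t'"
proof (rule hom_matsI)
  fix l m
  have "A l j * B j m \<in> poly_z_part (t' m - s l)" for j
    using poly_z_part_mult[OF hom_matsD[OF assms(1), of l j] hom_matsD[OF assms(2), of j m]] by simp
  then show "mat_mult c A B l m \<in> poly_z_part (t' m - s l)"
    by (simp add: mat_mult_def poly_z_part_sum)
qed (auto simp: mat_mult_def hom_mats_eq_0[OF assms(1)] hom_mats_eq_0[OF assms(2)])

lemma hom_mats_diff:
  assumes "A \<in> hom_mats r s c t" "B \<in> hom_mats r s c t"
  shows "mat_diff A B \<in> hom_mats r s c t"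
  using hom_matsD[OF assms(1)] hom_matsD[OF assms(2)]
  by (intro hom_matsI) (auto simp: mat_diff_def hom_mats_eq_0[OF assms(1)] hom_mats_eq_0[OF assms(2)]
      intro: poly_z_part_diff)

lemma id_mat_in_hom_mats: "id_mat r \<in> hom_mats r s r s"
  by (rule hom_matsI) (auto simp: id_mat_def poly_z_part_1)

lemma mat_mult_assoc: "mat_mult c (mat_mult c' A B) C = mat_mult c' A (mat_mult c B C)"
proof (intro ext)
  fix l m
  have "mat_mult c (mat_mult c' A B) C l m = (\<Sum>j<c. \<Sum>i<c'. A l i * B i j * C j m)"
    by (simp add: mat_mult_def sum_distrib_right)
  also have "\<dots> = (\<Sum>i<c'. \<Sum>j<c. A l i * B i j * C j m)"
    by (rule sum.swap)
  also have "\<dots> = mat_mult c' A (mat_mult c B C) l m"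
    by (simp add: mat_mult_def sum_distrib_left mult.assoc)
  finally show "mat_mult c (mat_mult c' A B) C l m = mat_mult c' A (mat_mult c B C) l m" .
qed

lemma mat_mult_diff_left: "mat_mult c (mat_diff A B) C = mat_diff (mat_mult c A C) (mat_mult c B C)"
  by (simp add: mat_mult_def mat_diff_def left_diff_distrib sum_subtractf)

lemma mat_mult_diff_right: "mat_mult c A (mat_diff B C) = mat_diff (mat_mult c A B) (mat_mult c A C)"
  by (simp add: mat_mult_def mat_diff_def right_diff_distrib sum_subtractf)

lemma mat_mult_0_right: "mat_mult c A (\<lambda>l m. 0) = (\<lambda>l m. 0)"
  by (simp add: mat_mult_def)

lemma mat_mult_id_left:
  assumes "A \<in> hom_mats r s c t"
  shows "mat_mult r (id_mat r) A = A"
proof (intro ext)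
  fix l m
  have "mat_mult r (id_mat r) A l m = (\<Sum>j<r. if j = l then A l m else 0)"
    unfolding mat_mult_def by (intro sum.cong) (auto simp: id_mat_def)
  also have "\<dots> = A l m"
    by (simp add: hom_mats_eq_0[OF assms])
  finally show "mat_mult r (id_mat r) A l m = A l m" .
qed

lemma mat_mult_id_right:
  assumes "A \<in> hom_mats r s c t"
  shows "mat_mult c A (id_mat c) = A"
proof (intro ext)
  fix l m
  have "mat_mult c A (id_mat c) l m = (\<Sum>j<c. if j = m then A l m else 0)"
    unfolding mat_mult_def by (intro sum.cong) (auto simp: id_mat_def)
  also have "\<dots> = A l m"
    by (simp add: hom_mats_eq_0[OF assms])
  finally show "mat_mult c A (id_mat c) l m = A l m" .
qed

text \<open>\<open>dmat\<close> is unconstrained outside the ranks. The truncated matrix lies in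
  \<open>hom_mats\<close>, so matrix identities hold at all indices.\<close>

definition diff_mat :: "('n, 'k::field) free_complex \<Rightarrow> nat \<Rightarrow> ('n, 'k) pmat"
  where "diff_mat P i = (\<lambda>l m. if l < frank P i \<and> m < frank P (Suc i) then dmat P i l m else 0)"

lemma tensor_diff_mult_eq:
  "tensor_diff (*) P (Suc i) v = (\<lambda>l. \<Sum>m<frank P (Suc i). diff_mat P i l m * v m)"
  by (auto simp: fun_eq_iff diff_mat_def)

text \<open>The augmentation e is a parameter, because comparison maps must be compatible with the
  augmentations of both resolutions.\<close>

locale residue_resolution =
  fixes P :: "('n::finite, 'k::field) free_complex" and e :: "nat \<Rightarrow> 'k"
  assumes dmat_hom: "l < frank P i \<Longrightarrow> m < frank P (Suc i) \<Longrightarrow>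
      dmat P i l m \<in> poly_z_part (shift P (Suc i) m - shift P i l)"
    and aug_hom: "l < frank P 0 \<Longrightarrow> e l \<in> residue_grading (shift P 0 l)"
    and aug_surj: "\<exists>v\<in>tensor_chains P 0. y = (\<Sum>l<frank P 0. residue_smul (v l :: ('n, 'k) mpoly) (e l))"
    and aug_exact: "{v \<in> tensor_chains P 0. (\<Sum>l<frank P 0. residue_smul (v l) (e l)) = 0} =
           tensor_diff (*) P 1 ` tensor_chains P 1"
    and exact: "{v \<in> tensor_chains P (Suc i). tensor_diff (*) P (Suc i) v = (\<lambda>l. 0)} =
           tensor_diff (*) P (Suc (Suc i)) ` tensor_chains P (Suc (Suc i))"

lemma graded_free_resolution_residue_iff:
  fixes P :: "('n::finite, 'k::field) free_complex"
  shows "graded_free_resolution residue_smul residue_grading P \<longleftrightarrow> (\<exists>e. residue_resolution P e)"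
proof
  assume *: "graded_free_resolution residue_smul residue_grading P"
  note hom = conjunct1[OF *[unfolded graded_free_resolution_def]]
    and ex = conjunct2[OF conjunct2[OF *[unfolded graded_free_resolution_def]]]
  obtain e where e: "\<forall>l<frank P 0. e l \<in> residue_grading (shift P 0 l)"
    and surj: "\<forall>y. \<exists>v\<in>tensor_chains P 0. y = (\<Sum>l<frank P 0. residue_smul (v l :: ('n, 'k) mpoly) (e l))"
    and aug: "{v \<in> tensor_chains P 0. (\<Sum>l<frank P 0. residue_smul (v l) (e l)) = 0} =
      tensor_diff (*) P 1 ` tensor_chains P 1"
    using * unfolding graded_free_resolution_def by (elim conjE exE) (rule that; assumption)
  have "residue_resolution P e"
    by (rule residue_resolution.intro; (rule aug | simp only: hom e surj | rule ex[rule_format] | use hom in blast))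
  then show "\<exists>e. residue_resolution P e"
    by (rule exI[of _ e])
next
  assume "\<exists>e. residue_resolution P e"
  then obtain e where "residue_resolution P e" ..
  then interpret residue_resolution P e .
  show "graded_free_resolution residue_smul residue_grading P"
    unfolding graded_free_resolution_def
    by (intro conjI allI impI exI[of _ e]) (fact dmat_hom aug_hom aug_surj aug_exact exact)+
qed

context residue_resolution
begin

text \<open>The columns are cycles of the augmented complex: in degree 0 the augmentation takes the
  place of the differential, so one lifting lemma covers all degrees.\<close>

definition cycle_mat :: "nat \<Rightarrow> ('n, 'k) pmat \<Rightarrow> bool"
  where "cycle_mat i W \<longleftrightarrow>
    (case i of 0 \<Rightarrow> \<forall>m. (\<Sum>l<frank P 0. residue_smul (W l m) (e l)) = 0
     | Suc j \<Rightarrow> mat_mult (frank P (Suc j)) (diff_mat P j) W = (\<lambda>l m. 0))"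

lemma cycle_mat_0: "cycle_mat 0 W \<longleftrightarrow> (\<forall>m. (\<Sum>l<frank P 0. residue_smul (W l m) (e l)) = 0)"
  by (simp add: cycle_mat_def)

lemma cycle_mat_Suc:
  "cycle_mat (Suc j) W \<longleftrightarrow> mat_mult (frank P (Suc j)) (diff_mat P j) W = (\<lambda>l m. 0)"
  by (simp add: cycle_mat_def)

abbreviation "mats i c t \<equiv> hom_mats (frank P i) (shift P i) c t"

lemma diff_mat_hom: "diff_mat P i \<in> mats i (frank P (Suc i)) (shift P (Suc i))"
  by (rule hom_matsI) (auto simp: diff_mat_def dmat_hom)

lemma cycle_mat_column:
  assumes "cycle_mat i W" "W \<in> mats i c t"
  shows "\<exists>v\<in>tensor_chains P (Suc i). tensor_diff (*) P (Suc i) v = (\<lambda>l. W l m)"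
proof -
  have W: "(\<lambda>l. W l m) \<in> tensor_chains P i"
    using hom_mats_eq_0[OF assms(2)] by (simp add: tensor_chains_def)
  show ?thesis
  proof (cases i)
    case 0
    then have "(\<lambda>l. W l m) \<in> tensor_diff (*) P 1 ` tensor_chains P 1"
      using W assms(1) by (subst aug_exact[symmetric]) (simp add: cycle_mat_0)
    then show ?thesis
      using 0 by force
  next
    case (Suc j)
    then have "tensor_diff (*) P (Suc j) (\<lambda>l. W l m) = (\<lambda>l. 0)"
      using assms(1) unfolding tensor_diff_mult_eq by (simp add: cycle_mat_Suc mat_mult_def fun_eq_iff)
    then have "(\<lambda>l. W l m) \<in> tensor_diff (*) P (Suc (Suc j)) ` tensor_chains P (Suc (Suc j))"
      using W Suc by (subst exact[symmetric]) simp
    then show ?thesis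
      using Suc by force
  qed
qed

text \<open>Exactness lifts each column to arbitrary polynomials. Their homogeneous parts of the
  required degrees still form a lift, because the differential is homogeneous.\<close>

lemma cycle_mat_lift:
  assumes "cycle_mat i W" and W: "W \<in> mats i c t"
  shows "\<exists>V\<in>mats (Suc i) c t. mat_mult (frank P (Suc i)) (diff_mat P i) V = W"
proof -
  obtain v where v: "\<And>m. tensor_diff (*) P (Suc i) (v m) = (\<lambda>l. W l m)"
    using cycle_mat_column[OF assms] by metis
  define V where "V l m = (if l < frank P (Suc i) \<and> m < c then hom_part (t m - shift P (Suc i) l) (v m l) else 0)"
    for l m
  have "V \<in> mats (Suc i) c t"
    by (rule hom_matsI) (auto simp: V_def hom_part_in_poly_z_part)
  moreover have "mat_mult (frank P (Suc i)) (diff_mat P i) V l m = W l m" for l m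
  proof (cases "m < c")
    case True
    have "diff_mat P i l j * V j m = hom_part (t m - shift P i l) (diff_mat P i l j * v m j)"
      if "j < frank P (Suc i)" for j
      using hom_part_mult[OF hom_matsD[OF diff_mat_hom[of i], of l j], of "t m - shift P (Suc i) j" "v m j"]
        that True by (simp add: V_def)
    then have "mat_mult (frank P (Suc i)) (diff_mat P i) V l m =
        hom_part (t m - shift P i l) (\<Sum>j<frank P (Suc i). diff_mat P i l j * v m j)"
      by (simp add: mat_mult_def hom_part_sum)
    also have "(\<Sum>j<frank P (Suc i). diff_mat P i l j * v m j) = W l m"
      using fun_cong[OF v[of m], of l] unfolding tensor_diff_mult_eq .
    finally show ?thesis
      using hom_matsD[OF W] by (simp add: hom_part_id)
  next
    case False
    then show ?thesis
      using hom_mats_eq_0[OF W] by (simp add: mat_mult_def V_def)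
  qed
  ultimately show ?thesis
    by (intro bexI[of _ V]) auto
qed

lemma unit_column:
  assumes "m < frank P i"
  shows "(\<lambda>l. if l = m then 1 else 0) \<in> tensor_chains P i"
  using assms by (auto simp: tensor_chains_def)

lemma tensor_diff_unit_column:
  assumes "m < frank P (Suc i)"
  shows "tensor_diff (*) P (Suc i) (\<lambda>l. if l = m then 1 else 0) = (\<lambda>l. diff_mat P i l m)"
proof
  fix l
  have "(\<Sum>j<frank P (Suc i). diff_mat P i l j * (if j = m then 1 else 0)) =
      (\<Sum>j<frank P (Suc i). if j = m then diff_mat P i l m else 0)"
    by (intro sum.cong) auto
  also have "\<dots> = diff_mat P i l m"
    using assms by simp
  finally show "tensor_diff (*) P (Suc i) (\<lambda>l. if l = m then 1 else 0) l = diff_mat P i l m"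
    unfolding tensor_diff_mult_eq .
qed

text \<open>That the differential squares to 0 is one half of exactness: the columns are images of
  basis vectors, and images are kernels.\<close>

lemma cycle_diff_mat: "cycle_mat i (diff_mat P i)"
proof (cases i)
  case 0
  have "(\<Sum>l<frank P 0. residue_smul (diff_mat P 0 l m) (e l)) = 0" for m
  proof (cases "m < frank P 1")
    case True
    have "(\<lambda>l. diff_mat P 0 l m) \<in> tensor_diff (*) P 1 ` tensor_chains P 1"
      using imageI[OF unit_column[of m 1], of "tensor_diff (*) P 1"] tensor_diff_unit_column[of m 0] True
      by (simp del: tensor_diff.simps)
    then show ?thesis
      unfolding aug_exact[symmetric] by simp
  next
    case False
    then show ?thesis
      by (simp add: diff_mat_def residue_smul_def)
  qed
  with 0 show ?thesis
    by (simp add: cycle_mat_0)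
next
  case (Suc j)
  have "mat_mult (frank P (Suc j)) (diff_mat P j) (diff_mat P (Suc j)) l m = 0" for l m
  proof (cases "m < frank P (Suc (Suc j))")
    case True
    have "(\<lambda>l. diff_mat P (Suc j) l m) \<in> tensor_diff (*) P (Suc (Suc j)) ` tensor_chains P (Suc (Suc j))"
      using imageI[OF unit_column[of m "Suc (Suc j)"], of "tensor_diff (*) P (Suc (Suc j))"]
        tensor_diff_unit_column[of m "Suc j"] True
      by (simp del: tensor_diff.simps)
    then have "tensor_diff (*) P (Suc j) (\<lambda>l. diff_mat P (Suc j) l m) = (\<lambda>l. 0)"
      unfolding exact[symmetric] by blast
    from fun_cong[OF this, of l] show ?thesis
      unfolding tensor_diff_mult_eq mat_mult_def .
  next
    case False
    then show ?thesis
      by (simp add: mat_mult_def diff_mat_def)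
  qed
  with Suc show ?thesis
    by (simp add: cycle_mat_Suc fun_eq_iff)
qed

lemma diff_mat_diff_mat:
  "mat_mult (frank P (Suc i)) (diff_mat P i) (diff_mat P (Suc i)) = (\<lambda>l m. 0)"
  using cycle_diff_mat[of "Suc i"] by (simp add: cycle_mat_Suc)

lemma null_homotopy:
  assumes f: "\<And>i. f i \<in> mats i (frank P i) (shift P i)"
    and chain: "\<And>i. mat_mult (frank P (Suc i)) (diff_mat P i) (f (Suc i)) = mat_mult (frank P i) (f i) (diff_mat P i)"
    and f0: "cycle_mat 0 (f 0)"
  shows "\<exists>h. (\<forall>i. h i \<in> mats (Suc i) (frank P i) (shift P i)) \<and>
    mat_mult (frank P 1) (diff_mat P 0) (h 0) = f 0 \<and>
    (\<forall>i. mat_mult (frank P (Suc (Suc i))) (diff_mat P (Suc i)) (h (Suc i)) =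
      mat_diff (f (Suc i)) (mat_mult (frank P i) (h i) (diff_mat P i)))"
proof -
  \<comment> \<open>The invariant is d h d = f d. It follows from the homotopy equation but does not
    mention the preceding homotopy, so it is a property of h alone; in degree 0 the full equation d
    h = f is kept.\<close>
  define S where "S i h \<longleftrightarrow> h \<in> mats (Suc i) (frank P i) (shift P i) \<and>
    mat_mult (frank P (Suc i)) (diff_mat P i) (mat_mult (frank P i) h (diff_mat P i)) =
    mat_mult (frank P i) (f i) (diff_mat P i) \<and>
    (i = 0 \<longrightarrow> mat_mult (frank P 1) (diff_mat P 0) h = f 0)" for i h
  define R where "R i h h' \<longleftrightarrow> mat_mult (frank P (Suc (Suc i))) (diff_mat P (Suc i)) h' =
      mat_diff (f (Suc i)) (mat_mult (frank P i) h (diff_mat P i))" for i h h'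
  have "\<exists>h. \<forall>i. S i (h i) \<and> R i (h i) (h (Suc i))"
  proof (rule dependent_nat_choice)
    obtain h where h: "h \<in> mats 1 (frank P 0) (shift P 0)" "mat_mult (frank P 1) (diff_mat P 0) h = f 0"
      using cycle_mat_lift[OF f0 f] by auto
    then have "S 0 h"
      by (simp add: S_def mat_mult_assoc[symmetric])
    then show "\<exists>h. S 0 h"
      by blast
  next
    fix h i assume h: "S i h"
    let ?W = "mat_diff (f (Suc i)) (mat_mult (frank P i) h (diff_mat P i))"
    \<comment> \<open>Since f is a chain map, d applied to f - h d gives f d - d h d, which is 0 by
      the invariant.\<close>
    have "cycle_mat (Suc i) ?W"
      using h by (simp add: S_def cycle_mat_Suc mat_mult_diff_right chain) (simp add: mat_diff_def)
    moreover have "?W \<in> mats (Suc i) (frank P (Suc i)) (shift P (Suc i))"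
      using h by (intro hom_mats_diff[OF f hom_mats_mult[OF _ diff_mat_hom]]) (simp add: S_def)
    ultimately obtain h' where h': "h' \<in> mats (Suc (Suc i)) (frank P (Suc i)) (shift P (Suc i))"
      "mat_mult (frank P (Suc (Suc i))) (diff_mat P (Suc i)) h' = ?W"
      using cycle_mat_lift by blast
    have "mat_mult (frank P (Suc (Suc i))) (diff_mat P (Suc i))
        (mat_mult (frank P (Suc i)) h' (diff_mat P (Suc i))) =
        mat_mult (frank P (Suc i)) ?W (diff_mat P (Suc i))"
      by (simp only: mat_mult_assoc[symmetric] h')
    also have "\<dots> = mat_mult (frank P (Suc i)) (f (Suc i)) (diff_mat P (Suc i))"
      by (simp add: mat_mult_diff_left mat_mult_assoc diff_mat_diff_mat mat_mult_0_right)
        (simp add: mat_diff_def)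
    finally have "S (Suc i) h'"
      using h' by (simp add: S_def)
    then show "\<exists>h'. S (Suc i) h' \<and> R i h h'"
      using h' unfolding R_def by blast
  qed
  then show ?thesis
    unfolding S_def R_def by blast
qed

end

lemma comparison_map:
  fixes P Q :: "('n::finite, 'k::field) free_complex"
  assumes "residue_resolution P e" "residue_resolution Q e'"
  shows "\<exists>\<phi> :: nat \<Rightarrow> ('n, 'k) pmat.
    (\<forall>i. \<phi> i \<in> hom_mats (frank Q i) (shift Q i) (frank P i) (shift P i)) \<and>
    (\<forall>i. mat_mult (frank Q (Suc i)) (diff_mat Q i) (\<phi> (Suc i)) = mat_mult (frank P i) (\<phi> i) (diff_mat P i)) \<and>
    (\<forall>m<frank P 0. (\<Sum>l<frank Q 0. residue_smul (\<phi> 0 l m) (e' l)) = e m)"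
proof -
  interpret P: residue_resolution P e by fact
  interpret Q: residue_resolution Q e' by fact
  define A where "A h \<longleftrightarrow> (\<forall>m<frank P 0. (\<Sum>l<frank Q 0. residue_smul (h l m) (e' l)) = e m)"
    for h :: "('n, 'k) pmat"
  \<comment> \<open>That the columns of h d are cycles of Q is what exactness of Q needs in order to
    give the next map.\<close>
  define S where "S i h \<longleftrightarrow> h \<in> Q.mats i (frank P i) (shift P i) \<and>
    Q.cycle_mat i (mat_mult (frank P i) h (diff_mat P i)) \<and> (i = 0 \<longrightarrow> A h)" for i h
  define R where "R i h h' \<longleftrightarrow>
    mat_mult (frank Q (Suc i)) (diff_mat Q i) h' = mat_mult (frank P i) h (diff_mat P i)" for i h h'
  have "\<exists>\<phi>. \<forall>i. S i (\<phi> i) \<and> R i (\<phi> i) (\<phi> (Suc i))"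
  proof (rule dependent_nat_choice)
    have "\<forall>m. \<exists>v :: nat \<Rightarrow> ('n, 'k) mpoly. e m = (\<Sum>l<frank Q 0. residue_smul (v l) (e' l))"
      using Q.aug_surj by blast
    from choice[OF this] obtain v :: "nat \<Rightarrow> nat \<Rightarrow> ('n, 'k) mpoly"
      where v: "\<And>m. e m = (\<Sum>l<frank Q 0. residue_smul (v m l) (e' l))"
      by blast
    \<comment> \<open>A column with e m nonzero has degree 0, so its homogeneous part keeps the
      constant terms at all l with shift 0. At every other l the augmentation e' l vanishes, hence
      the truncation does not change the augmented value.\<close>
    define h where "h l m = (if l < frank Q 0 \<and> m < frank P 0 \<and> e m \<noteq> 0
      then hom_part (shift P 0 m - shift Q 0 l) (v m l) else 0)" for l m
    have h: "h \<in> Q.mats 0 (frank P 0) (shift P 0)"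
      by (rule hom_matsI) (auto simp: h_def hom_part_in_poly_z_part)
    have deg: "total (multidegree (0 :: 'n \<Rightarrow>\<^sub>0 nat)) = 0"
      by (simp add: total_def multidegree_def)
    have "(\<Sum>l<frank Q 0. residue_smul (h l m) (e' l)) = e m" if m: "m < frank P 0" for m
    proof (cases "e m = 0")
      case True
      then show ?thesis
        by (simp add: h_def residue_smul_def)
    next
      case False
      then have "shift P 0 m = 0"
        using P.aug_hom[OF m] by (auto simp: residue_grading_def split: if_splits)
      moreover have "e' l = 0 \<or> shift Q 0 l = 0" if "l < frank Q 0" for l
        using Q.aug_hom[OF that] by (auto simp: residue_grading_def split: if_splits)
      ultimately have "residue_smul (h l m) (e' l) = residue_smul (v m l) (e' l)" if "l < frank Q 0" for l
        using that False m by (force simp: h_def residue_smul_def lookup_hom_part deg)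
      then show ?thesis
        unfolding v[of m] by (intro sum.cong) auto
    qed
    then have A: "A h"
      by (simp add: A_def)
    \<comment> \<open>As constant terms are multiplicative, the augmentation of Q after h d is the
      augmentation of P after d, which is 0.\<close>
    have "(\<Sum>l<frank Q 0. residue_smul (mat_mult (frank P 0) h (diff_mat P 0) l m) (e' l)) =
        (\<Sum>j<frank P 0. (\<Sum>l<frank Q 0. residue_smul (h l j) (e' l)) * Poly_Mapping.lookup (diff_mat P 0 j m) 0)" for m
      unfolding mat_mult_def residue_smul_def lookup_sum_poly lookup_mult_0 sum_distrib_right
      by (subst sum.swap) (simp add: ac_simps)
    also have "\<dots> m = (\<Sum>j<frank P 0. residue_smul (diff_mat P 0 j m) (e j))" for m
      using A by (intro sum.cong) (auto simp: A_def residue_smul_def)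
    also have "\<dots> m = 0" for m
      using P.cycle_diff_mat[of 0] by (simp add: P.cycle_mat_0)
    finally have "Q.cycle_mat 0 (mat_mult (frank P 0) h (diff_mat P 0))"
      by (simp add: Q.cycle_mat_0)
    then show "\<exists>h. S 0 h"
      using h A by (auto simp: S_def)
  next
    fix h i assume h: "S i h"
    let ?W = "mat_mult (frank P i) h (diff_mat P i)"
    have "?W \<in> Q.mats i (frank P (Suc i)) (shift P (Suc i))"
      using h by (intro hom_mats_mult[OF _ P.diff_mat_hom]) (simp add: S_def)
    then obtain h' where h': "h' \<in> Q.mats (Suc i) (frank P (Suc i)) (shift P (Suc i))"
      "mat_mult (frank Q (Suc i)) (diff_mat Q i) h' = ?W"
      using Q.cycle_mat_lift h unfolding S_def by blast
    have "Q.cycle_mat (Suc i) (mat_mult (frank P (Suc i)) h' (diff_mat P (Suc i)))"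
      unfolding Q.cycle_mat_Suc mat_mult_assoc[symmetric] h'(2)
      by (simp add: mat_mult_assoc P.diff_mat_diff_mat mat_mult_0_right)
    then show "\<exists>h'. S (Suc i) h' \<and> R i h h'"
      using h' unfolding S_def R_def by blast
  qed
  then show ?thesis
    unfolding S_def R_def A_def by blast
qed

section \<open>Tensoring with M: polynomial matrices acting on tuples of module elements\<close>

context poly_module
begin

definition apply_mat :: "nat \<Rightarrow> ('n, 'k) pmat \<Rightarrow> (nat \<Rightarrow> 'm) \<Rightarrow> nat \<Rightarrow> 'm"
  where "apply_mat c A v = (\<lambda>l. \<Sum>m<c. smul (A l m) (v m))"

lemma apply_mat_mult: "apply_mat c' (mat_mult c A B) v = apply_mat c A (apply_mat c' B v)"
proof
  fix l
  have "apply_mat c' (mat_mult c A B) v l = (\<Sum>m<c'. \<Sum>j<c. smul (A l j) (smul (B j m) (v m)))"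
    by (simp add: apply_mat_def mat_mult_def scale_sum_left)
  also have "\<dots> = (\<Sum>j<c. \<Sum>m<c'. smul (A l j) (smul (B j m) (v m)))"
    by (rule sum.swap)
  also have "\<dots> = apply_mat c A (apply_mat c' B v) l"
    by (simp add: apply_mat_def scale_sum_right)
  finally show "apply_mat c' (mat_mult c A B) v l = apply_mat c A (apply_mat c' B v) l" .
qed

lemma apply_mat_diff_left: "apply_mat c (mat_diff A B) v = apply_mat c A v - apply_mat c B v"
  by (simp add: apply_mat_def mat_diff_def fun_eq_iff scale_left_diff_distrib sum_subtractf)

lemma apply_mat_add: "apply_mat c A (v + w) = apply_mat c A v + apply_mat c A w"
  by (simp add: apply_mat_def fun_eq_iff scale_right_distrib sum.distrib)

lemma apply_mat_diff: "apply_mat c A (v - w) = apply_mat c A v - apply_mat c A w"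
  by (simp add: apply_mat_def fun_eq_iff scale_right_diff_distrib sum_subtractf)

lemma apply_mat_tuple_scale: "apply_mat c A (tuple_scale r v) = tuple_scale r (apply_mat c A v)"
  by (simp add: apply_mat_def tuple_scale_def fun_eq_iff scale_sum_right mult.commute)

lemma apply_mat_0: "apply_mat c A 0 = 0"
  by (simp add: apply_mat_def fun_eq_iff)

lemma apply_mat_sum: "apply_mat c A (\<Sum>i\<in>I. v i) = (\<Sum>i\<in>I. apply_mat c A (v i))"
  by (induction I rule: infinite_finite_induct) (simp_all only: sum.infinite sum.empty sum.insert not_False_eq_True apply_mat_0 apply_mat_add)

lemma apply_id_mat:
  assumes "v \<in> tensor_chains P i"
  shows "apply_mat (frank P i) (id_mat (frank P i)) v = v"
proof
  fix l
  have "apply_mat (frank P i) (id_mat (frank P i)) v l =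
      (\<Sum>m<frank P i. if m = l then v l else 0)"
    unfolding apply_mat_def by (intro sum.cong) (auto simp: id_mat_def)
  also have "\<dots> = v l"
    using assms by (simp add: tensor_chains_def)
  finally show "apply_mat (frank P i) (id_mat (frank P i)) v l = v l" .
qed

lemma tensor_diff_eq: "tensor_diff smul P (Suc i) v = apply_mat (frank P (Suc i)) (diff_mat P i) v"
  by (auto simp: fun_eq_iff apply_mat_def diff_mat_def)

end

locale z_graded_module = poly_module smul
  for smul :: "('n::finite, 'k::field) mpoly \<Rightarrow> 'm::ab_group_add \<Rightarrow> 'm" +
  fixes H :: "int \<Rightarrow> 'm set"
  assumes H_0: "0 \<in> H d"
    and H_add: "x \<in> H d \<Longrightarrow> y \<in> H d \<Longrightarrow> x + y \<in> H d"
    and H_smul: "f \<in> poly_z_part c \<Longrightarrow> x \<in> H d \<Longrightarrow> smul f x \<in> H (c + d)"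
begin

lemma H_sum: "(\<And>i. i \<in> I \<Longrightarrow> f i \<in> H d) \<Longrightarrow> (\<Sum>i\<in>I. f i) \<in> H d"
  by (induction I rule: infinite_finite_induct) (auto intro: H_0 H_add)

lemma H_scale: "x \<in> H d \<Longrightarrow> smul (const_poly c) x \<in> H d"
  using H_smul[of "const_poly c" 0] by (simp add: const_poly_def poly_z_part_def multidegree_def total_def)

lemma tensor_chains_gr_iff:
  "v \<in> tensor_chains_gr H P i d \<longleftrightarrow> v \<in> tensor_chains P i \<and> (\<forall>l. v l \<in> H (d - shift P i l))"
proof -
  have "v l \<in> H (d - shift P i l)" if "v \<in> tensor_chains P i" "frank P i \<le> l" for l
    using that by (simp add: tensor_chains_def H_0)
  then show ?thesis
    unfolding tensor_chains_gr_def by (auto simp: not_less intro: leI)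
qed

lemma subspace_tensor_chains_gr: "tuples.subspace (tensor_chains_gr H P i d)"
  by (rule tuples.subspaceI)
    (auto simp: tensor_chains_gr_def tensor_chains_def tuple_scale_def H_0 H_add H_scale)

lemma apply_mat_chains:
  assumes "A \<in> hom_mats (frank Q j) (shift Q j) (frank P i) (shift P i)"
    and "v \<in> tensor_chains_gr H P i d"
  shows "apply_mat (frank P i) A v \<in> tensor_chains_gr H Q j d"
proof -
  have "smul (A l m) (v m) \<in> H (d - shift Q j l)" for l m
    using H_smul[OF hom_matsD[OF assms(1), of l m], of "v m" "d - shift P i m"] assms(2)
    by (simp add: tensor_chains_gr_iff)
  then show ?thesis
    using hom_mats_eq_0[OF assms(1)]
    by (auto simp: tensor_chains_gr_iff tensor_chains_def apply_mat_def intro: H_sum)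
qed

definition cycles :: "('n, 'k) free_complex \<Rightarrow> nat \<Rightarrow> int \<Rightarrow> (nat \<Rightarrow> 'm) set"
  where "cycles P i d = {v \<in> tensor_chains_gr H P i d. tensor_diff smul P i v = (\<lambda>l. 0)}"

definition boundaries :: "('n, 'k) free_complex \<Rightarrow> nat \<Rightarrow> int \<Rightarrow> (nat \<Rightarrow> 'm) set"
  where "boundaries P i d = tensor_diff smul P (Suc i) ` tensor_chains_gr H P (Suc i) d"

text \<open>
  A comparison map of resolutions is a homotopy equivalence, so it induces an injection in the
  homology of the tensor product.
\<close>

lemma homology_embedding:
  assumes "residue_resolution P e" "residue_resolution Q e'"
  shows "\<exists>c A. \<forall>d. apply_mat c A ` cycles P i d \<subseteq> cycles Q i d \<and>
    (\<forall>z\<in>cycles P i d. apply_mat c A z \<in> boundaries Q i d \<longrightarrow> z \<in> boundaries P i d)"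
proof -
  interpret P: residue_resolution P e by fact
  interpret Q: residue_resolution Q e' by fact
  obtain \<phi> where \<phi>: "\<And>i. \<phi> i \<in> Q.mats i (frank P i) (shift P i)"
    and \<phi>_chain: "\<And>i. mat_mult (frank Q (Suc i)) (diff_mat Q i) (\<phi> (Suc i)) =
        mat_mult (frank P i) (\<phi> i) (diff_mat P i)"
    and \<phi>_aug: "\<And>m. m < frank P 0 \<Longrightarrow> (\<Sum>l<frank Q 0. residue_smul (\<phi> 0 l m) (e' l)) = e m"
    using comparison_map[OF assms] by blast
  obtain \<psi> where \<psi>: "\<And>i. \<psi> i \<in> P.mats i (frank Q i) (shift Q i)"
    and \<psi>_chain: "\<And>i. mat_mult (frank P (Suc i)) (diff_mat P i) (\<psi> (Suc i)) =
        mat_mult (frank Q i) (\<psi> i) (diff_mat Q i)"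
    and \<psi>_aug: "\<And>m. m < frank Q 0 \<Longrightarrow> (\<Sum>l<frank P 0. residue_smul (\<psi> 0 l m) (e l)) = e' m"
    using comparison_map[OF assms(2,1)] by blast
  \<comment> \<open>Both comparison maps respect the augmentations, so their composite minus the
    identity induces 0 on K and is null-homotopic.\<close>
  define f where "f i = mat_diff (mat_mult (frank Q i) (\<psi> i) (\<phi> i)) (id_mat (frank P i))" for i
  have f: "f i \<in> P.mats i (frank P i) (shift P i)" for i
    unfolding f_def by (rule hom_mats_diff[OF hom_mats_mult[OF \<psi> \<phi>] id_mat_in_hom_mats])
  have f_chain: "mat_mult (frank P (Suc i)) (diff_mat P i) (f (Suc i)) = mat_mult (frank P i) (f i) (diff_mat P i)" for i
  proof -
    have "mat_mult (frank P (Suc i)) (diff_mat P i) (mat_mult (frank Q (Suc i)) (\<psi> (Suc i)) (\<phi> (Suc i))) =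
        mat_mult (frank Q (Suc i)) (mat_mult (frank Q i) (\<psi> i) (diff_mat Q i)) (\<phi> (Suc i))"
      unfolding \<psi>_chain[symmetric] by (rule mat_mult_assoc[symmetric])
    also have "\<dots> = mat_mult (frank Q i) (\<psi> i) (mat_mult (frank P i) (\<phi> i) (diff_mat P i))"
      unfolding \<phi>_chain[symmetric] by (rule mat_mult_assoc)
    also have "\<dots> = mat_mult (frank P i) (mat_mult (frank Q i) (\<psi> i) (\<phi> i)) (diff_mat P i)"
      by (rule mat_mult_assoc[symmetric])
    finally show ?thesis
      unfolding f_def mat_mult_diff_right mat_mult_diff_left mat_mult_id_right[OF P.diff_mat_hom]
        mat_mult_id_left[OF P.diff_mat_hom] by (rule arg_cong)
  qed
  have f_aug: "P.cycle_mat 0 (f 0)"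
    unfolding P.cycle_mat_0
  proof
    fix m
    have "(\<Sum>l<frank P 0. residue_smul (f 0 l m) (e l)) =
        (\<Sum>l<frank P 0. residue_smul (mat_mult (frank Q 0) (\<psi> 0) (\<phi> 0) l m) (e l)) -
        (\<Sum>l<frank P 0. residue_smul (id_mat (frank P 0) l m :: ('n, 'k) mpoly) (e l))"
      by (simp add: f_def mat_diff_def residue_smul_def lookup_minus left_diff_distrib sum_subtractf)
    also have "(\<Sum>l<frank P 0. residue_smul (mat_mult (frank Q 0) (\<psi> 0) (\<phi> 0) l m) (e l)) =
        (\<Sum>j<frank Q 0. (\<Sum>l<frank P 0. residue_smul (\<psi> 0 l j) (e l)) * Poly_Mapping.lookup (\<phi> 0 j m) 0)"
      unfolding mat_mult_def residue_smul_def lookup_sum_poly lookup_mult_0 sum_distrib_right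
      by (subst sum.swap) (simp add: ac_simps)
    also have "\<dots> = (\<Sum>j<frank Q 0. residue_smul (\<phi> 0 j m) (e' j))"
      by (intro sum.cong) (simp_all add: \<psi>_aug residue_smul_def[of "\<phi> 0 _ m"])
    also have "\<dots> = (if m < frank P 0 then e m else 0)"
      using hom_mats_eq_0[OF \<phi>[of 0], of _ m]
      by (cases "m < frank P 0") (simp_all add: \<phi>_aug residue_smul_def[of 0])
    also have "(\<Sum>l<frank P 0. residue_smul (id_mat (frank P 0) l m :: ('n, 'k) mpoly) (e l)) =
        (\<Sum>l<frank P 0. if l = m then e m else 0)"
      by (intro sum.cong) (auto simp: id_mat_def residue_smul_def)
    finally show "(\<Sum>l<frank P 0. residue_smul (f 0 l m) (e l)) = 0"
      by auto
  qed
  obtain h where h: "\<And>i. h i \<in> P.mats (Suc i) (frank P i) (shift P i)"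
    and h_0: "mat_mult (frank P 1) (diff_mat P 0) (h 0) = f 0"
    and h_Suc: "\<And>i. mat_mult (frank P (Suc (Suc i))) (diff_mat P (Suc i)) (h (Suc i)) =
      mat_diff (f (Suc i)) (mat_mult (frank P i) (h i) (diff_mat P i))"
    using P.null_homotopy[OF f f_chain f_aug] by blast
  define F where "F = apply_mat (frank P i) (\<phi> i)"
  have F_cycle: "F z \<in> cycles Q i d" if z: "z \<in> cycles P i d" for z d
  proof -
    have "F z \<in> tensor_chains_gr H Q i d"
      unfolding F_def using z by (intro apply_mat_chains[OF \<phi>]) (simp add: cycles_def)
    moreover have "tensor_diff smul Q i (F z) = (\<lambda>l. 0)"
    proof (cases i)
      case (Suc j)
      then have "apply_mat (frank P (Suc j)) (diff_mat P j) z = 0"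
        using z by (simp add: cycles_def tensor_diff_eq zero_fun_def del: tensor_diff.simps)
      then have "apply_mat (frank P (Suc j)) (mat_mult (frank P j) (\<phi> j) (diff_mat P j)) z = 0"
        by (simp add: apply_mat_mult apply_mat_0)
      then show ?thesis
        unfolding \<phi>_chain[symmetric] by (simp add: Suc F_def tensor_diff_eq apply_mat_mult zero_fun_def del: tensor_diff.simps)
    qed simp
    ultimately show ?thesis
      by (simp add: cycles_def)
  qed
  \<comment> \<open>If \<phi> z = d w, then z = d (\<psi> w) - f z. On a cycle the homotopy reduces
    to f z = d (h z), hence z is the boundary of \<psi> w - h z.\<close>
  have "z \<in> boundaries P i d" if z: "z \<in> cycles P i d" and Fz: "F z \<in> boundaries Q i d" for z d
  proof -
    obtain w where w: "w \<in> tensor_chains_gr H Q (Suc i) d"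
      "F z = apply_mat (frank Q (Suc i)) (diff_mat Q i) w"
      using Fz by (auto simp: boundaries_def tensor_diff_eq simp del: tensor_diff.simps)
    define w' where "w' = apply_mat (frank Q (Suc i)) (\<psi> (Suc i)) w"
    have z_chain: "z \<in> tensor_chains_gr H P i d" "z \<in> tensor_chains P i"
      using z by (auto simp: cycles_def tensor_chains_gr_def)
    have w': "w' \<in> tensor_chains_gr H P (Suc i) d"
      unfolding w'_def by (rule apply_mat_chains[OF \<psi> w(1)])
    have hz: "apply_mat (frank P i) (h i) z \<in> tensor_chains_gr H P (Suc i) d"
      by (rule apply_mat_chains[OF h z_chain(1)])
    have "apply_mat (frank P (Suc i)) (diff_mat P i) w' =
        apply_mat (frank Q (Suc i)) (mat_mult (frank Q i) (\<psi> i) (diff_mat Q i)) w"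
      unfolding w'_def \<psi>_chain[symmetric] by (rule apply_mat_mult[symmetric])
    also have "\<dots> = apply_mat (frank Q i) (\<psi> i) (F z)"
      by (simp only: apply_mat_mult w(2))
    also have "\<dots> = apply_mat (frank P i) (f i) z + z"
      unfolding f_def F_def apply_mat_diff_left apply_id_mat[OF z_chain(2)] by (simp add: apply_mat_mult)
    also have "apply_mat (frank P i) (f i) z =
        apply_mat (frank P (Suc i)) (diff_mat P i) (apply_mat (frank P i) (h i) z)"
    proof (cases i)
      case 0
      then show ?thesis
        using h_0 by (simp add: apply_mat_mult[symmetric])
    next
      case (Suc j)
      then have "apply_mat (frank P (Suc j)) (diff_mat P j) z = 0"
        using z by (simp add: cycles_def tensor_diff_eq zero_fun_def del: tensor_diff.simps)
      then show ?thesis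
        unfolding Suc apply_mat_mult[symmetric] h_Suc apply_mat_diff_left
        by (simp add: apply_mat_mult apply_mat_0)
    qed
    finally have "z = apply_mat (frank P (Suc i)) (diff_mat P i) (w' - apply_mat (frank P i) (h i) z)"
      by (simp only: apply_mat_diff add_diff_cancel_left')
    moreover have "w' - apply_mat (frank P i) (h i) z \<in> tensor_chains_gr H P (Suc i) d"
      using w' hz by (rule tuples.subspace_diff[OF subspace_tensor_chains_gr])
    ultimately show ?thesis
      by (auto simp: boundaries_def tensor_diff_eq simp del: tensor_diff.simps)
  qed
  with F_cycle show ?thesis
    unfolding F_def by blast
qed

end

section \<open>The Koszul resolution\<close>

text \<open>The support condition of \<open>kchains\<close> without any grading, so that it applies
  to chains over S and to sums of several multidegrees.\<close>

definition ksupp :: "'n set \<Rightarrow> nat \<Rightarrow> ('n set \<Rightarrow> 'm::zero) \<Rightarrow> bool"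
  where "ksupp A q u \<longleftrightarrow> (\<forall>F. \<not> (F \<subseteq> A \<and> card F = q) \<longrightarrow> u F = 0)"

lemma ksuppD: "ksupp A q u \<Longrightarrow> \<not> (F \<subseteq> A \<and> card F = q) \<Longrightarrow> u F = 0"
  by (simp add: ksupp_def)

lemma ksupp_contract:
  fixes A :: "'n::finite set"
  assumes "ksupp (insert i A) (Suc q) u" "i \<notin> A"
  shows "ksupp A q (contract i u)"
  unfolding ksupp_def
proof (intro allI impI)
  fix F :: "'n set" assume F: "\<not> (F \<subseteq> A \<and> card F = q)"
  show "contract i u F = 0"
  proof (cases "i \<in> F")
    case False
    then have "\<not> (insert i F \<subseteq> insert i A \<and> card (insert i F) = Suc q)"
      using F by auto
    then show ?thesis
      using ksuppD[OF assms(1), of "insert i F"] by (simp add: contract_def)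
  qed (simp add: contract_def)
qed

lemma ksupp_contract':
  fixes A :: "'n::finite set"
  assumes "ksupp A (Suc q) u"
  shows "ksupp A q (contract i u)"
proof -
  have "ksupp (insert i (A - {i})) (Suc q) u"
    using assms unfolding ksupp_def by blast
  then have "ksupp (A - {i}) q (contract i u)"
    by (rule ksupp_contract) simp
  then show ?thesis
    unfolding ksupp_def by blast
qed

lemma ksupp_wedge:
  fixes A :: "'n::finite set"
  assumes "ksupp A q u" "i \<notin> A"
  shows "ksupp (insert i A) (Suc q) (wedge i u)"
  unfolding ksupp_def
proof (intro allI impI)
  fix F :: "'n set" assume F: "\<not> (F \<subseteq> insert i A \<and> card F = Suc q)"
  show "wedge i u F = 0"
  proof (cases "i \<in> F")
    case True
    then have "card F = Suc (card (F - {i}))"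
      using card_Suc_Diff1[of F i] by simp
    with F have "\<not> (F - {i} \<subseteq> A \<and> card (F - {i}) = q)"
      by auto
    then show ?thesis
      using ksuppD[OF assms(1), of "F - {i}"] by (simp add: wedge_def)
  qed (simp add: wedge_def)
qed

context poly_module
begin

lemma ksupp_kd: "ksupp A (Suc q) u \<Longrightarrow> ksupp A q (kd u)"
  using ksupp_contract'[of A q u] unfolding ksupp_def koszul_diff_def by (auto intro!: sum.neutral)

lemma kd_empty: "kd u {} = (\<Sum>i\<in>UNIV. smul (var i) (u {i}))"
  by (simp add: koszul_diff_def contract_def crosses_def)

end

section \<open>Exactness of the Koszul complex over the polynomial ring itself\<close>

interpretation polys: poly_module "(*) :: ('n::finite, 'k::field) mpoly \<Rightarrow> _"
  by standard (simp_all add: algebra_simps)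

lemma mult_single_1: "Poly_Mapping.single s 1 * Poly_Mapping.single t c = Poly_Mapping.single (s + t) c"
  for c :: "'k::field"
  by (simp add: mult_single)

lemma poly_mapping_sum_single: "(\<Sum>t\<in>Poly_Mapping.keys f. Poly_Mapping.single t (Poly_Mapping.lookup f t)) = f"
  for f :: "('n, 'k::field) mpoly"
  by (rule poly_mapping_eqI) (simp add: lookup_sum_poly lookup_single when_def in_keys_iff sum.delta)

lemma keys_var_mult:
  fixes f :: "('n, 'k::field) mpoly"
  shows "Poly_Mapping.keys (var i * f) = (\<lambda>t. Poly_Mapping.single i 1 + t) ` Poly_Mapping.keys f"
proof -
  have "Poly_Mapping.lookup (var i * f) (Poly_Mapping.single i 1 + t) = Poly_Mapping.lookup f t" for t
  proof -
    have "Poly_Mapping.lookup (Poly_Mapping.single s 1) l * x = (x when l = s)" for l s :: "'n \<Rightarrow>\<^sub>0 nat" and x :: 'k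
      by (simp add: lookup_single when_def)
    then show ?thesis
      by (simp add: lookup_mult var_def)
  qed
  then show ?thesis
    using keys_mult[of "var i" f] by (force simp: var_def in_keys_iff)
qed

text \<open>\<open>meets A f\<close> means that \<open>f\<close> lies in the ideal of the variables in \<open>A\<close>.\<close>

definition meets :: "'n set \<Rightarrow> ('n, 'k::field) mpoly \<Rightarrow> bool"
  where "meets A f \<longleftrightarrow> (\<forall>t\<in>Poly_Mapping.keys f. \<exists>j\<in>A. Poly_Mapping.lookup t j \<noteq> 0)"

lemma meets_kd:
  assumes "ksupp A (Suc 0) u"
  shows "meets A (koszul_diff (*) u {})"
  unfolding meets_def
proof
  fix t assume "t \<in> Poly_Mapping.keys (koszul_diff (*) u {})"
  then have "(\<Sum>i\<in>UNIV. Poly_Mapping.lookup (var i * u {i}) t) \<noteq> 0"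
    by (simp add: polys.kd_empty in_keys_iff lookup_sum_poly)
  then obtain i where i: "Poly_Mapping.lookup (var i * u {i}) t \<noteq> 0"
    by (meson sum.not_neutral_contains_not_neutral)
  then have "t \<in> Poly_Mapping.keys (var i * u {i})"
    by (simp add: in_keys_iff)
  then have "Poly_Mapping.lookup t i \<noteq> 0"
    by (auto simp: keys_var_mult lookup_add)
  moreover have "i \<in> A"
    using i ksuppD[OF assms, of "{i}"] by (metis card_1_singleton_iff empty_subsetI insert_subset lookup_zero mult_zero_right)
  ultimately show "\<exists>j\<in>A. Poly_Mapping.lookup t j \<noteq> 0"
    by blast
qed

lemma meets_imp_kd:
  fixes f :: "('n::finite, 'k::field) mpoly"
  assumes "meets A f"
  shows "\<exists>u. ksupp A (Suc 0) u \<and> koszul_diff (*) u {} = f"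
proof -
  have "\<exists>u. ksupp A (Suc 0) u \<and> koszul_diff (*) u {} = (Poly_Mapping.single t (Poly_Mapping.lookup f t))"
    if t: "t \<in> Poly_Mapping.keys f" for t
  proof -
    obtain j where j: "j \<in> A" "Poly_Mapping.lookup t j \<noteq> 0"
      using assms t by (auto simp: meets_def)
    \<comment> \<open>The term at t divided by x_j; as the coefficient of e_j it has the whole term
      as its boundary.\<close>
    define g where "g = Poly_Mapping.single (t - Poly_Mapping.single j 1) (Poly_Mapping.lookup f t)"
    define u where "u F = (if F = {j} then g else 0)" for F
    have "Poly_Mapping.single j 1 + (t - Poly_Mapping.single j 1) = t"
      using j by (intro poly_mapping_eqI) (auto simp: lookup_add lookup_minus lookup_single when_def)
    then have "var j * g = Poly_Mapping.single t (Poly_Mapping.lookup f t)"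
      by (simp only: g_def var_def mult_single_1)
    moreover have "koszul_diff (*) u {} = (\<Sum>i\<in>UNIV. if i = j then var j * g else 0)"
      unfolding polys.kd_empty by (intro sum.cong) (auto simp: u_def)
    ultimately show ?thesis
      using j by (intro exI[of _ u]) (auto simp: u_def ksupp_def)
  qed
  then obtain u where u: "\<And>t. t \<in> Poly_Mapping.keys f \<Longrightarrow> ksupp A (Suc 0) (u t)"
    "\<And>t. t \<in> Poly_Mapping.keys f \<Longrightarrow> koszul_diff (*) (u t) {} = Poly_Mapping.single t (Poly_Mapping.lookup f t)"
    by metis
  define w where "w = (\<lambda>F. \<Sum>t\<in>Poly_Mapping.keys f. u t F)"
  have "ksupp A (Suc 0) w"
    using u(1) by (auto simp: w_def ksupp_def intro!: sum.neutral)
  moreover have "koszul_diff (*) w {} = f"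
    unfolding w_def polys.kd_sum using u(2) by (simp add: poly_mapping_sum_single)
  ultimately show ?thesis
    by blast
qed

text \<open>Induction on A: for a new variable i write u = u0 + e_i wedge u1. The coefficient u1 is
  a boundary d w1, and adding d (e_i wedge w1) to u gives u0 + x_i w1, a cycle without e_i. Only q =
  0 needs an argument about polynomials.\<close>

lemma koszul_acyclic:
  fixes u :: "'n::finite set \<Rightarrow> ('n, 'k::field) mpoly"
  assumes "ksupp A (Suc q) u" "koszul_diff (*) u = (\<lambda>F. 0)"
  shows "\<exists>w. ksupp A (Suc (Suc q)) w \<and> koszul_diff (*) w = u"
proof -
  have "finite A"
    by simp
  then show ?thesis
    using assms
  proof (induction A arbitrary: q u)
    case empty
    then have "u F = 0" for F
      by (intro ksuppD[of "{}" "Suc q" u]) auto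
    then show ?case
      by (intro exI[of _ "\<lambda>F. 0"]) (auto simp: ksupp_def fun_eq_iff)
  next
    case (insert i A)
    define u1 where "u1 = contract i u"
    define u0 where "u0 = contract i (wedge i u)"
    have u1: "ksupp A q u1"
      unfolding u1_def using insert by (intro ksupp_contract)
    have u0_eq: "u0 F = (if i \<in> F then 0 else u F)" for F
      unfolding u0_def by (auto simp: contract_wedge wedge_def contract_def insert_absorb)
    have u0: "ksupp A (Suc q) u0"
      using insert.prems(1) unfolding ksupp_def u0_eq by auto
    have "contract i (koszul_diff (*) u) F = 0" for F
      unfolding insert.prems(2) by simp
    then have kd_u1: "koszul_diff (*) u1 = (\<lambda>F. 0)"
      by (simp add: u1_def fun_eq_iff polys.contract_kd)
    have u_eq: "(\<lambda>F. u0 F + wedge i u1 F) = u"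
      unfolding u0_def u1_def by (simp add: contract_wedge)
    have "koszul_diff (*) (\<lambda>F. u0 F + wedge i u1 F) F = 0" for F
      unfolding u_eq insert.prems(2) ..
    then have u0_u1: "koszul_diff (*) u0 F + var i * u1 F = 0" for F
      unfolding polys.kd_add polys.kd_wedge kd_u1 by simp
    have "\<exists>w1. ksupp A (Suc q) w1 \<and> koszul_diff (*) w1 = u1"
    proof (cases q)
      case 0
      have "meets A (koszul_diff (*) u0 {})"
        using u0 0 by (intro meets_kd) simp
      moreover have "koszul_diff (*) u0 {} = - (var i * u1 {})"
        using u0_u1 by (simp add: add_eq_0_iff2)
      ultimately have meets: "meets A (- (var i * u1 {}))"
        by simp
      \<comment> \<open>x_i is regular modulo the ideal of A: a variable of A that divides x_i t is
        different from x_i, so it divides t.\<close>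
      have "meets A (u1 {})"
        unfolding meets_def
      proof
        fix t assume "t \<in> Poly_Mapping.keys (u1 {})"
        then have "Poly_Mapping.single i 1 + t \<in> Poly_Mapping.keys (- (var i * u1 {}))"
          by (simp add: keys_var_mult in_keys_iff[of _ "- _"])
        then obtain j where "j \<in> A" "Poly_Mapping.lookup (Poly_Mapping.single i 1 + t) j \<noteq> 0"
          using meets unfolding meets_def by blast
        then show "\<exists>j\<in>A. Poly_Mapping.lookup t j \<noteq> 0"
          using insert.hyps by (intro bexI[of _ j]) (auto simp: lookup_add lookup_single when_def split: if_splits)
      qed
      then obtain w1 where w1: "ksupp A (Suc 0) w1" "koszul_diff (*) w1 {} = u1 {}"
        using meets_imp_kd by blast
      have "koszul_diff (*) w1 F = u1 F" for F
      proof (cases "F = {}")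
        case False
        then have "card F \<noteq> 0"
          by simp
        then show ?thesis
          using ksuppD[OF polys.ksupp_kd[OF w1(1)], of F] ksuppD[OF u1, of F] 0 by auto
      qed (simp add: w1)
      then show ?thesis
        using w1 0 by auto
    next
      case (Suc q')
      then show ?thesis
        using insert.IH u1 kd_u1 by blast
    qed
    then obtain w1 where w1: "ksupp A (Suc q) w1" "koszul_diff (*) w1 = u1"
      by blast
    define u' where "u' F = u0 F + var i * w1 F" for F
    have u'_eq: "u' F = u F + koszul_diff (*) (wedge i w1) F" for F
      unfolding u'_def polys.kd_wedge w1(2) by (simp add: u_eq[symmetric] fun_eq_iff)
    have "ksupp A (Suc q) u'"
      using u0 w1(1) by (auto simp: ksupp_def u'_def)
    moreover have "koszul_diff (*) u' = (\<lambda>F. 0)"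
      unfolding u'_eq[abs_def] using insert.prems(2) by (simp add: polys.kd_add fun_eq_iff)
    ultimately obtain w2 where w2: "ksupp A (Suc (Suc q)) w2" "koszul_diff (*) w2 = u'"
      using insert.IH by blast
    have "ksupp (insert i A) (Suc (Suc q)) (\<lambda>F. w2 F - wedge i w1 F)"
      using w2(1) ksupp_wedge[OF w1(1), of i] insert.hyps by (auto simp: ksupp_def)
    moreover have "koszul_diff (*) (\<lambda>F. w2 F - wedge i w1 F) F = u F" for F
      by (simp add: polys.kd_diff w2(2) u'_eq)
    ultimately show ?case
      by blast
  qed
qed

section \<open>The Koszul complex in the numbered bases required by
  \<open>free_complex\<close>\<close>

definition faces :: "nat \<Rightarrow> 'n set set"
  where "faces q = {F. card F = q}"

definition face :: "nat \<Rightarrow> nat \<Rightarrow> 'n::finite set"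
  where "face q = (SOME f. bij_betw f {..<card (faces q :: 'n set set)} (faces q))"

definition face_index :: "nat \<Rightarrow> 'n::finite set \<Rightarrow> nat"
  where "face_index q = inv_into {..<card (faces q :: 'n set set)} (face q)"

text \<open>At most one i contributes to a matrix entry, the one that extends the smaller face to
  the larger; the sum avoids having to select it. The shift q is the degree of e_F for a set F with
  q elements.\<close>

definition koszul_complex :: "('n::finite, 'k::field) free_complex"
  where "koszul_complex = \<lparr>
    frank = (\<lambda>q. card (faces q :: 'n set set)),
    shift = (\<lambda>q l. int q),
    dmat = (\<lambda>q l m. \<Sum>i\<in>UNIV.
      if i \<notin> face q l \<and> insert i (face q l) = face (Suc q) m then flip (crosses i (face q l)) (var i) else 0)\<rparr>"

lemma bij_face: "bij_betw (face q) {..<card (faces q :: 'n set set)} (faces q :: 'n::finite set set)"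
proof -
  have "\<exists>f. bij_betw f {..<card (faces q :: 'n set set)} (faces q :: 'n::finite set set)"
    using ex_bij_betw_nat_finite[of "faces q :: 'n set set"] by (simp add: lessThan_atLeast0)
  then show ?thesis
    unfolding face_def by (rule someI_ex)
qed

lemma frank_koszul: "frank (koszul_complex :: ('n::finite, 'k::field) free_complex) q = card (faces q :: 'n set set)"
  by (simp add: koszul_complex_def)

lemma card_face: "l < card (faces q :: 'n set set) \<Longrightarrow> card (face q l :: 'n::finite set) = q"
  using bij_face[of q] by (auto simp: bij_betw_def faces_def)

lemma face_face_index: "card F = q \<Longrightarrow> face q (face_index q F) = (F :: 'n::finite set)"
  unfolding face_index_def by (rule bij_betw_inv_into_right[OF bij_face]) (simp add: faces_def)

lemma face_index_less:
  fixes F :: "'n::finite set"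
  shows "card F = q \<Longrightarrow> face_index q F < card (faces q :: 'n set set)"
  using bij_betw_apply[OF bij_betw_inv_into[OF bij_face[of q]], of F] by (simp add: face_index_def faces_def)

lemma face_index_face: "l < card (faces q :: 'n set set) \<Longrightarrow> face_index q (face q l :: 'n::finite set) = l"
  unfolding face_index_def using bij_face[of q] by (auto intro: bij_betw_inv_into_left)

definition tuple :: "nat \<Rightarrow> ('n::finite set \<Rightarrow> 'm::zero) \<Rightarrow> nat \<Rightarrow> 'm"
  where "tuple q u = (\<lambda>l. if l < card (faces q :: 'n set set) then u (face q l) else 0)"

definition untuple :: "nat \<Rightarrow> (nat \<Rightarrow> 'm::zero) \<Rightarrow> 'n::finite set \<Rightarrow> 'm"
  where "untuple q v = (\<lambda>F. if card F = q then v (face_index q F) else 0)"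

lemma untuple_tuple: "ksupp UNIV q u \<Longrightarrow> untuple q (tuple q u) = u"
  by (auto simp: fun_eq_iff untuple_def tuple_def face_index_less face_face_index ksupp_def)

lemma tuple_untuple:
  "v \<in> tensor_chains (koszul_complex :: ('n, 'k::field) free_complex) q \<Longrightarrow>
   tuple q (untuple q v :: 'n::finite set \<Rightarrow> _) = v"
  by (auto simp: fun_eq_iff untuple_def tuple_def face_index_face card_face tensor_chains_def frank_koszul)

lemma ksupp_untuple: "ksupp UNIV q (untuple q v)"
  by (simp add: ksupp_def untuple_def)

lemma tuple_in_chains: "tuple q (u :: 'n::finite set \<Rightarrow> _) \<in> tensor_chains (koszul_complex :: ('n, 'k::field) free_complex) q"
  by (simp add: tuple_def tensor_chains_def frank_koszul)

context poly_module
begin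

text \<open>Holds over every module, so it serves both for exactness, with S as the module, and for
  computing Tor with M.\<close>

lemma tensor_diff_koszul:
  "tensor_diff smul koszul_complex (Suc q) v = tuple q (kd (untuple (Suc q) v))"
proof
  fix l
  let ?r = "\<lambda>q. card (faces q :: 'n set set)"
  show "tensor_diff smul koszul_complex (Suc q) v l = tuple q (kd (untuple (Suc q) v)) l"
  proof (cases "l < ?r q")
    case l: True
    define F where "F = (face q l :: 'n set)"
    have F: "card F = q"
      using l by (simp add: F_def card_face)
    have "(\<Sum>m<?r (Suc q). if i \<notin> F \<and> insert i F = face (Suc q) m then flip (crosses i F) (smul (var i) (v m)) else 0) =
        smul (var i) (contract i (untuple (Suc q) v) F)" for i
    proof (cases "i \<in> F")
      case True
      then show ?thesis
        by (simp add: contract_def)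
    next
      case False
      then have c: "card (insert i F) = Suc q"
        using F by simp
      have "insert i F = face (Suc q) m \<longleftrightarrow> m = face_index (Suc q) (insert i F)" if "m < ?r (Suc q)" for m
        using face_index_face[OF that] face_face_index[OF c] by metis
      then have "(\<Sum>m<?r (Suc q). if i \<notin> F \<and> insert i F = face (Suc q) m then flip (crosses i F) (smul (var i) (v m)) else 0) =
          (\<Sum>m<?r (Suc q). if m = face_index (Suc q) (insert i F) then flip (crosses i F) (smul (var i) (v m)) else 0)"
        using False by (intro sum.cong) auto
      also have "\<dots> = flip (crosses i F) (smul (var i) (v (face_index (Suc q) (insert i F))))"
        using face_index_less[OF c] by simp
      finally show ?thesis
        using False c by (simp add: contract_def untuple_def scale_flip)
    qed
    then have "kd (untuple (Suc q) v) F = (\<Sum>i\<in>UNIV. \<Sum>m<?r (Suc q).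
        if i \<notin> F \<and> insert i F = face (Suc q) m then flip (crosses i F) (smul (var i) (v m)) else 0)"
      by (simp add: koszul_diff_def)
    also have "\<dots> = (\<Sum>m<?r (Suc q). \<Sum>i\<in>UNIV.
        if i \<notin> F \<and> insert i F = face (Suc q) m then flip (crosses i F) (smul (var i) (v m)) else 0)"
      by (rule sum.swap)
    also have "\<dots> = (\<Sum>m<?r (Suc q). smul (\<Sum>i\<in>UNIV.
        if i \<notin> F \<and> insert i F = face (Suc q) m then flip (crosses i F) (var i) else 0) (v m))"
      unfolding scale_sum_left by (intro sum.cong) (auto simp: flip_def)
    finally show ?thesis
      using l unfolding F_def by (simp add: tuple_def koszul_complex_def)
  next
    case False
    then show ?thesis
      by (simp add: tuple_def frank_koszul)
  qed
qed

lemma untuple_tensor_diff_koszul: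
  "untuple q (tensor_diff smul koszul_complex (Suc q) v) = kd (untuple (Suc q) v)"
  unfolding tensor_diff_koszul by (rule untuple_tuple) (rule ksupp_kd[OF ksupp_untuple])

end

lemma var_in_poly_z_part: "var i \<in> poly_z_part 1"
  by (simp add: poly_z_part_def var_def)

lemma koszul_resolution:
  "residue_resolution (koszul_complex :: ('n::finite, 'k::field) free_complex) (\<lambda>l. 1)"
proof
  let ?K = "koszul_complex :: ('n, 'k) free_complex"
  have faces_0: "faces 0 = {{} :: 'n set}"
    by (auto simp: faces_def)
  have rank_0: "frank ?K 0 = Suc 0"
    by (simp add: frank_koszul faces_0)
  show "dmat ?K i l m \<in> poly_z_part (shift ?K (Suc i) m - shift ?K i l)" for i l m
    unfolding koszul_complex_def by (auto intro!: poly_z_part_sum simp: flip_def var_in_poly_z_part poly_z_part_minus)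
  show "(1 :: 'k) \<in> residue_grading (shift ?K 0 l)" for l
    by (simp add: koszul_complex_def residue_grading_def)
  show "\<exists>v\<in>tensor_chains ?K 0. y = (\<Sum>l<frank ?K 0. residue_smul (v l :: ('n, 'k) mpoly) 1)" for y
    by (rule bexI[of _ "\<lambda>l. if l = 0 then const_poly y else 0"])
      (auto simp: rank_0 tensor_chains_def residue_smul_def const_poly_def)
  have image: "tensor_diff (*) ?K (Suc q) ` tensor_chains ?K (Suc q) =
      tuple q ` koszul_diff (*) ` {u :: 'n set \<Rightarrow> ('n, 'k) mpoly. ksupp UNIV (Suc q) u}" for q
  proof (intro equalityI subsetI)
    fix x assume "x \<in> tensor_diff (*) ?K (Suc q) ` tensor_chains ?K (Suc q)"
    then show "x \<in> tuple q ` koszul_diff (*) ` {u :: 'n set \<Rightarrow> ('n, 'k) mpoly. ksupp UNIV (Suc q) u}"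
      unfolding polys.tensor_diff_koszul using ksupp_untuple by blast
  next
    fix x assume "x \<in> tuple q ` koszul_diff (*) ` {u :: 'n set \<Rightarrow> ('n, 'k) mpoly. ksupp UNIV (Suc q) u}"
    then obtain u :: "'n set \<Rightarrow> ('n, 'k) mpoly" where u: "ksupp UNIV (Suc q) u" "x = tuple q (koszul_diff (*) u)"
      by blast
    have "x = tensor_diff (*) ?K (Suc q) (tuple (Suc q) u)"
      unfolding polys.tensor_diff_koszul u(2) untuple_tuple[OF u(1)] ..
    then show "x \<in> tensor_diff (*) ?K (Suc q) ` tensor_chains ?K (Suc q)"
      using tuple_in_chains by blast
  qed
  show "{v \<in> tensor_chains ?K 0. (\<Sum>l<frank ?K 0. residue_smul (v l :: ('n, 'k) mpoly) 1) = 0} =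
      tensor_diff (*) ?K 1 ` tensor_chains ?K 1"
    unfolding One_nat_def image
  proof (intro equalityI subsetI)
    fix v assume "v \<in> {v \<in> tensor_chains ?K 0. (\<Sum>l<frank ?K 0. residue_smul (v l :: ('n, 'k) mpoly) 1) = 0}"
    then have v: "v \<in> tensor_chains ?K 0" "Poly_Mapping.lookup (v 0) 0 = 0"
      by (auto simp: rank_0 residue_smul_def)
    define f where "f = untuple 0 v ({} :: 'n set)"
    have "f = v 0"
      using face_index_less[of "{} :: 'n set" 0, OF card.empty] by (simp add: f_def untuple_def faces_0)
    \<comment> \<open>Every monomial other than 1 contains a variable, so a polynomial without
      constant term lies in the ideal of all variables.\<close>
    moreover have "\<exists>j. Poly_Mapping.lookup t j \<noteq> 0" if "t \<noteq> 0" for t :: "'n \<Rightarrow>\<^sub>0 nat"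
      using that by (auto simp: poly_mapping_eq_iff fun_eq_iff)
    ultimately have "meets UNIV f"
      using v(2) unfolding meets_def by (metis UNIV_I in_keys_iff)
    then obtain u where u: "ksupp UNIV (Suc 0) u" "koszul_diff (*) u {} = f"
      using meets_imp_kd by blast
    have "koszul_diff (*) u F = untuple 0 v F" for F
    proof (cases "F = {}")
      case False
      then show ?thesis
        using ksuppD[OF polys.ksupp_kd[OF u(1)], of F] ksuppD[OF ksupp_untuple, of F 0 v] by simp
    qed (simp add: u f_def)
    then have "koszul_diff (*) u = (untuple 0 v :: 'n set \<Rightarrow> _)" ..
    then have "v = tuple 0 (koszul_diff (*) u)"
      using tuple_untuple[OF v(1)] by simp
    then show "v \<in> tuple 0 ` koszul_diff (*) ` {u :: 'n set \<Rightarrow> ('n, 'k) mpoly. ksupp UNIV (Suc 0) u}"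
      using u(1) by blast
  next
    fix v assume "v \<in> tuple 0 ` koszul_diff (*) ` {u :: 'n set \<Rightarrow> ('n, 'k) mpoly. ksupp UNIV (Suc 0) u}"
    then obtain u :: "'n set \<Rightarrow> ('n, 'k) mpoly" where u: "ksupp UNIV (Suc 0) u" "v = tuple 0 (koszul_diff (*) u)"
      by blast
    have "face 0 0 = ({} :: 'n set)"
      using card_face[of 0 0, where 'n = 'n] by (simp add: faces_0)
    then have "v 0 = koszul_diff (*) u {}"
      by (simp add: u(2) tuple_def faces_0)
    moreover have "Poly_Mapping.lookup (koszul_diff (*) u {}) 0 = 0"
      using meets_kd[OF u(1)] unfolding meets_def by (metis in_keys_iff lookup_zero)
    ultimately show "v \<in> {v \<in> tensor_chains ?K 0. (\<Sum>l<frank ?K 0. residue_smul (v l :: ('n, 'k) mpoly) 1) = 0}"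
      using tuple_in_chains u(2) by (auto simp: rank_0 residue_smul_def)
  qed
  show "{v \<in> tensor_chains ?K (Suc i). tensor_diff (*) ?K (Suc i) v = (\<lambda>l. 0)} =
      tensor_diff (*) ?K (Suc (Suc i)) ` tensor_chains ?K (Suc (Suc i))" for i
    unfolding image
  proof (intro equalityI subsetI)
    fix v assume "v \<in> {v \<in> tensor_chains ?K (Suc i). tensor_diff (*) ?K (Suc i) v = (\<lambda>l. 0)}"
    then have v: "v \<in> tensor_chains ?K (Suc i)" "tensor_diff (*) ?K (Suc i) v = (\<lambda>l. 0)"
      by blast+
    have "koszul_diff (*) (untuple (Suc i) v) = (\<lambda>F :: 'n set. 0)"
      unfolding polys.untuple_tensor_diff_koszul[symmetric] v(2) by (simp add: untuple_def)
    then obtain w :: "'n set \<Rightarrow> ('n, 'k) mpoly" where "ksupp UNIV (Suc (Suc i)) w" "koszul_diff (*) w = untuple (Suc i) v"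
      using koszul_acyclic[OF ksupp_untuple] by blast
    then show "v \<in> tuple (Suc i) ` koszul_diff (*) ` {u :: 'n set \<Rightarrow> ('n, 'k) mpoly. ksupp UNIV (Suc (Suc i)) u}"
      using tuple_untuple[OF v(1)] by (metis (mono_tags, lifting) image_eqI mem_Collect_eq)
  next
    fix v assume "v \<in> tuple (Suc i) ` koszul_diff (*) ` {u :: 'n set \<Rightarrow> ('n, 'k) mpoly. ksupp UNIV (Suc (Suc i)) u}"
    then obtain u :: "'n set \<Rightarrow> ('n, 'k) mpoly" where u: "ksupp UNIV (Suc (Suc i)) u" "v = tuple (Suc i) (koszul_diff (*) u)"
      by blast
    have untuple: "untuple (Suc i) v = koszul_diff (*) u"
      unfolding u(2) using polys.ksupp_kd[OF u(1)] by (rule untuple_tuple)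
    have "tensor_diff (*) ?K (Suc i) v = (\<lambda>l. 0)"
      unfolding polys.tensor_diff_koszul untuple by (simp add: tuple_def fun_eq_iff)
    then show "v \<in> {v \<in> tensor_chains ?K (Suc i). tensor_diff (*) ?K (Suc i) v = (\<lambda>l. 0)}"
      using tuple_in_chains u(2) by blast
  qed
qed

section \<open>Homogeneous components\<close>

context poly_module
begin

sublocale scalars: vector_space "\<lambda>c. smul (const_poly c)"
  by standard
    (simp_all add: scale_right_distrib scale_left_distrib const_poly_add const_poly_mult const_poly_1)

end

lemma single_in_poly_zn_part: "Poly_Mapping.single t c \<in> poly_zn_part (multidegree t)"
  by (auto simp: poly_zn_part_def)

context graded_module
begin

definition decomp :: "'m \<Rightarrow> (int ^ 'n) \<Rightarrow>\<^sub>0 'm"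
  where "decomp x = (THE c. (\<forall>a. Poly_Mapping.lookup c a \<in> G a) \<and>
    x = (\<Sum>a\<in>Poly_Mapping.keys c. Poly_Mapping.lookup c a))"

definition component :: "int ^ 'n \<Rightarrow> 'm \<Rightarrow> 'm"
  where "component a x = Poly_Mapping.lookup (decomp x) a"

lemma ex1_decomp: "\<exists>!c. (\<forall>a. Poly_Mapping.lookup c a \<in> G a) \<and>
    x = (\<Sum>a\<in>Poly_Mapping.keys c. Poly_Mapping.lookup c a)"
  using graded unfolding zn_graded_module_def by blast

lemma component_in_G: "component a x \<in> G a"
  and sum_component: "(\<Sum>a\<in>Poly_Mapping.keys (decomp x). component a x) = x"
  using theI'[OF ex1_decomp[of x]] unfolding decomp_def[symmetric] component_def by simp_all

text \<open>Reduces an identity between components to exhibiting a finite homogeneous decomposition,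
  given as a plain function with finite support.\<close>

lemma component_unique:
  assumes "finite A" "\<And>a. f a \<in> G a" "\<And>a. a \<notin> A \<Longrightarrow> f a = 0" "x = (\<Sum>a\<in>A. f a)"
  shows "component a x = f a"
proof -
  have fin: "finite {a. f a \<noteq> 0}"
    by (rule finite_subset[OF _ assms(1)]) (use assms(3) in blast)
  define c where "c = Abs_poly_mapping f"
  have c: "Poly_Mapping.lookup c = f"
    unfolding c_def using fin by simp
  have "Poly_Mapping.keys c \<subseteq> A"
    using assms(3) unfolding subset_iff in_keys_iff c by blast
  then have "x = (\<Sum>a\<in>Poly_Mapping.keys c. Poly_Mapping.lookup c a)"
    unfolding assms(4) c using assms(1)
    by (intro sum.mono_neutral_right) (auto simp: in_keys_iff c)
  then have "decomp x = c"
    unfolding decomp_def using assms(2) c by (intro the1_equality[OF ex1_decomp]) auto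
  then show ?thesis
    by (simp add: component_def c)
qed

lemma finite_component: "finite {a. component a x \<noteq> 0}"
  by (simp add: component_def)

lemma sum_component_superset:
  assumes "finite A" "\<And>a. component a x \<noteq> 0 \<Longrightarrow> a \<in> A"
  shows "(\<Sum>a\<in>A. component a x) = x"
proof -
  have "(\<Sum>a\<in>A. component a x) = (\<Sum>a\<in>Poly_Mapping.keys (decomp x). component a x)"
    using assms by (intro sum.mono_neutral_right) (auto simp: component_def in_keys_iff)
  then show ?thesis
    by (simp add: sum_component)
qed

lemma component_add: "component a (x + y) = component a x + component a y"
proof (rule component_unique)
  let ?A = "{a. component a x \<noteq> 0} \<union> {a. component a y \<noteq> 0}"
  show "finite ?A"
    using finite_component by simp
  show "x + y = (\<Sum>a\<in>?A. component a x + component a y)"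
    unfolding sum.distrib using finite_component by (simp add: sum_component_superset)
qed (auto intro: G_add component_in_G)

lemma component_smul:
  assumes "f \<in> poly_zn_part b"
  shows "component a (smul f x) = smul f (component (a - b) x)"
proof (rule component_unique)
  let ?A = "(\<lambda>a. b + a) ` {a. component a x \<noteq> 0}"
  show "finite ?A"
    using finite_component by simp
  show "smul f (component (a - b) x) \<in> G a" for a
    using G_smul[OF assms component_in_G[of "a - b" x]] by simp
  show "smul f (component (a - b) x) = 0" if "a \<notin> ?A" for a
  proof (rule ccontr)
    assume "smul f (component (a - b) x) \<noteq> 0"
    then have "b + (a - b) \<in> ?A"
      by (intro imageI) auto
    then show False
      using that by simp
  qed
  have "smul f x = smul f (\<Sum>a\<in>{a. component a x \<noteq> 0}. component a x)"
    using finite_component by (simp add: sum_component_superset)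
  also have "\<dots> = (\<Sum>a\<in>?A. smul f (component (a - b) x))"
    by (simp add: sum.reindex scale_sum_right)
  finally show "smul f x = (\<Sum>a\<in>?A. smul f (component (a - b) x))" .
qed

lemma component_scale: "component a (smul (const_poly c) x) = smul (const_poly c) (component a x)"
  using component_smul[OF const_poly_in_poly_zn_part] by simp

lemma component_0 [simp]: "component a 0 = 0"
  using component_add[of a 0 0] by simp

lemma component_minus: "component a (- x) = - component a x"
  using component_add[of a x "- x"] by (simp add: add_eq_0_iff)

lemma component_flip: "component a (flip b x) = flip b (component a x)"
  by (simp add: flip_def component_minus)

lemma component_sum: "component a (\<Sum>i\<in>I. f i) = (\<Sum>i\<in>I. component a (f i))"
  by (induction I rule: infinite_finite_induct) (auto simp: component_add)

lemma component_G: "x \<in> G b \<Longrightarrow> component a x = (if a = b then x else 0)"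
  by (rule component_unique[of "{b}" "\<lambda>a. if a = b then x else 0"]) auto

lemma z_grading_iff: "x \<in> z_grading G d \<longleftrightarrow> (\<forall>a. component a x \<noteq> 0 \<longrightarrow> total a = d)"
proof
  assume "x \<in> z_grading G d"
  then obtain c where c: "\<And>a. a \<in> Poly_Mapping.keys c \<Longrightarrow> total a = d \<and> Poly_Mapping.lookup c a \<in> G a"
    "x = (\<Sum>a\<in>Poly_Mapping.keys c. Poly_Mapping.lookup c a)"
    by (auto simp: z_grading_def)
  have "component a x = Poly_Mapping.lookup c a" for a
  proof (rule component_unique[OF _ _ _ c(2)])
    show "Poly_Mapping.lookup c a \<in> G a" for a
      using c(1)[of a] by (cases "a \<in> Poly_Mapping.keys c") (auto simp: in_keys_iff)
  qed (auto simp: in_keys_iff)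
  then show "\<forall>a. component a x \<noteq> 0 \<longrightarrow> total a = d"
    using c(1) by (auto simp: in_keys_iff)
next
  assume "\<forall>a. component a x \<noteq> 0 \<longrightarrow> total a = d"
  then show "x \<in> z_grading G d"
    unfolding z_grading_def using sum_component[of x] component_in_G
    by (auto intro!: exI[of _ "decomp x"] simp: in_keys_iff component_def)
qed

lemma G_subset_z_grading: "x \<in> G a \<Longrightarrow> x \<in> z_grading G (total a)"
  by (auto simp: z_grading_iff component_G split: if_splits)

lemma z_grading_sum: "(\<And>i. i \<in> I \<Longrightarrow> f i \<in> z_grading G d) \<Longrightarrow> (\<Sum>i\<in>I. f i) \<in> z_grading G d"
  unfolding z_grading_iff component_sum by (meson sum.not_neutral_contains_not_neutral)

text \<open>A polynomial homogeneous for the total degree need not be so for the Z^n-grading, hence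
  the passage to its monomials.\<close>

lemma z_grading_smul:
  assumes "f \<in> poly_z_part c" "x \<in> z_grading G d"
  shows "smul f x \<in> z_grading G (c + d)"
proof -
  have "smul (Poly_Mapping.single t r) x \<in> z_grading G (c + d)" if "t \<in> Poly_Mapping.keys f" for t r
    unfolding z_grading_iff
  proof (intro allI impI)
    fix a assume "component a (smul (Poly_Mapping.single t r) x) \<noteq> 0"
    then have "component (a - multidegree t) x \<noteq> 0"
      by (auto simp: component_smul[OF single_in_poly_zn_part])
    then have "total (a - multidegree t) = d"
      using assms(2) by (simp add: z_grading_iff)
    then show "total a = c + d"
      using assms(1) that by (simp add: total_diff poly_z_part_def)
  qed
  then have "(\<Sum>t\<in>Poly_Mapping.keys f. smul (Poly_Mapping.single t (Poly_Mapping.lookup f t)) x) \<in> z_grading G (c + d)"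
    by (intro z_grading_sum)
  then show ?thesis
    by (simp only: scale_sum_left[symmetric] poly_mapping_sum_single)
qed

sublocale z_graded_module smul "z_grading G"
proof
  show "0 \<in> z_grading G d" for d
    by (simp add: z_grading_iff)
  show "x + y \<in> z_grading G d" if "x \<in> z_grading G d" "y \<in> z_grading G d" for x y d
    using that unfolding z_grading_iff component_add by (metis add_0)
qed (rule z_grading_smul)

text \<open>The component of multidegree \<open>a\<close> of a Koszul chain; \<open>e\<^sub>F\<close> has degree \<open>indicator_vec F\<close>.\<close>

definition kcomp :: "int ^ 'n \<Rightarrow> ('n set \<Rightarrow> 'm) \<Rightarrow> 'n set \<Rightarrow> 'm"
  where "kcomp a u = (\<lambda>F. component (a - indicator_vec F) (u F))"

lemma kcomp_kchains: "ksupp UNIV q u \<Longrightarrow> kcomp a u \<in> kchains UNIV q a"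
  by (rule kchainsI) (auto simp: kcomp_def component_in_G ksupp_def)

text \<open>Each summand is homogeneous for the Z^n-grading: multiplication by x_i adds the degree
  that contraction removes from e_F.\<close>

lemma kd_kcomp: "kd (kcomp a u) F = kcomp a (kd u) F"
proof -
  have "smul (var i) (contract i (kcomp a u) F) = component (a - indicator_vec F) (smul (var i) (contract i u F))" for i
    by (simp add: component_smul[OF var_in_poly_zn_part] contract_def kcomp_def component_flip
        indicator_vec_insert diff_diff_add)
  then show ?thesis
    by (simp add: koszul_diff_def kcomp_def component_sum)
qed

lemma kcomp_of_kchains: "u \<in> kchains A q b \<Longrightarrow> kcomp a u F = (if a = b then u F else 0)"
  using component_G[OF kchains_G, of u A q b "a - indicator_vec F" F] by (simp add: kcomp_def)

lemma finite_kcomp: "finite {a. kcomp a u \<noteq> (\<lambda>F. 0)}"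
proof -
  have "{a. kcomp a u \<noteq> (\<lambda>F. 0)} \<subseteq> (\<Union>F. (\<lambda>a. a + indicator_vec F) ` {a. component a (u F) \<noteq> 0})"
  proof
    fix a assume "a \<in> {a. kcomp a u \<noteq> (\<lambda>F. 0)}"
    then obtain F where "component (a - indicator_vec F) (u F) \<noteq> 0"
      by (auto simp: kcomp_def)
    then have "a - indicator_vec F + indicator_vec F \<in> (\<lambda>a. a + indicator_vec F) ` {a. component a (u F) \<noteq> 0}"
      by (intro imageI) simp
    then show "a \<in> (\<Union>F. (\<lambda>a. a + indicator_vec F) ` {a. component a (u F) \<noteq> 0})"
      by auto
  qed
  then show ?thesis
    using finite_component by (auto intro: finite_subset)
qed

lemma sum_kcomp: "(\<Sum>a | kcomp a u \<noteq> (\<lambda>F. 0). kcomp a u F) = u F"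
proof -
  let ?T = "{a. kcomp a u \<noteq> (\<lambda>F. 0)}"
  have "(\<Sum>a\<in>?T. kcomp a u F) = (\<Sum>a\<in>(\<lambda>a. a - indicator_vec F) ` ?T. component a (u F))"
    by (subst sum.reindex) (auto simp: inj_on_def kcomp_def)
  also have "\<dots> = u F"
  proof (rule sum_component_superset)
    show "a \<in> (\<lambda>a. a - indicator_vec F) ` ?T" if "component a (u F) \<noteq> 0" for a
    proof -
      have "kcomp (a + indicator_vec F) u F \<noteq> 0"
        using that by (simp add: kcomp_def)
      then have "a + indicator_vec F - indicator_vec F \<in> (\<lambda>a. a - indicator_vec F) ` ?T"
        by (intro imageI) auto
      then show ?thesis
        by simp
    qed
  qed (simp add: finite_kcomp)
  finally show ?thesis .
qed

section \<open>Betti numbers and multigraded Koszul homology\<close>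

abbreviation koszul_cx :: "('n, 'k) free_complex"
  where "koszul_cx \<equiv> koszul_complex"

lemma shift_koszul [simp]: "shift koszul_complex q l = int q"
  by (simp add: koszul_complex_def)

lemma kd_untuple_cycle:
  assumes "v \<in> cycles koszul_cx q d"
  shows "kd (untuple q v) = (\<lambda>F. 0)"
proof (cases q)
  case 0
  then have "contract i (untuple q v) F = (0 :: 'm)" for i :: 'n and F
    by (simp add: contract_def untuple_def)
  then show ?thesis
    by (simp add: fun_eq_iff koszul_diff_def)
next
  case (Suc j)
  then have "tensor_diff smul koszul_cx (Suc j) v = (\<lambda>l. 0)"
    using assms by (simp add: cycles_def del: tensor_diff.simps)
  then show ?thesis
    unfolding Suc untuple_tensor_diff_koszul[symmetric] by (simp add: untuple_def)
qed

lemma tuple_in_chains_gr: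
  fixes u :: "'n set \<Rightarrow> 'm"
  assumes "\<And>F. u F \<in> z_grading G (d - int q)"
  shows "tuple q u \<in> tensor_chains_gr (z_grading G) koszul_cx q d"
  unfolding tensor_chains_gr_iff
proof (intro conjI allI)
  show "tuple q u l \<in> z_grading G (d - shift koszul_cx q l)" for l
    by (simp add: tuple_def assms H_0)
qed (rule tuple_in_chains)

lemma kchains_z_grading:
  assumes "u \<in> kchains A q a"
  shows "u F \<in> z_grading G (total a - int q)"
proof (cases "card F = q")
  case True
  then show ?thesis
    using G_subset_z_grading[OF kchains_G[OF assms, of F]] by (simp add: total_diff)
next
  case False
  then show ?thesis
    using kchains_eq_0[OF assms, of F] H_0 by simp
qed

text \<open>Otherwise each of the finitely many multigraded components of the cycle bounds, and the
  sum of their primitives is a primitive of v.\<close>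

lemma nonboundary_imp_nonzero_class:
  assumes v: "v \<in> cycles koszul_cx q d" "v \<notin> boundaries koszul_cx q d"
  shows "\<exists>a. total a = d \<and> nonzero_class q a"
proof (rule ccontr)
  assume none: "\<not> (\<exists>a. total a = d \<and> nonzero_class q a)"
  define u where "u = (untuple q v :: 'n set \<Rightarrow> 'm)"
  define T where "T = {a. kcomp a u \<noteq> (\<lambda>F. 0)}"
  have v_chain: "v \<in> tensor_chains koszul_cx q" "v \<in> tensor_chains_gr (z_grading G) koszul_cx q d"
    using v(1) by (auto simp: cycles_def tensor_chains_gr_def)
  have u_gr: "u F \<in> z_grading G (d - int q)" for F
    using v_chain(2) H_0 by (auto simp: tensor_chains_gr_iff u_def untuple_def)
  have supp_u: "ksupp UNIV q u"
    unfolding u_def by (rule ksupp_untuple)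
  have T: "total a = d" if aT: "a \<in> T" for a
  proof -
    obtain F where F: "component (a - indicator_vec F) (u F) \<noteq> 0"
      using aT by (auto simp: T_def kcomp_def)
    then have "card F = q"
      using ksuppD[OF supp_u, of F] by (cases "card F = q") auto
    moreover have "total (a - indicator_vec F) = d - int q"
      using u_gr[of F] F by (simp add: z_grading_iff)
    ultimately show ?thesis
      by (simp add: total_diff)
  qed
  have "\<exists>y\<in>kchains UNIV (Suc q) a. kd y = kcomp a u" if "a \<in> T" for a
  proof -
    have "kd (kcomp a u) = (\<lambda>F. 0)"
      unfolding fun_eq_iff kd_kcomp kd_untuple_cycle[OF v(1), folded u_def] by (simp add: kcomp_def)
    then have "kcomp a u \<in> kd ` kchains UNIV (Suc q) a"
      using none T[OF that] kcomp_kchains[OF supp_u, of a] unfolding nonzero_class_def essential_def by blast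
    then show ?thesis
      by force
  qed
  then obtain y where y: "\<And>a. a \<in> T \<Longrightarrow> y a \<in> kchains UNIV (Suc q) a"
    "\<And>a. a \<in> T \<Longrightarrow> kd (y a) = kcomp a u"
    by metis
  define w where "w = (\<lambda>F. \<Sum>a\<in>T. y a F)"
  have "ksupp UNIV (Suc q) w"
    unfolding ksupp_def w_def using kchains_eq_0[OF y(1)] by (auto intro!: sum.neutral)
  then have utw: "untuple (Suc q) (tuple (Suc q) w) = w"
    by (rule untuple_tuple)
  have "kd w F = (\<Sum>a\<in>T. kcomp a u F)" for F
    unfolding w_def kd_sum using y(2) by (intro sum.cong) auto
  then have "kd w = u"
    using sum_kcomp[of u, folded T_def] by (simp add: fun_eq_iff)
  then have "tensor_diff smul koszul_cx (Suc q) (tuple (Suc q) w) = v"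
    unfolding tensor_diff_koszul utw u_def by (simp add: tuple_untuple[OF v_chain(1)])
  moreover have "w F \<in> z_grading G (d - int (Suc q))" for F
    unfolding w_def using kchains_z_grading[OF y(1)] T by (intro z_grading_sum) metis
  then have "tuple (Suc q) w \<in> tensor_chains_gr (z_grading G) koszul_cx (Suc q) d"
    by (rule tuple_in_chains_gr)
  ultimately have "v \<in> boundaries koszul_cx q d"
    unfolding boundaries_def by blast
  with v(2) show False ..
qed

lemma tuple_essential_cycle:
  assumes "essential q a z"
  shows "tuple q z \<in> cycles koszul_cx q (total a)"
proof -
  have z: "z \<in> kchains UNIV q a" "kd z = (\<lambda>F. 0)"
    using assms by (auto simp: essential_def)
  have supp_z: "ksupp UNIV q z"
    unfolding ksupp_def using kchains_eq_0[OF z(1)] by blast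
  have "tensor_diff smul koszul_cx q (tuple q z) = (\<lambda>l. 0)"
  proof (cases q)
    case (Suc j)
    show ?thesis
      unfolding Suc tensor_diff_koszul untuple_tuple[OF supp_z[unfolded Suc]] z(2)
      by (simp add: tuple_def)
  qed simp
  then show ?thesis
    using tuple_in_chains_gr[OF kchains_z_grading[OF z(1)]] by (simp add: cycles_def)
qed

text \<open>The component of multidegree b of a primitive of the sum has boundary c b times the
  cycle z b; if c b were invertible, z b would be a boundary.\<close>

lemma essential_independent:
  assumes I: "finite I" and z: "\<And>a. a \<in> I \<Longrightarrow> essential q a (z a)"
    and sum: "(\<Sum>a\<in>I. tuple_scale (c a) (tuple q (z a))) \<in> boundaries koszul_cx q d" and b: "b \<in> I"
  shows "c b = 0"
proof (rule ccontr)
  assume cb: "c b \<noteq> 0"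
  have chain: "z a \<in> kchains UNIV q a" if "a \<in> I" for a
    using z[OF that] by (simp add: essential_def)
  define u where "u = (\<lambda>F. \<Sum>a\<in>I. smul (const_poly (c a)) (z a F))"
  have supp_u: "ksupp UNIV q u"
    unfolding ksupp_def u_def using kchains_eq_0[OF chain] by (auto intro!: sum.neutral)
  have "(\<Sum>a\<in>I. tuple_scale (c a) (tuple q (z a))) = tuple q u"
    unfolding fun_eq_iff sum_fun_apply by (auto simp: tuple_scale_def tuple_def u_def)
  then obtain w where w: "tuple q u = tensor_diff smul koszul_cx (Suc q) w"
    using sum by (auto simp: boundaries_def simp del: tensor_diff.simps)
  define y where "y = (untuple (Suc q) w :: 'n set \<Rightarrow> 'm)"
  have "u = kd y"
    unfolding y_def untuple_tensor_diff_koszul[symmetric] w[symmetric] using supp_u by (simp add: untuple_tuple)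
  then have "kd (kcomp b y) F = kcomp b u F" for F
    by (simp add: kd_kcomp)
  moreover have "kcomp b u F = smul (const_poly (c b)) (z b F)" for F
  proof -
    have "kcomp b u F = (\<Sum>a\<in>I. smul (const_poly (c a)) (kcomp b (z a) F))"
      by (simp add: kcomp_def u_def component_sum component_scale)
    also have "\<dots> = (\<Sum>a\<in>I. if a = b then smul (const_poly (c b)) (z b F) else 0)"
      by (intro sum.cong) (auto simp: kcomp_of_kchains[OF chain])
    finally show ?thesis
      using I b by simp
  qed
  ultimately have "kd (\<lambda>F. smul (const_poly (inverse (c b))) (kcomp b y F)) F = z b F" for F
    using cb by (simp add: kd_scale const_poly_mult[symmetric] const_poly_1)
  moreover have "(\<lambda>F. smul (const_poly (inverse (c b))) (kcomp b y F)) \<in> kchains UNIV (Suc q) b"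
  proof -
    have "kcomp b y \<in> kchains UNIV (Suc q) b"
      unfolding y_def by (rule kcomp_kchains[OF ksupp_untuple])
    then show ?thesis
      by (intro kchainsI) (auto intro: G_scale kchains_G simp: kchains_eq_0)
  qed
  ultimately have "z b \<in> kd ` kchains UNIV (Suc q) b"
    by (intro image_eqI) auto
  then show False
    using z[OF b] by (simp add: essential_def)
qed

end

section \<open>Cycles and boundaries as subspaces, and finite-dimensionality of the chains in each
  degree\<close>

context z_graded_module
begin

lemma subspace_cycles: "tuples.subspace (cycles P i d)"
proof (cases i)
  case 0
  then show ?thesis
    using subspace_tensor_chains_gr by (simp add: cycles_def)
next
  case (Suc j)
  note sub = subspace_tensor_chains_gr[of P i d]
  show ?thesis
    unfolding cycles_def Suc tensor_diff_eq
    using tuples.subspace_0[OF sub] tuples.subspace_add[OF sub] tuples.subspace_scale[OF sub]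
    by (intro tuples.subspaceI)
      (auto simp: apply_mat_add apply_mat_tuple_scale apply_mat_0 Suc zero_fun_def[symmetric] simp del: zero_fun_apply)
qed

lemma subspace_boundaries: "tuples.subspace (boundaries P i d)"
proof (rule tuples.subspaceI)
  note sub = subspace_tensor_chains_gr[of P "Suc i" d]
  have eq: "boundaries P i d = apply_mat (frank P (Suc i)) (diff_mat P i) ` tensor_chains_gr H P (Suc i) d"
    by (simp add: boundaries_def tensor_diff_eq del: tensor_diff.simps)
  show "0 \<in> boundaries P i d"
    unfolding eq using tuples.subspace_0[OF sub] apply_mat_0 by (metis image_eqI)
  show "x + y \<in> boundaries P i d" if "x \<in> boundaries P i d" "y \<in> boundaries P i d" for x y
    using that tuples.subspace_add[OF sub] unfolding eq by (auto simp: apply_mat_add[symmetric])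
  show "tuple_scale c x \<in> boundaries P i d" if "x \<in> boundaries P i d" for c x
    using that tuples.subspace_scale[OF sub] unfolding eq by (auto simp: apply_mat_tuple_scale[symmetric])
qed

lemma boundaries_subset_cycles:
  assumes "residue_resolution P e"
  shows "boundaries P i d \<subseteq> cycles P i d"
proof
  interpret P: residue_resolution P e by fact
  fix v assume "v \<in> boundaries P i d"
  then obtain w where w: "w \<in> tensor_chains_gr H P (Suc i) d" "v = apply_mat (frank P (Suc i)) (diff_mat P i) w"
    by (auto simp: boundaries_def tensor_diff_eq simp del: tensor_diff.simps)
  have "v \<in> tensor_chains_gr H P i d"
    unfolding w(2) by (rule apply_mat_chains[OF P.diff_mat_hom w(1)])
  moreover have "tensor_diff smul P i v = (\<lambda>l. 0)"
  proof (cases i)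
    case (Suc j)
    show ?thesis
      unfolding Suc tensor_diff_eq w(2) apply_mat_mult[symmetric] P.diff_mat_diff_mat
      by (simp add: apply_mat_def)
  qed simp
  ultimately show "v \<in> cycles P i d"
    by (simp add: cycles_def)
qed

lemma finite_span_chains:
  assumes "\<And>d. \<exists>X. finite X \<and> H d \<subseteq> scalars.span X"
  shows "\<exists>X. finite X \<and> tensor_chains_gr H P i d \<subseteq> tuples.span X"
proof -
  obtain X where X: "\<And>d. finite (X d)" "\<And>d. H d \<subseteq> scalars.span (X d)"
    using assms by metis
  define unit where "unit l x = (\<lambda>j. if j = l then x else 0 :: 'm)" for l :: nat and x
  define Y where "Y = (\<Union>l<frank P i. unit l ` X (d - shift P i l))"
  have span: "unit l x \<in> tuples.span Y" if "x \<in> scalars.span (X (d - shift P i l))" "l < frank P i" for l x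
    using that(1)
  proof (rule scalars.span_induct)
    show "unit l x \<in> tuples.span Y" if "x \<in> X (d - shift P i l)" for x
      using that \<open>l < frank P i\<close> by (intro tuples.span_base) (auto simp: Y_def)
    have "unit l 0 = 0" "unit l (x + y) = unit l x + unit l y"
      "unit l (smul (const_poly c) x) = tuple_scale c (unit l x)" for x y c
      by (auto simp: unit_def fun_eq_iff tuple_scale_def)
    then show "scalars.subspace {x. unit l x \<in> tuples.span Y}"
      by (intro scalars.subspaceI)
        (auto intro: tuples.span_add tuples.span_scale tuples.span_zero simp del: zero_fun_apply)
  qed
  have "v \<in> tuples.span Y" if v: "v \<in> tensor_chains_gr H P i d" for v
  proof -
    have "v = (\<Sum>l<frank P i. unit l (v l))"
      using v by (auto simp: fun_eq_iff sum_fun_apply unit_def tensor_chains_gr_def tensor_chains_def not_less)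
    also have "\<dots> \<in> tuples.span Y"
      using v X(2) by (intro tuples.span_sum span) (auto simp: tensor_chains_gr_def)
    finally show ?thesis .
  qed
  moreover have "finite Y"
    using X(1) by (simp add: Y_def)
  ultimately show ?thesis
    by blast
qed

end

context graded_module
begin

text \<open>The choice made in the definition of Tor is meaningful only if some resolution exists;
  the Koszul complex is one.\<close>

lemma ex_betti_resolution:
  "\<exists>P e. residue_resolution P e \<and>
    (\<forall>i d. betti smul G i d = quotient_dim smul (cycles P i d) (boundaries P i d))"
proof -
  define P :: "('n, 'k) free_complex"
    where "P = (SOME P. graded_free_resolution residue_smul residue_grading P)"
  have "\<exists>P :: ('n, 'k) free_complex. graded_free_resolution residue_smul residue_grading P"
    using koszul_resolution unfolding graded_free_resolution_residue_iff by blast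
  then have "graded_free_resolution residue_smul residue_grading P"
    unfolding P_def by (rule someI_ex)
  moreover have "betti smul G i d = quotient_dim smul (cycles P i d) (boundaries P i d)" for i d
    by (simp add: betti_def tor_dim_def Let_def cycles_def boundaries_def P_def del: tensor_diff.simps)
  ultimately show ?thesis
    unfolding graded_free_resolution_residue_iff by blast
qed

lemma betti_nonzero_imp:
  assumes "betti smul G q d \<noteq> 0"
  shows "\<exists>a. total a = d \<and> nonzero_class q a"
proof -
  obtain P e where P: "residue_resolution P e"
    and betti: "betti smul G q d = quotient_dim smul (cycles P q d) (boundaries P q d)"
    using ex_betti_resolution by blast
  obtain v where "v \<in> cycles P q d" "v \<notin> boundaries P q d"
    using quotient_dim_nonzero assms unfolding betti by blast
  moreover obtain c A where "apply_mat c A ` cycles P q d \<subseteq> cycles koszul_cx q d"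
    "\<forall>z\<in>cycles P q d. apply_mat c A z \<in> boundaries koszul_cx q d \<longrightarrow> z \<in> boundaries P q d"
    using homology_embedding[OF P koszul_resolution, of q] by blast
  ultimately show ?thesis
    using nonboundary_imp_nonzero_class[of "apply_mat c A v" q d] by blast
qed

text \<open>The embedding goes from Koszul homology into the homology of the chosen resolution. It
  reflects boundaries, so one nonzero class for each multidegree in I yields an independent family
  there.\<close>

lemma card_le_betti:
  assumes fin: "\<And>d. \<exists>X. finite X \<and> z_grading G d \<subseteq> scalars.span X"
    and I: "finite I" "\<And>a. a \<in> I \<Longrightarrow> total a = d \<and> nonzero_class q a"
  shows "card I \<le> betti smul G q d"
proof -
  obtain P e where P: "residue_resolution P e"
    and betti: "betti smul G q d = quotient_dim smul (cycles P q d) (boundaries P q d)"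
    using ex_betti_resolution by blast
  obtain c A where A: "apply_mat c A ` cycles koszul_cx q d \<subseteq> cycles P q d"
    "\<forall>z\<in>cycles koszul_cx q d. apply_mat c A z \<in> boundaries P q d \<longrightarrow> z \<in> boundaries koszul_cx q d"
    using homology_embedding[OF koszul_resolution P, of q] by blast
  obtain z where z: "\<And>a. a \<in> I \<Longrightarrow> essential q a (z a)"
    using I(2) unfolding nonzero_class_def by metis
  have cyc: "tuple q (z a) \<in> cycles koszul_cx q d" if "a \<in> I" for a
    using tuple_essential_cycle[OF z[OF that]] I(2)[OF that] by simp
  obtain X where X: "finite X" "tensor_chains_gr (z_grading G) P q d \<subseteq> tuples.span X"
    using finite_span_chains[OF fin] by blast
  have "card I \<le> quotient_dim smul (cycles P q d) (boundaries P q d)"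
  proof (rule quotient_dim_ge[where f = "\<lambda>a. apply_mat c A (tuple q (z a))", OF subspace_cycles _ X(1)
        subspace_boundaries boundaries_subset_cycles[OF P] I(1)])
    show "cycles P q d \<subseteq> tuples.span X"
      using X(2) by (auto simp: cycles_def)
    show "apply_mat c A (tuple q (z a)) \<in> cycles P q d" if "a \<in> I" for a
      using A(1) cyc[OF that] by blast
    fix r a assume sum: "(\<Sum>a\<in>I. tuple_scale (r a) (apply_mat c A (tuple q (z a)))) \<in> boundaries P q d" and a: "a \<in> I"
    have "(\<Sum>a\<in>I. tuple_scale (r a) (tuple q (z a))) \<in> cycles koszul_cx q d"
      using cyc by (intro tuples.subspace_sum[OF subspace_cycles] tuples.subspace_scale[OF subspace_cycles])
    then have "(\<Sum>a\<in>I. tuple_scale (r a) (tuple q (z a))) \<in> boundaries koszul_cx q d"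
      using A(2) sum by (simp only: apply_mat_tuple_scale[symmetric] apply_mat_sum[symmetric])
    then show "r a = 0"
      using essential_independent[OF I(1) z _ a] by blast
  qed
  then show ?thesis
    by (simp only: betti)
qed

end

section \<open>Finitely generated modules\<close>

lemma finite_monomials_of_degree: "finite {t :: 'n::finite \<Rightarrow>\<^sub>0 nat. total (multidegree t) = d}"
proof -
  have "Poly_Mapping.lookup t i \<le> nat d" if "total (multidegree t) = d" for t :: "'n \<Rightarrow>\<^sub>0 nat" and i
  proof -
    have "int (Poly_Mapping.lookup t i) \<le> (\<Sum>j\<in>UNIV. int (Poly_Mapping.lookup t j))"
      by (rule member_le_sum) auto
    then show ?thesis
      using that by (simp add: total_def multidegree_def)
  qed
  then have "Poly_Mapping.lookup ` {t :: 'n \<Rightarrow>\<^sub>0 nat. total (multidegree t) = d} \<subseteq> (\<Pi>\<^sub>E i\<in>UNIV. {..nat d})"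
    by (auto simp: PiE_def extensional_def)
  then have "finite (Poly_Mapping.lookup ` {t :: 'n \<Rightarrow>\<^sub>0 nat. total (multidegree t) = d})"
    by (rule finite_subset) (intro finite_PiE; simp)
  then show ?thesis
    by (rule finite_imageD) (simp add: inj_on_def lookup_inject)
qed

lemma total_multidegree_nonneg: "0 \<le> total (multidegree t)"
  by (simp add: total_def multidegree_def sum_nonneg)

context graded_module
begin

text \<open>Generators are stored together with a degree, since the degree of h cannot be read off
  when h = 0.\<close>

definition monomial_multiples :: "((int ^ 'n) \<times> 'm) set \<Rightarrow> int \<Rightarrow> 'm set"
  where "monomial_multiples B d =
    (\<lambda>(t, a, h). smul (Poly_Mapping.single t 1) h) ` {(t, a, h). (a, h) \<in> B \<and> total (multidegree t) + total a = d}"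

text \<open>Homogeneous components of generators again generate. The K-span of their monomial
  multiples is closed under all polynomials, hence is a submodule that contains the
  generators.\<close>

lemma span_UNIV_monomial_multiples:
  assumes "finitely_generated smul"
  shows "\<exists>B. finite B \<and> (\<forall>(a, h)\<in>B. h \<in> G a) \<and> scalars.span (\<Union>d. monomial_multiples B d) = UNIV"
proof -
  obtain C where C: "finite C" "span C = UNIV"
    using assms unfolding finitely_generated_def by blast
  define B where "B = (\<Union>x\<in>C. (\<lambda>a. (a, component a x)) ` Poly_Mapping.keys (decomp x))"
  define Y where "Y = (\<Union>d. monomial_multiples B d)"
  have Y: "y \<in> Y \<longleftrightarrow> (\<exists>t a h. (a, h) \<in> B \<and> y = smul (Poly_Mapping.single t 1) h)" for y
    unfolding Y_def monomial_multiples_def by force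
  have "smul (Poly_Mapping.single t c) y \<in> scalars.span Y" if "y \<in> scalars.span Y" for t c y
    using that
  proof (rule scalars.span_induct)
    fix y assume "y \<in> Y"
    then obtain s a h where h: "(a, h) \<in> B" "y = smul (Poly_Mapping.single s 1) h"
      unfolding Y by blast
    have "smul (Poly_Mapping.single t c) y = smul (const_poly c) (smul (Poly_Mapping.single (t + s) 1) h)"
      by (simp add: h(2) mult_single const_poly_def)
    also have "\<dots> \<in> scalars.span Y"
      using h(1) Y by (intro scalars.span_scale scalars.span_base) blast
    finally show "smul (Poly_Mapping.single t c) y \<in> scalars.span Y" .
  next
    show "scalars.subspace {y. smul (Poly_Mapping.single t c) y \<in> scalars.span Y}"
    proof (rule scalars.subspaceI)
      show "smul (const_poly r) x \<in> {y. smul (Poly_Mapping.single t c) y \<in> scalars.span Y}"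
        if "x \<in> {y. smul (Poly_Mapping.single t c) y \<in> scalars.span Y}" for x r
        using scalars.span_scale[of "smul (Poly_Mapping.single t c) x" Y r] that
        by (simp add: mult.commute)
    qed (auto simp: scale_right_distrib intro: scalars.span_add scalars.span_zero)
  qed
  then have "(\<Sum>t\<in>Poly_Mapping.keys f. smul (Poly_Mapping.single t (Poly_Mapping.lookup f t)) y) \<in> scalars.span Y"
    if "y \<in> scalars.span Y" for f y
    using that by (intro scalars.span_sum)
  then have smul_Y: "smul f y \<in> scalars.span Y" if "y \<in> scalars.span Y" for f y
    using that by (simp only: scale_sum_left[symmetric] poly_mapping_sum_single)
  have "subspace (scalars.span Y)"
    by (intro subspaceI scalars.span_zero scalars.span_add smul_Y)
  moreover have "C \<subseteq> scalars.span Y"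
  proof
    fix x assume x: "x \<in> C"
    have "component a x \<in> scalars.span Y" if "a \<in> Poly_Mapping.keys (decomp x)" for a
    proof -
      have "(a, component a x) \<in> B"
        using x that by (auto simp: B_def)
      moreover have "component a x = smul (Poly_Mapping.single 0 1) (component a x)"
        by simp
      ultimately show ?thesis
        using Y by (intro scalars.span_base) blast
    qed
    then have "(\<Sum>a\<in>Poly_Mapping.keys (decomp x). component a x) \<in> scalars.span Y"
      by (rule scalars.span_sum)
    then show "x \<in> scalars.span Y"
      by (simp add: sum_component)
  qed
  ultimately have "scalars.span Y = UNIV"
    using span_minimal[of C "scalars.span Y"] C(2) by blast
  moreover have "finite B" "\<forall>(a, h)\<in>B. h \<in> G a"
    using C(1) component_in_G by (auto simp: B_def)
  ultimately show ?thesis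
    unfolding Y_def by blast
qed

text \<open>Each spanning element is homogeneous, so taking components of a linear combination
  discards all multiples of other degrees.\<close>

lemma z_grading_span_monomial_multiples:
  assumes B: "\<forall>(a, h)\<in>B. h \<in> G a" "scalars.span (\<Union>d. monomial_multiples B d) = UNIV"
  shows "z_grading G d \<subseteq> scalars.span (monomial_multiples B d)"
proof
  have component_span: "component a x \<in> scalars.span (monomial_multiples B (total a))" for a x
  proof -
    have "x \<in> scalars.span (\<Union>d. monomial_multiples B d)"
      using B(2) by simp
    then show ?thesis
    proof (rule scalars.span_induct)
      fix y assume "y \<in> (\<Union>d. monomial_multiples B d)"
      then obtain d t a' h where y: "(a', h) \<in> B" "y = smul (Poly_Mapping.single t 1) h"
        unfolding monomial_multiples_def by auto
      then have "y \<in> G (multidegree t + a')"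
        using B(1) by (auto intro!: G_smul single_in_poly_zn_part)
      then have "component a y = (if a = multidegree t + a' then y else 0)"
        by (rule component_G)
      moreover have "y \<in> monomial_multiples B (total (multidegree t + a'))"
        using y unfolding monomial_multiples_def by (force simp: total_add)
      ultimately show "component a y \<in> scalars.span (monomial_multiples B (total a))"
        by (auto intro: scalars.span_base scalars.span_zero)
    next
      show "scalars.subspace {x. component a x \<in> scalars.span (monomial_multiples B (total a))}"
        by (rule scalars.subspaceI)
          (auto simp: component_add component_scale intro: scalars.span_add scalars.span_zero scalars.span_scale)
    qed
  qed
  fix x assume x: "x \<in> z_grading G d"
  have "(\<Sum>a\<in>Poly_Mapping.keys (decomp x). component a x) \<in> scalars.span (monomial_multiples B d)"
  proof (rule scalars.span_sum)
    fix a assume "a \<in> Poly_Mapping.keys (decomp x)"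
    then have "total a = d"
      using x by (auto simp: z_grading_iff component_def in_keys_iff)
    then show "component a x \<in> scalars.span (monomial_multiples B d)"
      using component_span[of a x] by simp
  qed
  then show "x \<in> scalars.span (monomial_multiples B d)"
    by (simp add: sum_component)
qed

lemma finite_monomial_multiples:
  assumes "finite B"
  shows "finite (monomial_multiples B d)"
proof -
  have "{(t, a, h). (a, h) \<in> B \<and> total (multidegree t) + total a = d} \<subseteq>
      (\<Union>(a, h)\<in>B. (\<lambda>t. (t, a, h)) ` {t. total (multidegree t) = d - total a})"
    by force
  then have "finite {(t, a, h). (a, h) \<in> B \<and> total (multidegree t) + total a = d}"
    by (rule finite_subset) (use assms finite_monomials_of_degree in auto)
  then show ?thesis
    unfolding monomial_multiples_def by (rule finite_imageI)
qed

lemma finitely_generated_z_grading: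
  assumes "finitely_generated smul"
  shows "\<exists>X. finite X \<and> z_grading G d \<subseteq> scalars.span X"
proof -
  obtain B where B: "finite B" "\<forall>(a, h)\<in>B. h \<in> G a" "scalars.span (\<Union>d. monomial_multiples B d) = UNIV"
    using span_UNIV_monomial_multiples[OF assms] by blast
  show ?thesis
    using finite_monomial_multiples[OF B(1)] z_grading_span_monomial_multiples[OF B(2,3)] by blast
qed

lemma finitely_generated_bounded:
  assumes "finitely_generated smul"
  shows "\<exists>b. bounded_graded_module smul G b"
proof -
  obtain B where B: "finite B" "\<forall>(a, h)\<in>B. h \<in> G a" "scalars.span (\<Union>d. monomial_multiples B d) = UNIV"
    using span_UNIV_monomial_multiples[OF assms] by blast
  \<comment> \<open>Monomials have nonnegative degree, so nothing lies below the least degree of a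
    generator. The inserted 0 keeps the minimum defined when B is empty.\<close>
  define b where "b = Min (insert 0 ((\<lambda>(a, h). total a) ` B))"
  have b: "b \<le> total a" if "(a, h) \<in> B" for a h
    unfolding b_def using B(1) that by (intro Min_le) force+
  have "G a = {0}" if a: "total a < b" for a
  proof -
    have "monomial_multiples B (total a) = {}"
    proof (rule ccontr)
      assume "monomial_multiples B (total a) \<noteq> {}"
      then obtain t :: "'n \<Rightarrow>\<^sub>0 nat" and a' h where "(a', h) \<in> B" "total (multidegree t) + total a' = total a"
        unfolding monomial_multiples_def by auto
      then show False
        using b[of a' h] total_multidegree_nonneg[of t] a by simp
    qed
    then have "z_grading G (total a) \<subseteq> {0}"
      using z_grading_span_monomial_multiples[OF B(2,3), of "total a"] by (simp add: scalars.span_empty)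
    then show ?thesis
      using G_subset_z_grading G_0 by blast
  qed
  then have "bounded_graded_module smul G b"
    by unfold_locales
  then show ?thesis
    by blast
qed

end

section \<open>The minimum that defines d_k, and the final count\<close>

lemma Least_int_bounded:
  fixes J :: "int set"
  assumes "j \<in> J" "\<And>i. i \<in> J \<Longrightarrow> c \<le> i"
  shows "(LEAST j. j \<in> J) \<in> J" "\<And>i. i \<in> J \<Longrightarrow> (LEAST j. j \<in> J) \<le> i"
proof -
  \<comment> \<open>The integers are not well-ordered; subtracting the lower bound c moves the
    search for a minimum to the natural numbers.\<close>
  obtain m where m: "m \<in> J" "\<And>i. i \<in> J \<Longrightarrow> nat (m - c) \<le> nat (i - c)"
    using ex_has_least_nat[of "\<lambda>j. j \<in> J" j "\<lambda>j. nat (j - c)"] assms(1) by blast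
  have le: "m \<le> i" if "i \<in> J" for i
    using m(2)[OF that] assms(2)[OF that] assms(2)[OF m(1)] by linarith
  then have "(LEAST j. j \<in> J) = m"
    using m(1) by (intro Least_equality)
  then show "(LEAST j. j \<in> J) \<in> J" "\<And>i. i \<in> J \<Longrightarrow> (LEAST j. j \<in> J) \<le> i"
    using m(1) le by auto
qed

text \<open>A chain of homological degree q has its coefficients in total degree |a| - q, and these
  are 0 below b.\<close>

lemma (in bounded_graded_module) nonzero_class_ge:
  assumes "nonzero_class q a"
  shows "b \<le> total a - int q"
proof (rule ccontr)
  assume less: "\<not> b \<le> total a - int q"
  obtain z where z: "essential q a z"
    using assms by (auto simp: nonzero_class_def)
  then have chain: "z \<in> kchains UNIV q a"
    by (simp add: essential_def)
  have "z F = 0" for F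
  proof (cases "card F = q")
    case True
    then show ?thesis
      using kchains_G[OF chain, of F] G_below[of "a - indicator_vec F"] less by (simp add: total_diff)
  next
    case False
    then show ?thesis
      using kchains_eq_0[OF chain] by simp
  qed
  then have "z = (\<lambda>F. 0)" ..
  then show False
    using z not_essential_0 by simp
qed

theorem theorem3p3:
  fixes smul :: "('n::finite, 'k::field) mpoly \<Rightarrow> 'm::ab_group_add \<Rightarrow> 'm"
    and G :: "int ^ 'n \<Rightarrow> 'm set"
    and k p :: nat
  assumes "k \<in> {1..CARD('n)}"
    and "zn_graded_module smul G"
    and "finitely_generated smul"
    and "p \<ge> k"
    and "betti_lin smul G k p \<noteq> 0"
  shows "\<forall>i\<in>{k..p}. betti_lin smul G k i \<ge> p choose i"
proof
  fix i assume i: "i \<in> {k..p}"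
  have "graded_module smul G"
    using assms(2) by (rule graded_module.intro)
  then obtain b where "bounded_graded_module smul G b"
    using graded_module.finitely_generated_bounded assms(3) by blast
  then interpret bounded_graded_module smul G b .
  note card_le = card_le_betti[OF finitely_generated_z_grading[OF assms(3)]]
  define D where "D = lin_degree smul G k"
  define J where "J = {j. betti smul G k (int k + j) \<noteq> 0} \<union> {regularity smul G}"
  \<comment> \<open>The value of the regularity plays no role: any integer in its place gives the same argument.\<close>
  have D_eq: "D = (LEAST j. j \<in> J)"
    by (simp only: D_def J_def lin_degree_def)
  \<comment> \<open>An element of J is either the regularity itself or the strand of a nonzero
    class, so J is bounded below and \<open>LEAST\<close> is a true minimum.\<close>
  have "min b (regularity smul G) \<le> j" if j: "j \<in> J" for j
  proof (cases "betti smul G k (int k + j) = 0")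
    case False
    then obtain a where "total a = int k + j" "nonzero_class k a"
      using betti_nonzero_imp by blast
    then show ?thesis
      using nonzero_class_ge[of k a] by simp
  qed (use j in \<open>auto simp: J_def\<close>)
  then have D_le: "D \<le> j" if "j \<in> J" for j
    unfolding D_eq using Least_int_bounded(2)[of "regularity smul G" J "min b (regularity smul G)"] that
    by (simp only: J_def UnI2 singletonI)
  have V: "strands_vanish k D"
    unfolding strands_vanish_def
  proof (intro allI impI notI)
    fix a assume a: "total a - int k < D" "nonzero_class k a"
    \<comment> \<open>A single nonzero class already makes the Betti number positive and puts its
      strand into J, against the minimality of D.\<close>
    have "card {a} \<le> betti smul G k (total a)"
      using a(2) by (intro card_le) auto
    then have "total a - int k \<in> J"
      by (simp add: J_def)
    then show False
      using D_le a(1) by force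
  qed
  obtain a where a: "total a = int p + D" "nonzero_class p a"
    using betti_nonzero_imp assms(5) unfolding betti_lin_def D_def by blast
  obtain I where I: "finite I" "p choose i \<le> card I" "\<And>a'. a' \<in> I \<Longrightarrow> total a' = int i + D \<and> nonzero_class i a'"
    using card_nonzero_class[OF V a(2), of i] a(1) i by auto
  have "card I \<le> betti smul G i (int i + D)"
    using I by (intro card_le)
  then show "p choose i \<le> betti_lin smul G k i"
    using I(2) by (simp add: betti_lin_def D_def)
qed

end
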